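(* Let $(M,F)$ be a connected non-Riemannian two-dimensional generalized Berwald manifold. Then $(M,F)$ is a Landsberg surface if and only if it is a Berwald surface.
   Context: A Finsler metric on a manifold $M$ is a continuous function $F\colon TM\to\mathbb{R}$, smooth off the zero section, with $F(tv)=tF(v)$ for $t>0$, such that with $E=\frac12F^2$ the Hessian $g_{ij}=\partial^2E/\partial y^i\partial y^j$ is positive definite at all nonzero vectors. It is Riemannian if $F$ is the norm of a Riemannian metric. Local coordinates $u^i$ on $M$ induce coordinates $x^i=u^i\circ\pi$, $y^i(v)=v(u^i)$ on $TM$, where $\pi\colon TM\to M$ is the projection; repeated indices are summed, and $(g^{ij})=(g_{ij})^{-1}$. A linear connection on $M$ (not necessarily torsion-free) is compatible with $F$ if its parallel transports preserve the Finslerian length $F$ of tangent vectors. Finsler manifolds admitting compatible linear connections are called generalized Berwald manifolds. Put $G^l=\frac12 g^{lm}\big(y^k\frac{\partial^2E}{\partial y^m\partial x^k}-\frac{\partial E}{\partial x^m}\big)$, $G^l_i=\partial G^l/\partial y^i$, $G^l_{ij}=\partial G^l_i/\partial y^j$, $G^l_{ijk}=\partial G^l_{ij}/\partial y^k$, $X_i^h=\frac{\partial}{\partial x^i}-G^l_i\frac{\partial}{\partial y^l}$. The Landsberg tensor is $P^l_{ij}=\frac12 g^{lm}\big(X_i^h(g_{jm})-G^k_{ij}g_{km}-G^k_{im}g_{jk}\big)$, and the mixed curvature is $P^l_{ijk}=-G^l_{ijk}$. A Finsler manifold is a Landsberg manifold if its Landsberg tensor vanishes, and a Berwald manifold if its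 mixed curvature vanishes (surface means dimension 2). *)

theory Defs
  imports "HOL-Analysis.Analysis"
begin

section \<open>Smooth maps between normed spaces\<close>

text \<open>Iterated differentiability; meant for open \<open>S\<close>.\<close>

primrec Ck_on :: "nat \<Rightarrow> ('a::real_normed_vector \<Rightarrow> 'b::real_normed_vector) \<Rightarrow> 'a set \<Rightarrow> bool" where
  "Ck_on 0 f S \<longleftrightarrow> continuous_on S f"
| "Ck_on (Suc k) f S \<longleftrightarrow>
     (\<forall>x\<in>S. f differentiable (at x)) \<and> (\<forall>v. Ck_on k (\<lambda>x. frechet_derivative f (at x) v) S)"

definition smooth_on :: "'a set \<Rightarrow> ('a::real_normed_vector \<Rightarrow> 'b::real_normed_vector) \<Rightarrow> bool" where
  "smooth_on S f \<longleftrightarrow> (\<forall>k. Ck_on k f S)"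


section \<open>Smooth manifolds\<close>

text \<open>
  The manifold is a whole type \<open>'m\<close>, its dimension is the cardinality of the index type \<open>'n\<close>.
  A chart is a pair of its domain and its coordinate map \<open>u\<close>; the values of \<open>u\<close> outside the
  domain are irrelevant.
\<close>

type_synonym ('m, 'n) chart = "'m set \<times> ('m \<Rightarrow> real ^ 'n)"

abbreviation dom_chart :: "('m, 'n::finite) chart \<Rightarrow> 'm set" where
  "dom_chart c \<equiv> fst c"

abbreviation im_chart :: "('m, 'n::finite) chart \<Rightarrow> (real ^ 'n) set" where
  "im_chart c \<equiv> snd c ` fst c"

definition inv_chart :: "('m, 'n::finite) chart \<Rightarrow> real ^ 'n \<Rightarrow> 'm" where
  "inv_chart c = inv_into (fst c) (snd c)"

definition is_chart :: "('m::topological_space, 'n::finite) chart \<Rightarrow> bool" where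
  "is_chart c \<longleftrightarrow> open (dom_chart c) \<and> open (im_chart c) \<and>
     homeomorphism (dom_chart c) (im_chart c) (snd c) (inv_chart c)"

definition compatible_charts ::
    "('m::topological_space, 'n::finite) chart \<Rightarrow> ('m, 'n) chart \<Rightarrow> bool" where
  "compatible_charts c d \<longleftrightarrow>
     smooth_on (snd c ` (dom_chart c \<inter> dom_chart d)) (snd d \<circ> inv_chart c) \<and>
     smooth_on (snd d ` (dom_chart c \<inter> dom_chart d)) (snd c \<circ> inv_chart d)"

text \<open>Smooth structures are maximal atlases, so that \<open>A\<close> contains all local coordinate systems.\<close>

definition smooth_manifold ::
    "('m::{t2_space, second_countable_topology}, 'n::finite) chart set \<Rightarrow> bool" where
  "smooth_manifold A \<longleftrightarrow>
     (\<forall>c\<in>A. is_chart c) \<and>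
     (\<Union>c\<in>A. dom_chart c) = UNIV \<and>
     (\<forall>c\<in>A. \<forall>d\<in>A. compatible_charts c d) \<and>
     (\<forall>c. is_chart c \<and> (\<forall>d\<in>A. compatible_charts c d) \<longrightarrow> c \<in> A)"

definition smooth_fun_at ::
    "('m::topological_space, 'n::finite) chart set \<Rightarrow> 'm \<Rightarrow> ('m \<Rightarrow> real) \<Rightarrow> bool" where
  "smooth_fun_at A p f \<longleftrightarrow>
     (\<exists>U. open U \<and> p \<in> U \<and>
       (\<forall>c\<in>A. smooth_on (snd c ` (U \<inter> dom_chart c)) (f \<circ> inv_chart c)))"


section \<open>Tangent vectors and vector fields\<close>

text \<open>
  A tangent vector at \<open>p\<close> is a derivation of the functions smooth near \<open>p\<close>, namely
  \<open>f \<mapsto> w\<^sup>i \<partial>f/\<partial>u\<^sup>i (p)\<close> for a chart \<open>u\<close> around \<open>p\<close> and a coordinate vector \<open>w\<close>. It is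
  extended by \<open>0\<close> to functions that are not smooth near \<open>p\<close>. Vector space operations are
  pointwise. The base point is not part of a tangent vector, hence is carried separately.
\<close>

type_synonym 'm tvec = "('m \<Rightarrow> real) \<Rightarrow> real"

definition coord_vec ::
    "('m::topological_space, 'n::finite) chart set \<Rightarrow> ('m, 'n) chart \<Rightarrow> 'm \<Rightarrow> real ^ 'n \<Rightarrow> 'm tvec" where
  "coord_vec A c p w = (\<lambda>f.
     if smooth_fun_at A p f then frechet_derivative (f \<circ> inv_chart c) (at (snd c p)) w else 0)"

definition tangent_space ::
    "('m::topological_space, 'n::finite) chart set \<Rightarrow> 'm \<Rightarrow> 'm tvec set" where
  "tangent_space A p = {coord_vec A c p w | c w. c \<in> A \<and> p \<in> dom_chart c}"

text \<open>The induced fibre coordinates \<open>y\<^sup>i(v) = v(u\<^sup>i)\<close>.\<close>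

definition comps :: "('m, 'n::finite) chart \<Rightarrow> 'm tvec \<Rightarrow> real ^ 'n" where
  "comps c v = (\<chi> i. v (\<lambda>q. snd c q $ i))"

abbreviation tadd :: "'m tvec \<Rightarrow> 'm tvec \<Rightarrow> 'm tvec" where
  "tadd v w \<equiv> (\<lambda>f. v f + w f)"

abbreviation tscale :: "real \<Rightarrow> 'm tvec \<Rightarrow> 'm tvec" where
  "tscale a v \<equiv> (\<lambda>f. a * v f)"

definition smooth_field_on ::
    "('m::topological_space, 'n::finite) chart set \<Rightarrow> 'm set \<Rightarrow> ('m \<Rightarrow> 'm tvec) \<Rightarrow> bool" where
  "smooth_field_on A U Y \<longleftrightarrow>
     (\<forall>q\<in>U. Y q \<in> tangent_space A q) \<and>
     (\<forall>c\<in>A. smooth_on (snd c ` (U \<inter> dom_chart c)) (\<lambda>x. comps c (Y (inv_chart c x))))"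

definition smooth_field_at ::
    "('m::topological_space, 'n::finite) chart set \<Rightarrow> 'm \<Rightarrow> ('m \<Rightarrow> 'm tvec) \<Rightarrow> bool" where
  "smooth_field_at A p Y \<longleftrightarrow> (\<exists>U. open U \<and> p \<in> U \<and> smooth_field_on A U Y)"

text \<open>The coordinate vector field \<open>\<partial>/\<partial>u\<^sup>i\<close>, meaningful on the domain of \<open>c\<close>.\<close>

definition coord_field ::
    "('m::topological_space, 'n::finite) chart set \<Rightarrow> ('m, 'n) chart \<Rightarrow> 'n \<Rightarrow> 'm \<Rightarrow> 'm tvec" where
  "coord_field A c i = (\<lambda>q. coord_vec A c q (axis i 1))"


section \<open>Linear connections and parallel transport\<close>

text \<open>
  \<open>D p v Y\<close> is the covariant derivative at \<open>p\<close>, in the direction \<open>v\<close>, of a vector field \<open>Y\<close>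
  defined and smooth near \<open>p\<close>. No condition is put on the torsion.
\<close>

definition linear_connection ::
    "('m::topological_space, 'n::finite) chart set \<Rightarrow>
     ('m \<Rightarrow> 'm tvec \<Rightarrow> ('m \<Rightarrow> 'm tvec) \<Rightarrow> 'm tvec) \<Rightarrow> bool" where
  "linear_connection A D \<longleftrightarrow>
     (\<forall>p. \<forall>v\<in>tangent_space A p. \<forall>Y. smooth_field_at A p Y \<longrightarrow> D p v Y \<in> tangent_space A p) \<and>
     (\<forall>p. \<forall>v\<in>tangent_space A p. \<forall>Y Z. smooth_field_at A p Y \<and>
        (\<exists>U. open U \<and> p \<in> U \<and> (\<forall>q\<in>U. Y q = Z q)) \<longrightarrow> D p v Y = D p v Z) \<and>
     (\<forall>p. \<forall>v\<in>tangent_space A p. \<forall>w\<in>tangent_space A p. \<forall>a b Y. smooth_field_at A p Y \<longrightarrow>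
        D p (tadd (tscale a v) (tscale b w)) Y = tadd (tscale a (D p v Y)) (tscale b (D p w Y))) \<and>
     (\<forall>p. \<forall>v\<in>tangent_space A p. \<forall>Y Z. smooth_field_at A p Y \<and> smooth_field_at A p Z \<longrightarrow>
        D p v (\<lambda>q. tadd (Y q) (Z q)) = tadd (D p v Y) (D p v Z)) \<and>
     (\<forall>p. \<forall>v\<in>tangent_space A p. \<forall>f Y. smooth_fun_at A p f \<and> smooth_field_at A p Y \<longrightarrow>
        D p v (\<lambda>q. tscale (f q) (Y q)) = tadd (tscale (v f) (Y p)) (tscale (f p) (D p v Y))) \<and>
     (\<forall>U X Y. open U \<and> smooth_field_on A U X \<and> smooth_field_on A U Y \<longrightarrow>
        smooth_field_on A U (\<lambda>q. D q (X q) Y))"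

text \<open>\<open>christoffel A D c p k i j\<close> is the \<open>k\<close>-th component of the derivative of \<open>\<partial>/\<partial>u\<^sup>j\<close> along \<open>\<partial>/\<partial>u\<^sup>i\<close>.\<close>

definition christoffel ::
    "('m::topological_space, 'n::finite) chart set \<Rightarrow>
     ('m \<Rightarrow> 'm tvec \<Rightarrow> ('m \<Rightarrow> 'm tvec) \<Rightarrow> 'm tvec) \<Rightarrow>
     ('m, 'n) chart \<Rightarrow> 'm \<Rightarrow> 'n \<Rightarrow> 'n \<Rightarrow> 'n \<Rightarrow> real" where
  "christoffel A D c p k i j = comps c (D p (coord_field A c i p) (coord_field A c j)) $ k"

definition smooth_curve ::
    "('m::topological_space, 'n::finite) chart set \<Rightarrow> real set \<Rightarrow> (real \<Rightarrow> 'm) \<Rightarrow> bool" where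
  "smooth_curve A J \<gamma> \<longleftrightarrow> continuous_on J \<gamma> \<and>
     (\<forall>c\<in>A. smooth_on {t\<in>J. \<gamma> t \<in> dom_chart c} (snd c \<circ> \<gamma>))"

definition parallel_along ::
    "('m::topological_space, 'n::finite) chart set \<Rightarrow>
     ('m \<Rightarrow> 'm tvec \<Rightarrow> ('m \<Rightarrow> 'm tvec) \<Rightarrow> 'm tvec) \<Rightarrow>
     real set \<Rightarrow> (real \<Rightarrow> 'm) \<Rightarrow> (real \<Rightarrow> 'm tvec) \<Rightarrow> bool" where
  "parallel_along A D J \<gamma> V \<longleftrightarrow>
     (\<forall>t\<in>J. V t \<in> tangent_space A (\<gamma> t)) \<and>
     (\<forall>c\<in>A. \<forall>t\<in>J. \<gamma> t \<in> dom_chart c \<longrightarrow>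
        ((\<lambda>s. comps c (V s)) has_vector_derivative
           (\<chi> k. - (\<Sum>i\<in>UNIV. \<Sum>j\<in>UNIV. christoffel A D c (\<gamma> t) k i j *
                     vector_derivative (snd c \<circ> \<gamma>) (at t) $ i * comps c (V t) $ j))) (at t))"

text \<open>
  The parallel transport along \<open>\<gamma>\<close> from time \<open>s\<close> to time \<open>t\<close>, as a relation between tangent
  vectors at \<open>\<gamma> s\<close> and at \<open>\<gamma> t\<close>. The open interval \<open>J\<close> makes the derivatives at the end
  points two-sided.
\<close>

definition parallel_transport ::
    "('m::topological_space, 'n::finite) chart set \<Rightarrow>
     ('m \<Rightarrow> 'm tvec \<Rightarrow> ('m \<Rightarrow> 'm tvec) \<Rightarrow> 'm tvec) \<Rightarrow>
     real set \<Rightarrow> (real \<Rightarrow> 'm) \<Rightarrow> real \<Rightarrow> real \<Rightarrow> 'm tvec \<Rightarrow> 'm tvec \<Rightarrow> bool" where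
  "parallel_transport A D J \<gamma> s t v w \<longleftrightarrow>
     (\<exists>V. parallel_along A D J \<gamma> V \<and> V s = v \<and> V t = w)"


section \<open>Finsler metrics\<close>

text \<open>
  A function on the tangent bundle is given as \<open>F p v\<close> for \<open>v\<close> tangent at \<open>p\<close>.
  \<open>loc A c F\<close> is its expression in the induced coordinates \<open>(x, y)\<close>; continuity and smoothness
  on the tangent bundle refer to these coordinates.
\<close>

definition loc ::
    "('m::topological_space, 'n::finite) chart set \<Rightarrow> ('m, 'n) chart \<Rightarrow>
     ('m \<Rightarrow> 'm tvec \<Rightarrow> real) \<Rightarrow> (real ^ 'n) \<times> (real ^ 'n) \<Rightarrow> real" where
  "loc A c F = (\<lambda>(x, y). F (inv_chart c x) (coord_vec A c (inv_chart c x) y))"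

definition energy :: "('m \<Rightarrow> 'm tvec \<Rightarrow> real) \<Rightarrow> 'm \<Rightarrow> 'm tvec \<Rightarrow> real" where
  "energy F p v = (F p v)\<^sup>2 / 2"

definition pdx :: "'n \<Rightarrow> ((real ^ 'n) \<times> (real ^ 'n) \<Rightarrow> real) \<Rightarrow> (real ^ 'n::finite) \<times> (real ^ 'n) \<Rightarrow> real" where
  "pdx i f z = frechet_derivative f (at z) (axis i 1, 0)"

definition pdy :: "'n \<Rightarrow> ((real ^ 'n) \<times> (real ^ 'n) \<Rightarrow> real) \<Rightarrow> (real ^ 'n::finite) \<times> (real ^ 'n) \<Rightarrow> real" where
  "pdy i f z = frechet_derivative f (at z) (0, axis i 1)"

text \<open>
  The following operators take the coordinate expression \<open>E\<close> of the energy. Upper indices are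
  written first: \<open>mixed_curvature E l i j k\<close> is \<open>P\<^sup>l\<^sub>i\<^sub>j\<^sub>k\<close>.
\<close>

definition fundamental_tensor ::
    "((real ^ 'n) \<times> (real ^ 'n) \<Rightarrow> real) \<Rightarrow> 'n::finite \<Rightarrow> 'n \<Rightarrow> (real ^ 'n) \<times> (real ^ 'n) \<Rightarrow> real" where
  "fundamental_tensor E i j = pdy i (pdy j E)"

definition fundamental_matrix ::
    "((real ^ 'n) \<times> (real ^ 'n) \<Rightarrow> real) \<Rightarrow> (real ^ 'n::finite) \<times> (real ^ 'n) \<Rightarrow> real ^ 'n ^ 'n" where
  "fundamental_matrix E z = (\<chi> i j. fundamental_tensor E i j z)"

definition inverse_tensor ::
    "((real ^ 'n) \<times> (real ^ 'n) \<Rightarrow> real) \<Rightarrow> 'n::finite \<Rightarrow> 'n \<Rightarrow> (real ^ 'n) \<times> (real ^ 'n) \<Rightarrow> real" where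
  "inverse_tensor E i j z = matrix_inv (fundamental_matrix E z) $ i $ j"

definition spray ::
    "((real ^ 'n) \<times> (real ^ 'n) \<Rightarrow> real) \<Rightarrow> 'n::finite \<Rightarrow> (real ^ 'n) \<times> (real ^ 'n) \<Rightarrow> real" where
  "spray E l z = (1/2) * (\<Sum>m\<in>UNIV. inverse_tensor E l m z *
     ((\<Sum>k\<in>UNIV. snd z $ k * pdy m (pdx k E) z) - pdx m E z))"

definition spray1 ::
    "((real ^ 'n) \<times> (real ^ 'n) \<Rightarrow> real) \<Rightarrow> 'n::finite \<Rightarrow> 'n \<Rightarrow> (real ^ 'n) \<times> (real ^ 'n) \<Rightarrow> real" where
  "spray1 E l i = pdy i (spray E l)"

definition spray2 ::
    "((real ^ 'n) \<times> (real ^ 'n) \<Rightarrow> real) \<Rightarrow> 'n::finite \<Rightarrow> 'n \<Rightarrow> 'n \<Rightarrow> (real ^ 'n) \<times> (real ^ 'n) \<Rightarrow> real" where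
  "spray2 E l i j = pdy j (spray1 E l i)"

definition spray3 ::
    "((real ^ 'n) \<times> (real ^ 'n) \<Rightarrow> real) \<Rightarrow> 'n::finite \<Rightarrow> 'n \<Rightarrow> 'n \<Rightarrow> 'n \<Rightarrow> (real ^ 'n) \<times> (real ^ 'n) \<Rightarrow> real" where
  "spray3 E l i j k = pdy k (spray2 E l i j)"

text \<open>The horizontal vector field \<open>X\<^sub>i\<^sup>h\<close> applied to \<open>f\<close>.\<close>

definition hor ::
    "((real ^ 'n) \<times> (real ^ 'n) \<Rightarrow> real) \<Rightarrow> 'n::finite \<Rightarrow>
     ((real ^ 'n) \<times> (real ^ 'n) \<Rightarrow> real) \<Rightarrow> (real ^ 'n) \<times> (real ^ 'n) \<Rightarrow> real" where
  "hor E i f z = pdx i f z - (\<Sum>l\<in>UNIV. spray1 E l i z * pdy l f z)"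

definition landsberg_tensor ::
    "((real ^ 'n) \<times> (real ^ 'n) \<Rightarrow> real) \<Rightarrow> 'n::finite \<Rightarrow> 'n \<Rightarrow> 'n \<Rightarrow> (real ^ 'n) \<times> (real ^ 'n) \<Rightarrow> real" where
  "landsberg_tensor E l i j z = (1/2) * (\<Sum>m\<in>UNIV. inverse_tensor E l m z *
     (hor E i (fundamental_tensor E j m) z
      - (\<Sum>k\<in>UNIV. spray2 E k i j z * fundamental_tensor E k m z)
      - (\<Sum>k\<in>UNIV. spray2 E k i m z * fundamental_tensor E j k z)))"

definition mixed_curvature ::
    "((real ^ 'n) \<times> (real ^ 'n) \<Rightarrow> real) \<Rightarrow> 'n::finite \<Rightarrow> 'n \<Rightarrow> 'n \<Rightarrow> 'n \<Rightarrow> (real ^ 'n) \<times> (real ^ 'n) \<Rightarrow> real" where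
  "mixed_curvature E l i j k z = - spray3 E l i j k z"

definition finsler_metric ::
    "('m::topological_space, 'n::finite) chart set \<Rightarrow> ('m \<Rightarrow> 'm tvec \<Rightarrow> real) \<Rightarrow> bool" where
  "finsler_metric A F \<longleftrightarrow>
     (\<forall>c\<in>A. continuous_on (im_chart c \<times> UNIV) (loc A c F)) \<and>
     (\<forall>c\<in>A. smooth_on (im_chart c \<times> (UNIV - {0})) (loc A c F)) \<and>
     (\<forall>p. \<forall>v\<in>tangent_space A p. \<forall>t>0. F p (tscale t v) = t * F p v) \<and>
     (\<forall>c\<in>A. \<forall>x\<in>im_chart c. \<forall>y. y \<noteq> 0 \<longrightarrow>
        (\<forall>w. w \<noteq> 0 \<longrightarrow> w \<bullet> (fundamental_matrix (loc A c (energy F)) (x, y) *v w) > 0))"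

definition riemannian_metric ::
    "('m::topological_space, 'n::finite) chart set \<Rightarrow> ('m \<Rightarrow> 'm tvec \<Rightarrow> 'm tvec \<Rightarrow> real) \<Rightarrow> bool" where
  "riemannian_metric A h \<longleftrightarrow>
     (\<forall>p. \<forall>u\<in>tangent_space A p. \<forall>v\<in>tangent_space A p. \<forall>w\<in>tangent_space A p. \<forall>a b.
        h p (tadd (tscale a u) (tscale b v)) w = a * h p u w + b * h p v w) \<and>
     (\<forall>p. \<forall>v\<in>tangent_space A p. \<forall>w\<in>tangent_space A p. h p v w = h p w v) \<and>
     (\<forall>p. \<forall>v\<in>tangent_space A p. v \<noteq> (\<lambda>_. 0) \<longrightarrow> h p v v > 0) \<and>
     (\<forall>c\<in>A. \<forall>i j. smooth_on (im_chart c)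
        (\<lambda>x. let p = inv_chart c x in h p (coord_field A c i p) (coord_field A c j p)))"

definition riemannian ::
    "('m::topological_space, 'n::finite) chart set \<Rightarrow> ('m \<Rightarrow> 'm tvec \<Rightarrow> real) \<Rightarrow> bool" where
  "riemannian A F \<longleftrightarrow>
     (\<exists>h. riemannian_metric A h \<and> (\<forall>p. \<forall>v\<in>tangent_space A p. F p v = sqrt (h p v v)))"

definition compatible_connection ::
    "('m::topological_space, 'n::finite) chart set \<Rightarrow> ('m \<Rightarrow> 'm tvec \<Rightarrow> real) \<Rightarrow>
     ('m \<Rightarrow> 'm tvec \<Rightarrow> ('m \<Rightarrow> 'm tvec) \<Rightarrow> 'm tvec) \<Rightarrow> bool" where
  "compatible_connection A F D \<longleftrightarrow>
     (\<forall>J \<gamma> s t v w. open J \<and> is_interval J \<and> smooth_curve A J \<gamma> \<and> s \<in> J \<and> t \<in> J \<and>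
        parallel_transport A D J \<gamma> s t v w \<longrightarrow> F (\<gamma> t) w = F (\<gamma> s) v)"

definition finsler_manifold ::
    "('m::{t2_space, second_countable_topology}, 'n::finite) chart set \<Rightarrow>
     ('m \<Rightarrow> 'm tvec \<Rightarrow> real) \<Rightarrow> bool" where
  "finsler_manifold A F \<longleftrightarrow> smooth_manifold A \<and> finsler_metric A F"

definition generalized_berwald_manifold ::
    "('m::{t2_space, second_countable_topology}, 'n::finite) chart set \<Rightarrow>
     ('m \<Rightarrow> 'm tvec \<Rightarrow> real) \<Rightarrow> bool" where
  "generalized_berwald_manifold A F \<longleftrightarrow> finsler_manifold A F \<and>
     (\<exists>D. linear_connection A D \<and> compatible_connection A F D)"

definition landsberg_manifold ::
    "('m::{t2_space, second_countable_topology}, 'n::finite) chart set \<Rightarrow>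
     ('m \<Rightarrow> 'm tvec \<Rightarrow> real) \<Rightarrow> bool" where
  "landsberg_manifold A F \<longleftrightarrow> finsler_manifold A F \<and>
     (\<forall>c\<in>A. \<forall>x\<in>im_chart c. \<forall>y. y \<noteq> 0 \<longrightarrow>
        (\<forall>l i j. landsberg_tensor (loc A c (energy F)) l i j (x, y) = 0))"

definition berwald_manifold ::
    "('m::{t2_space, second_countable_topology}, 'n::finite) chart set \<Rightarrow>
     ('m \<Rightarrow> 'm tvec \<Rightarrow> real) \<Rightarrow> bool" where
  "berwald_manifold A F \<longleftrightarrow> finsler_manifold A F \<and>
     (\<forall>c\<in>A. \<forall>x\<in>im_chart c. \<forall>y. y \<noteq> 0 \<longrightarrow>
        (\<forall>l i j k. mixed_curvature (loc A c (energy F)) l i j k (x, y) = 0))"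

end

theory Submission
  imports Defs
begin

text \<open>
  The two conditions are equivalent on each tangent plane separately. Fix a chart and a point \<open>x\<close>, let
  \<open>e y = E (x, y)\<close> be the energy on the tangent plane at \<open>x\<close>, \<open>e\<^sub>i\<close> and \<open>e\<^sub>i\<^sub>j\<close> its partial derivatives,
  and \<open>\<Gamma>\<^sup>k\<^sub>i\<^sub>j\<close> the Christoffel symbols of a compatible connection.

  Parallel vector fields along the coordinate lines exist locally, and \<open>F\<close> is constant on them. Hence
  \<open>\<partial>E/\<partial>x\<^sup>i = \<Gamma>\<^sup>k\<^sub>i\<^sub>j y\<^sup>j e\<^sub>k\<close> (\<open>compatible_horizontal_constancy\<close>), so all the \<open>x\<close>-derivatives in the spray and in
  the Landsberg tensor become expressions in \<open>e\<close>. In dimension two the torsion is a vector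
  \<open>\<tau>\<^sup>r = \<Gamma>\<^sup>r\<^sub>1\<^sub>2 - \<Gamma>\<^sup>r\<^sub>2\<^sub>1\<close>, and \<open>2 G\<^sup>l = \<Gamma>\<^sup>l\<^sub>k\<^sub>j y\<^sup>k y\<^sup>j + H\<^sup>l\<close> with \<open>H\<^sup>l = (\<beta>/\<kappa>) V\<^sup>l\<close>, where \<open>\<beta> = \<tau>\<^sup>r e\<^sub>r\<close>,
  \<open>\<kappa> = det (e\<^sub>i\<^sub>j)\<close> and \<open>V = (- e\<^sub>2, e\<^sub>1)\<close> (\<open>spray_on_plane\<close>). The Berwald condition says that the third
  derivatives \<open>H\<^sup>l\<^sub>i\<^sub>j\<^sub>k\<close> vanish. Differentiating the identity \<open>\<partial>E/\<partial>x\<^sup>i = G\<^sup>l\<^sub>i e\<^sub>l\<close> twice shows that the Landsberg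
  condition says \<open>e\<^sub>l H\<^sup>l\<^sub>i\<^sub>j\<^sub>k = 0\<close> (\<open>landsberg_bracket_eq\<close>). So one implication is immediate.

  For the other one, differentiate along \<open>V\<close>, which is tangent to the level curves of \<open>e\<close>, and write
  \<open>f'\<close> for the derivative of \<open>f\<close>. Then \<open>y' = V\<close>, \<open>V' = - \<kappa> y\<close>, and \<open>\<beta>' = - \<kappa> b\<close>, \<open>b' = \<beta>\<close> for
  \<open>b = \<tau>\<^sup>1 y\<^sup>2 - \<tau>\<^sup>2 y\<^sup>1\<close>. The contraction \<open>e\<^sub>l H\<^sup>l\<^sub>i\<^sub>j\<^sub>k V\<^sup>i V\<^sup>j V\<^sup>k\<close> reduces to
  \<open>- 2 e \<beta> (3 \<kappa>'\<^sup>2 - 2 \<kappa> \<kappa>'') / \<kappa>\<^sup>2\<close> (\<open>landsberg_contraction\<close>). If \<open>\<tau> = 0\<close>, then \<open>H = 0\<close>. If \<open>\<tau> \<noteq> 0\<close>, then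
  the zeros of \<open>\<beta>\<close> on a level curve are simple, so that \<open>3 \<kappa>'\<^sup>2 = 2 \<kappa> \<kappa>''\<close> everywhere; that is, \<open>q = \<kappa>'/\<kappa>\<close>
  satisfies \<open>q' = q\<^sup>2/2\<close>. The level curves are closed, and at the extrema of \<open>q\<close> this gives \<open>q = 0\<close>. So
  \<open>\<kappa>\<close> is constant, which forces \<open>e\<close> to be a quadratic form (\<open>cartan_tensor_zero\<close>); then \<open>H\<close> is
  quadratic as well (\<open>torsion_spray_quadratic\<close>).
\<close>

section \<open>Calculus of smooth maps\<close>

lemma Ck_on_cong:
  fixes f g :: "'a::real_normed_vector \<Rightarrow> 'b::real_normed_vector"
  assumes "open S" and "\<And>x. x \<in> S \<Longrightarrow> f x = g x" and "Ck_on k f S"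
  shows "Ck_on k g S"
  using assms(2,3)
proof (induction k arbitrary: f g)
  case 0
  then show ?case using continuous_on_cong[of S S f g] by simp
next
  case (Suc k)
  have d: "f differentiable (at x)" if "x \<in> S" for x using Suc.prems(2) that by simp
  have g: "g differentiable (at x)" if "x \<in> S" for x
    using d[OF that] Suc.prems(1) \<open>open S\<close> that
    by (metis differentiable_def has_derivative_transform_within_open)
  have eq: "frechet_derivative f (at x) v = frechet_derivative g (at x) v" if "x \<in> S" for x v
    using frechet_derivative_transform_within_open[OF d[OF that] \<open>open S\<close> that] Suc.prems(1) by simp
  have "Ck_on k (\<lambda>x. frechet_derivative g (at x) v) S" for v
    by (rule Suc.IH[where f="\<lambda>x. frechet_derivative f (at x) v"]) (use eq Suc.prems(2) in auto)
  then show ?case using g by simp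
qed

lemma Ck_on_Suc_imp: "Ck_on (Suc k) f S \<Longrightarrow> Ck_on k f S"
proof (induction k arbitrary: f)
  case 0
  then show ?case
    by (auto intro!: continuous_at_imp_continuous_on differentiable_imp_continuous_within)
next
  case (Suc k)
  have "Ck_on k (\<lambda>x. frechet_derivative f (at x) v) S" for v
    by (rule Suc.IH) (use Suc.prems in simp)
  then show ?case using Suc.prems by simp
qed

lemma Ck_on_subset: "Ck_on k f S \<Longrightarrow> T \<subseteq> S \<Longrightarrow> Ck_on k f T"
proof (induction k arbitrary: f)
  case 0 then show ?case by (auto intro: continuous_on_subset)
next
  case (Suc k) then show ?case by auto
qed

lemma Ck_on_const: "Ck_on k (\<lambda>x. c) S"
  by (induction k arbitrary: c) auto

lemma Ck_on_bounded_linear: "bounded_linear L \<Longrightarrow> Ck_on k L S"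
proof (cases k)
  case 0
  assume "bounded_linear L"
  then show ?thesis using 0 by (simp add: linear_continuous_on)
next
  case (Suc m)
  assume L: "bounded_linear L"
  then have "(L has_derivative L) (at x)" for x by (rule bounded_linear_imp_has_derivative)
  then have "frechet_derivative L (at x) = L" "L differentiable at x" for x
    by (auto simp: frechet_derivative_at[symmetric] differentiable_def)
  then show ?thesis using Suc by (simp add: Ck_on_const)
qed

text \<open>It suffices to know some expression \<open>f'\<close> for the derivative on \<open>S\<close>.\<close>

lemma Ck_on_SucI:
  assumes "open S" and "\<And>x. x \<in> S \<Longrightarrow> (f has_derivative f' x) (at x)"
    and "\<And>v. Ck_on k (\<lambda>x. f' x v) S"
  shows "Ck_on (Suc k) f S"
proof -
  have "Ck_on k (\<lambda>x. frechet_derivative f (at x) v) S" for v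
    by (rule Ck_on_cong[OF assms(1) _ assms(3)[of v]]) (metis assms(2) frechet_derivative_at)
  then show ?thesis using assms(2) by (auto simp: differentiable_def)
qed

lemma Ck_on_has_derivative:
  "Ck_on (Suc k) f S \<Longrightarrow> x \<in> S \<Longrightarrow> (f has_derivative frechet_derivative f (at x)) (at x)"
  using frechet_derivative_works by auto

lemma Ck_on_add:
  assumes "open S" "Ck_on k f S" "Ck_on k g S"
  shows "Ck_on k (\<lambda>x. f x + g x) S"
  using assms(2,3)
proof (induction k arbitrary: f g)
  case 0 then show ?case by (auto intro: continuous_on_add)
next
  case (Suc k)
  have "Ck_on k (\<lambda>x. frechet_derivative f (at x) v + frechet_derivative g (at x) v) S" for v
    using Suc by auto
  with has_derivative_add[OF Ck_on_has_derivative[OF Suc.prems(1)] Ck_on_has_derivative[OF Suc.prems(2)]]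
  show ?case by (rule Ck_on_SucI[OF assms(1)])
qed

lemma Ck_on_bilinear:
  fixes prod :: "'b::real_normed_vector \<Rightarrow> 'c::real_normed_vector \<Rightarrow> 'd::real_normed_vector"
  assumes "bounded_bilinear prod" "open S" "Ck_on k f S" "Ck_on k g S"
  shows "Ck_on k (\<lambda>x. prod (f x) (g x)) S"
  using assms(3,4)
proof (induction k arbitrary: f g)
  case 0 then show ?case using bounded_bilinear.continuous_on[OF assms(1)] by auto
next
  case (Suc k)
  have "Ck_on k (\<lambda>x. prod (f x) (frechet_derivative g (at x) v) +
          prod (frechet_derivative f (at x) v) (g x)) S" for v
    using Suc by (intro Ck_on_add assms(2) Suc.IH Ck_on_Suc_imp[of k f] Ck_on_Suc_imp[of k g]) auto
  with bounded_bilinear.FDERIV[OF assms(1)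
      Ck_on_has_derivative[OF Suc.prems(1)] Ck_on_has_derivative[OF Suc.prems(2)]]
  show ?case by (rule Ck_on_SucI[OF assms(2)])
qed

lemma Ck_on_bounded_linear_comp:
  assumes "bounded_linear L" "open S" "Ck_on k f S"
  shows "Ck_on k (\<lambda>x. L (f x)) S"
  using assms(3)
proof (induction k arbitrary: f)
  case 0 then show ?case using bounded_linear.continuous_on[OF assms(1)] by auto
next
  case (Suc k)
  have "Ck_on k (\<lambda>x. L (frechet_derivative f (at x) v)) S" for v using Suc by auto
  with bounded_linear.has_derivative[OF assms(1) Ck_on_has_derivative[OF Suc.prems]]
  show ?case by (rule Ck_on_SucI[OF assms(2)])
qed

lemma Ck_on_sum:
  assumes "open S" "\<And>i. i \<in> I \<Longrightarrow> Ck_on k (f i) S"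
  shows "Ck_on k (\<lambda>x. \<Sum>i\<in>I. f i x) S"
  using assms(2)
proof (induction I rule: infinite_finite_induct)
  case (infinite A) then show ?case by (simp add: Ck_on_const)
next
  case empty then show ?case by (simp add: Ck_on_const)
next
  case (insert i I) then show ?case by (auto intro!: Ck_on_add assms(1))
qed

lemma Ck_on_inverse:
  fixes f :: "'a::real_normed_vector \<Rightarrow> real"
  assumes "open S" "Ck_on k f S" "\<And>x. x \<in> S \<Longrightarrow> f x \<noteq> 0"
  shows "Ck_on k (\<lambda>x. inverse (f x)) S"
  using assms(2)
proof (induction k)
  case 0 then show ?case using assms(3) by (auto intro: continuous_on_inverse)
next
  case (Suc k)
  have i: "Ck_on k (\<lambda>x. inverse (f x)) S" using Suc Ck_on_Suc_imp by blast
  have "Ck_on k (\<lambda>x. - (inverse (f x) * frechet_derivative f (at x) v * inverse (f x))) S" for v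
    using i Suc.prems
    by (intro Ck_on_bounded_linear_comp[OF bounded_linear_minus[OF bounded_linear_ident]]
          Ck_on_bilinear[OF bounded_bilinear_mult] assms(1)) auto
  with Deriv.has_derivative_inverse[OF assms(3) Ck_on_has_derivative[OF Suc.prems]]
  show ?case by (rule Ck_on_SucI[OF assms(1)])
qed

lemma Ck_on_compose:
  fixes f :: "'a::real_normed_vector \<Rightarrow> 'b::euclidean_space"
    and g :: "'b \<Rightarrow> 'c::real_normed_vector"
  assumes "open S" "f ` S \<subseteq> T" "Ck_on k f S" "Ck_on k g T"
  shows "Ck_on k (\<lambda>x. g (f x)) S"
  using assms(3,4)
proof (induction k arbitrary: g)
  case 0 then show ?case using assms(2) by (auto intro: continuous_on_compose2)
next
  case (Suc k)
  have fd: "f differentiable at x" if "x \<in> S" for x using Suc.prems that by auto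
  have gd: "g differentiable at (f x)" if "x \<in> S" for x using Suc.prems that assms(2) by auto
  have expand: "frechet_derivative g (at (f x)) w
      = (\<Sum>b\<in>Basis. (w \<bullet> b) *\<^sub>R frechet_derivative g (at (f x)) b)" if "x \<in> S" for x w
  proof -
    have l: "linear (frechet_derivative g (at (f x)))" using gd[OF that] by (rule linear_frechet_derivative)
    have "frechet_derivative g (at (f x)) w
       = frechet_derivative g (at (f x)) (\<Sum>b\<in>Basis. (w \<bullet> b) *\<^sub>R b)"
      by (simp add: euclidean_representation)
    also have "\<dots> = (\<Sum>b\<in>Basis. (w \<bullet> b) *\<^sub>R frechet_derivative g (at (f x)) b)"
      by (simp add: linear_sum[OF l] linear_scale[OF l])
    finally show ?thesis .
  qed
  have "Ck_on k (\<lambda>x. \<Sum>b\<in>Basis. (frechet_derivative f (at x) v \<bullet> b) *\<^sub>R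
                 frechet_derivative g (at (f x)) b) S" for v
  proof (intro Ck_on_sum Ck_on_bilinear[OF bounded_bilinear_scaleR] assms(1))
    fix b :: 'b
    show "Ck_on k (\<lambda>x. frechet_derivative f (at x) v \<bullet> b) S"
      using Suc.prems by (intro Ck_on_bounded_linear_comp[OF bounded_linear_inner_left] assms(1)) auto
    show "Ck_on k (\<lambda>x. frechet_derivative g (at (f x)) b) S"
      using Suc.IH[of "\<lambda>y. frechet_derivative g (at y) b"] Suc.prems Ck_on_Suc_imp by auto
  qed
  then show ?case
  proof (rule Ck_on_SucI[OF assms(1), rotated])
    fix x assume x: "x \<in> S"
    have "((\<lambda>x. g (f x)) has_derivative (\<lambda>v. frechet_derivative g (at (f x)) (frechet_derivative f (at x) v))) (at x)"
      using fd[OF x] gd[OF x] has_derivative_compose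
      by (simp add: frechet_derivative_works)
    then show "((\<lambda>x. g (f x)) has_derivative (\<lambda>v. \<Sum>b\<in>Basis. (frechet_derivative f (at x) v \<bullet> b) *\<^sub>R
                 frechet_derivative g (at (f x)) b)) (at x)"
      by (subst (asm) expand[OF x])
  qed
qed

lemma smooth_on_cong:
  assumes "open S" "\<And>x. x \<in> S \<Longrightarrow> f x = g x" "smooth_on S f"
  shows "smooth_on S g"
  using assms Ck_on_cong unfolding smooth_on_def by blast

lemma smooth_on_subset: "smooth_on S f \<Longrightarrow> T \<subseteq> S \<Longrightarrow> smooth_on T f"
  unfolding smooth_on_def using Ck_on_subset by blast

lemma smooth_on_const: "smooth_on S (\<lambda>x. c)"
  by (simp add: smooth_on_def Ck_on_const)

lemma smooth_on_bounded_linear: "bounded_linear L \<Longrightarrow> smooth_on S L"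
  by (simp add: smooth_on_def Ck_on_bounded_linear)

lemma smooth_on_add: "open S \<Longrightarrow> smooth_on S f \<Longrightarrow> smooth_on S g \<Longrightarrow> smooth_on S (\<lambda>x. f x + g x)"
  by (simp add: smooth_on_def Ck_on_add)

lemma smooth_on_bounded_linear_comp:
  "bounded_linear L \<Longrightarrow> open S \<Longrightarrow> smooth_on S f \<Longrightarrow> smooth_on S (\<lambda>x. L (f x))"
  by (simp add: smooth_on_def Ck_on_bounded_linear_comp)

lemma smooth_on_minus:
  "open S \<Longrightarrow> smooth_on S f \<Longrightarrow> smooth_on S (\<lambda>x. - f x)"
  using smooth_on_bounded_linear_comp[OF bounded_linear_minus[OF bounded_linear_ident]] by auto

lemma smooth_on_diff: "open S \<Longrightarrow> smooth_on S f \<Longrightarrow> smooth_on S g \<Longrightarrow> smooth_on S (\<lambda>x. f x - g x)"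
  using smooth_on_add[of S f "\<lambda>x. - g x"] smooth_on_minus[of S g] by simp

lemma smooth_on_mult:
  fixes f g :: "'a::real_normed_vector \<Rightarrow> real"
  shows "open S \<Longrightarrow> smooth_on S f \<Longrightarrow> smooth_on S g \<Longrightarrow> smooth_on S (\<lambda>x. f x * g x)"
  by (simp add: smooth_on_def Ck_on_bilinear[OF bounded_bilinear_mult])

lemma smooth_on_scaleR:
  "open S \<Longrightarrow> smooth_on S f \<Longrightarrow> smooth_on S g \<Longrightarrow> smooth_on S (\<lambda>x. f x *\<^sub>R g x)"
  by (simp add: smooth_on_def Ck_on_bilinear[OF bounded_bilinear_scaleR])

lemma smooth_on_sum:
  "open S \<Longrightarrow> (\<And>i. i \<in> I \<Longrightarrow> smooth_on S (f i)) \<Longrightarrow> smooth_on S (\<lambda>x. \<Sum>i\<in>I. f i x)"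
  by (simp add: smooth_on_def Ck_on_sum)

lemma smooth_on_divide:
  fixes f g :: "'a::real_normed_vector \<Rightarrow> real"
  assumes "open S" "smooth_on S f" "smooth_on S g" "\<And>x. x \<in> S \<Longrightarrow> g x \<noteq> 0"
  shows "smooth_on S (\<lambda>x. f x / g x)"
proof -
  have "smooth_on S (\<lambda>x. inverse (g x))"
    using assms by (simp add: smooth_on_def Ck_on_inverse)
  from smooth_on_mult[OF assms(1,2) this] show ?thesis by (simp add: divide_inverse)
qed

lemma smooth_on_compose:
  fixes f :: "'a::real_normed_vector \<Rightarrow> 'b::euclidean_space"
  shows "open S \<Longrightarrow> f ` S \<subseteq> T \<Longrightarrow> smooth_on S f \<Longrightarrow> smooth_on T g \<Longrightarrow> smooth_on S (\<lambda>x. g (f x))"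
  unfolding smooth_on_def by (blast intro: Ck_on_compose)

lemma smooth_on_nth:
  fixes f :: "'a::real_normed_vector \<Rightarrow> real ^ 'n"
  shows "open S \<Longrightarrow> smooth_on S f \<Longrightarrow> smooth_on S (\<lambda>x. f x $ i)"
  by (rule smooth_on_bounded_linear_comp[OF bounded_linear_vec_nth])

lemma smooth_on_frechet_derivative:
  "smooth_on S f \<Longrightarrow> smooth_on S (\<lambda>x. frechet_derivative f (at x) v)"
  unfolding smooth_on_def using Ck_on.simps(2) by blast

lemma smooth_on_imp_differentiable: "smooth_on S f \<Longrightarrow> x \<in> S \<Longrightarrow> f differentiable (at x)"
  unfolding smooth_on_def using Ck_on.simps(2)[of 0] by blast

lemma smooth_on_imp_has_derivative:
  "smooth_on S f \<Longrightarrow> x \<in> S \<Longrightarrow> (f has_derivative frechet_derivative f (at x)) (at x)"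
  using smooth_on_imp_differentiable frechet_derivative_works by blast

lemma smooth_on_imp_continuous_on: "smooth_on S f \<Longrightarrow> continuous_on S f"
  unfolding smooth_on_def using Ck_on.simps(1) by blast

lemma linear_axis_expansion:
  fixes f :: "real ^ 'n \<Rightarrow> 'b::real_vector"
  assumes "linear f"
  shows "(\<Sum>k\<in>UNIV. (w $ k) *\<^sub>R f (axis k 1)) = f w"
proof -
  have "f w = f (\<Sum>k\<in>UNIV. (w $ k) *\<^sub>R axis k 1)"
    using basis_expansion[of w] by (simp add: scalar_mult_eq_scaleR)
  then show ?thesis by (simp add: linear_sum[OF assms] linear_scale[OF assms])
qed

lemma has_derivative_along_line:
  assumes "(f has_derivative f') (at (x + t *\<^sub>R u))"
  shows "((\<lambda>t. f (x + t *\<^sub>R u)) has_vector_derivative f' u) (at t)"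
proof -
  have "((\<lambda>t. x + t *\<^sub>R u) has_derivative (\<lambda>t. t *\<^sub>R u)) (at t)"
    by (auto intro!: derivative_eq_intros)
  from has_derivative_compose[OF this assms]
  have "((\<lambda>t. f (x + t *\<^sub>R u)) has_derivative (\<lambda>t. f' (t *\<^sub>R u))) (at t)" .
  moreover have "f' (t *\<^sub>R u) = t *\<^sub>R f' u" for t
    using assms has_derivative_linear linear_scale by blast
  ultimately show ?thesis by (simp add: has_vector_derivative_def)
qed

text \<open>The second derivatives of a smooth function are symmetric, because both mixed derivatives at \<open>x\<close> are
  limits of \<open>(f (x + h u + h v) - f (x + h u) - f (x + h v) + f x) / h\<^sup>2\<close>. The next lemma expresses this
  second difference by a value of the mixed derivative near \<open>x\<close>.\<close>

lemma second_difference_mean_value: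
  fixes f :: "'a::real_normed_vector \<Rightarrow> real"
  assumes S: "smooth_on S f" and h: "0 < h"
    and in_S: "\<And>s t. 0 \<le> s \<Longrightarrow> s \<le> h \<Longrightarrow> 0 \<le> t \<Longrightarrow> t \<le> h \<Longrightarrow> x + s *\<^sub>R u + t *\<^sub>R v \<in> S"
  obtains s t where "0 \<le> s" "s \<le> h" "0 \<le> t" "t \<le> h"
    "f (x + h *\<^sub>R u + h *\<^sub>R v) - f (x + h *\<^sub>R u) - f (x + h *\<^sub>R v) + f x
      = h * h * frechet_derivative (\<lambda>z. frechet_derivative f (at z) u) (at (x + s *\<^sub>R u + t *\<^sub>R v)) v"
proof -
  define g where "g s = f (x + s *\<^sub>R u + h *\<^sub>R v) - f (x + s *\<^sub>R u)" for s
  let ?f' = "\<lambda>z. frechet_derivative f (at z) u"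
  have g': "(g has_real_derivative ?f' (x + s *\<^sub>R u + h *\<^sub>R v) - ?f' (x + s *\<^sub>R u)) (at s)"
    if "0 \<le> s" "s \<le> h" for s
  proof -
    have "(x + h *\<^sub>R v) + s *\<^sub>R u \<in> S" "x + s *\<^sub>R u \<in> S"
      using in_S[of s h] in_S[of s 0] that h by (auto simp: ac_simps)
    then have 1: "((\<lambda>s. f ((x + h *\<^sub>R v) + s *\<^sub>R u)) has_vector_derivative ?f' ((x + h *\<^sub>R v) + s *\<^sub>R u)) (at s)"
      and 2: "((\<lambda>s. f (x + s *\<^sub>R u)) has_vector_derivative ?f' (x + s *\<^sub>R u)) (at s)"
      using has_derivative_along_line[OF smooth_on_imp_has_derivative[OF S]] by blast+
    from has_vector_derivative_diff[OF 1 2] show ?thesis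
      by (simp add: g_def[abs_def] has_real_derivative_iff_has_vector_derivative algebra_simps)
  qed
  obtain s where s: "0 < s" "s < h" "g h - g 0 = h * (?f' (x + s *\<^sub>R u + h *\<^sub>R v) - ?f' (x + s *\<^sub>R u))"
    using MVT2[of 0 h g "\<lambda>s. ?f' (x + s *\<^sub>R u + h *\<^sub>R v) - ?f' (x + s *\<^sub>R u)"] g' h by auto
  have k': "((\<lambda>t. ?f' (x + s *\<^sub>R u + t *\<^sub>R v)) has_real_derivative
          frechet_derivative ?f' (at (x + s *\<^sub>R u + t *\<^sub>R v)) v) (at t)" if "0 \<le> t" "t \<le> h" for t
    using has_derivative_along_line[OF smooth_on_imp_has_derivative[OF smooth_on_frechet_derivative[OF S]]]
      in_S[of s t] s that by (simp add: has_real_derivative_iff_has_vector_derivative)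
  obtain t where t: "0 < t" "t < h" "?f' (x + s *\<^sub>R u + h *\<^sub>R v) - ?f' (x + s *\<^sub>R u + 0 *\<^sub>R v)
       = (h - 0) * frechet_derivative ?f' (at (x + s *\<^sub>R u + t *\<^sub>R v)) v"
    using MVT2[OF h k'] by auto
  show ?thesis
    by (rule that[of s t]) (use s t in \<open>auto simp: g_def\<close>)
qed

lemma second_derivative_symmetric:
  fixes f :: "'a::real_normed_vector \<Rightarrow> real"
  assumes S: "open S" "smooth_on S f" and x: "x \<in> S"
  shows "frechet_derivative (\<lambda>z. frechet_derivative f (at z) u) (at x) v
       = frechet_derivative (\<lambda>z. frechet_derivative f (at z) v) (at x) u"
proof (rule ccontr)
  define A where "A z = frechet_derivative (\<lambda>z. frechet_derivative f (at z) u) (at z) v" for z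
  define B where "B z = frechet_derivative (\<lambda>z. frechet_derivative f (at z) v) (at z) u" for z
  assume "\<not> ?thesis"
  then have ne: "A x \<noteq> B x" by (simp add: A_def B_def)
  define e where "e = dist (A x) (B x) / 2"
  have e: "e > 0" using ne by (simp add: e_def)
  have "continuous_on S A" "continuous_on S B" unfolding A_def[abs_def] B_def[abs_def]
    by (intro smooth_on_imp_continuous_on smooth_on_frechet_derivative S)+
  then obtain dA dB where dA: "dA > 0" "\<And>z. z \<in> S \<Longrightarrow> dist z x < dA \<Longrightarrow> dist (A z) (A x) < e"
    and dB: "dB > 0" "\<And>z. z \<in> S \<Longrightarrow> dist z x < dB \<Longrightarrow> dist (B z) (B x) < e"
    using x e unfolding continuous_on_iff by metis
  obtain d0 where d0: "d0 > 0" "ball x d0 \<subseteq> S" using S(1) x open_contains_ball by blast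
  define d where "d = min d0 (min dA dB)"
  have d: "d > 0" using d0 dA dB by (simp add: d_def)
  \<comment> \<open>A step for which the whole parallelogram spanned by \<open>h u\<close> and \<open>h v\<close> stays within distance \<open>d\<close> of \<open>x\<close>.\<close>
  define h where "h = d / (norm u + norm v + 1)"
  have p: "norm u + norm v + 1 > 0" by (smt (verit) norm_ge_zero)
  have h: "h > 0" using d p by (simp add: h_def)
  have near: "dist (x + s *\<^sub>R u + t *\<^sub>R v) x < d" if "0 \<le> s" "s \<le> h" "0 \<le> t" "t \<le> h" for s t
  proof -
    have "norm (s *\<^sub>R u + t *\<^sub>R v) \<le> s * norm u + t * norm v"
      using norm_triangle_ineq[of "s *\<^sub>R u" "t *\<^sub>R v"] that by simp
    also have "\<dots> \<le> h * norm u + h * norm v" using that by (intro add_mono mult_right_mono) auto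
    also have "\<dots> < h * (norm u + norm v + 1)" using h by (simp add: algebra_simps)
    also have "\<dots> = d" using p by (simp add: h_def)
    finally show ?thesis by (simp add: dist_norm add.assoc)
  qed
  have in_S: "x + s *\<^sub>R u + t *\<^sub>R v \<in> S" if "0 \<le> s" "s \<le> h" "0 \<le> t" "t \<le> h" for s t
    using near[OF that] d0 by (auto simp: d_def dist_commute)
  let ?q = "f (x + h *\<^sub>R u + h *\<^sub>R v) - f (x + h *\<^sub>R u) - f (x + h *\<^sub>R v) + f x"
  obtain s t where st: "0 \<le> s" "s \<le> h" "0 \<le> t" "t \<le> h" "?q = h * h * A (x + s *\<^sub>R u + t *\<^sub>R v)"
    using second_difference_mean_value[OF S(2) h in_S] unfolding A_def by blast
  have in_S': "x + s *\<^sub>R v + t *\<^sub>R u \<in> S" if "0 \<le> s" "s \<le> h" "0 \<le> t" "t \<le> h" for s t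
    using in_S[of t s] that by (simp add: algebra_simps)
  obtain s' t' where st': "0 \<le> s'" "s' \<le> h" "0 \<le> t'" "t' \<le> h"
    "f (x + h *\<^sub>R v + h *\<^sub>R u) - f (x + h *\<^sub>R v) - f (x + h *\<^sub>R u) + f x = h * h * B (x + s' *\<^sub>R v + t' *\<^sub>R u)"
    using second_difference_mean_value[OF S(2) h in_S'] unfolding B_def by blast
  have "x + h *\<^sub>R v + h *\<^sub>R u = x + h *\<^sub>R u + h *\<^sub>R v" "x + s' *\<^sub>R v + t' *\<^sub>R u = x + t' *\<^sub>R u + s' *\<^sub>R v"
    by simp_all
  then have "h * h * A (x + s *\<^sub>R u + t *\<^sub>R v) = h * h * B (x + t' *\<^sub>R u + s' *\<^sub>R v)"
    using st(5) st'(5) by (smt (verit))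
  then have AB: "A (x + s *\<^sub>R u + t *\<^sub>R v) = B (x + t' *\<^sub>R u + s' *\<^sub>R v)" using h by simp
  have "dist (A (x + s *\<^sub>R u + t *\<^sub>R v)) (A x) < e" "dist (B (x + t' *\<^sub>R u + s' *\<^sub>R v)) (B x) < e"
    using dA(2)[OF in_S near[THEN order.strict_trans2]] dB(2)[OF in_S near[THEN order.strict_trans2]] st st'
    by (auto simp: d_def)
  then have "dist (A x) (B x) < 2 * e" unfolding AB
    by (smt (verit) dist_commute dist_triangle)
  then show False by (simp add: e_def)
qed

lemma smooth_on_frechet_derivative_apply:
  fixes f :: "real ^ 'n \<Rightarrow> 'b::real_normed_vector"
  assumes "open S" "smooth_on S f" "smooth_on S g"
  shows "smooth_on S (\<lambda>x. frechet_derivative f (at x) (g x))"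
proof (rule smooth_on_cong[OF assms(1)])
  show "smooth_on S (\<lambda>x. \<Sum>k\<in>UNIV. (g x $ k) *\<^sub>R frechet_derivative f (at x) (axis k 1))"
    using assms by (intro smooth_on_sum smooth_on_scaleR smooth_on_nth smooth_on_frechet_derivative)
qed (use linear_axis_expansion smooth_on_imp_differentiable[OF assms(2)] linear_frechet_derivative in \<open>metis\<close>)

section \<open>Linear connections\<close>

lemma linear_connection_smooth:
  assumes "linear_connection A D" "open U" "smooth_field_on A U X" "smooth_field_on A U Y"
  shows "smooth_field_on A U (\<lambda>q. D q (X q) Y)"
proof -
  have "\<forall>U X Y. open U \<and> smooth_field_on A U X \<and> smooth_field_on A U Y \<longrightarrow>
        smooth_field_on A U (\<lambda>q. D q (X q) Y)"
    using assms(1) unfolding linear_connection_def by (elim conjE)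
  then show ?thesis using assms(2-4) by simp
qed

lemma linear_connection_tangent:
  assumes "linear_connection A D" "v \<in> tangent_space A p" "smooth_field_at A p Y"
  shows "D p v Y \<in> tangent_space A p"
proof -
  have "\<forall>p. \<forall>v\<in>tangent_space A p. \<forall>Y. smooth_field_at A p Y \<longrightarrow> D p v Y \<in> tangent_space A p"
    using assms(1) unfolding linear_connection_def by (elim conjE)
  then show ?thesis using assms(2,3) by simp
qed

lemma linear_connection_local:
  assumes "linear_connection A D" "v \<in> tangent_space A p" "smooth_field_at A p Y"
    and "open U" "p \<in> U" "\<And>q. q \<in> U \<Longrightarrow> Y q = Z q"
  shows "D p v Y = D p v Z"
proof -
  have "\<forall>p. \<forall>v\<in>tangent_space A p. \<forall>Y Z. smooth_field_at A p Y \<and>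
        (\<exists>U. open U \<and> p \<in> U \<and> (\<forall>q\<in>U. Y q = Z q)) \<longrightarrow> D p v Y = D p v Z"
    using assms(1) unfolding linear_connection_def by (elim conjE)
  from this[rule_format, OF assms(2), of Y Z] show ?thesis using assms(3-6) by blast
qed

lemma linear_connection_lincomb:
  assumes "linear_connection A D" "v \<in> tangent_space A p" "w \<in> tangent_space A p" "smooth_field_at A p Y"
  shows "D p (tadd (tscale a v) (tscale b w)) Y = tadd (tscale a (D p v Y)) (tscale b (D p w Y))"
proof -
  have "\<forall>p. \<forall>v\<in>tangent_space A p. \<forall>w\<in>tangent_space A p. \<forall>a b Y. smooth_field_at A p Y \<longrightarrow>
        D p (tadd (tscale a v) (tscale b w)) Y = tadd (tscale a (D p v Y)) (tscale b (D p w Y))"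
    using assms(1) unfolding linear_connection_def by (elim conjE)
  from this[rule_format, OF assms(2-4)] show ?thesis .
qed

lemma linear_connection_add:
  assumes "linear_connection A D" "v \<in> tangent_space A p" "smooth_field_at A p Y" "smooth_field_at A p Z"
  shows "D p v (\<lambda>q. tadd (Y q) (Z q)) = tadd (D p v Y) (D p v Z)"
proof -
  have "\<forall>p. \<forall>v\<in>tangent_space A p. \<forall>Y Z. smooth_field_at A p Y \<and> smooth_field_at A p Z \<longrightarrow>
        D p v (\<lambda>q. tadd (Y q) (Z q)) = tadd (D p v Y) (D p v Z)"
    using assms(1) unfolding linear_connection_def by (elim conjE)
  from this[rule_format, OF assms(2)] assms(3,4) show ?thesis by blast
qed

lemma linear_connection_leibniz:
  assumes "linear_connection A D" "v \<in> tangent_space A p" "smooth_fun_at A p f" "smooth_field_at A p Y"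
  shows "D p v (\<lambda>q. tscale (f q) (Y q)) = tadd (tscale (v f) (Y p)) (tscale (f p) (D p v Y))"
proof -
  have "\<forall>p. \<forall>v\<in>tangent_space A p. \<forall>f Y. smooth_fun_at A p f \<and> smooth_field_at A p Y \<longrightarrow>
        D p v (\<lambda>q. tscale (f q) (Y q)) = tadd (tscale (v f) (Y p)) (tscale (f p) (D p v Y))"
    using assms(1) unfolding linear_connection_def by (elim conjE)
  from this[rule_format, OF assms(2)] assms(3,4) show ?thesis by blast
qed

section \<open>Charts and tangent vectors\<close>

text \<open>A smooth manifold of dimension \<open>CARD('n)\<close> with its maximal atlas \<open>A\<close>.\<close>

locale smooth_mfd =
  fixes A :: "('m::{t2_space, second_countable_topology}, 'n::finite) chart set"
  assumes smooth_mfd: "smooth_manifold A"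
begin

lemma
  assumes "c \<in> A"
  shows open_dom: "open (dom_chart c)" and open_im: "open (im_chart c)"
    and homeo: "homeomorphism (dom_chart c) (im_chart c) (snd c) (inv_chart c)"
proof -
  have "is_chart c" using smooth_mfd assms unfolding smooth_manifold_def by blast
  then show "open (dom_chart c)" "open (im_chart c)"
    "homeomorphism (dom_chart c) (im_chart c) (snd c) (inv_chart c)"
    unfolding is_chart_def by blast+
qed

lemma inv_chart_in: "c \<in> A \<Longrightarrow> x \<in> im_chart c \<Longrightarrow> inv_chart c x \<in> dom_chart c"
  using homeo[of c] by (auto simp: homeomorphism_def)

lemma chart_inv: "c \<in> A \<Longrightarrow> x \<in> im_chart c \<Longrightarrow> snd c (inv_chart c x) = x"
  using homeo[of c] by (auto simp: homeomorphism_def)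

lemma inv_chart: "c \<in> A \<Longrightarrow> p \<in> dom_chart c \<Longrightarrow> inv_chart c (snd c p) = p"
  using homeo[of c] by (auto simp: homeomorphism_def)

lemma open_chart_image:
  assumes "c \<in> A" "open U" shows "open (snd c ` (U \<inter> dom_chart c))"
proof -
  have "openin (top_of_set (dom_chart c)) (U \<inter> dom_chart c)"
    using assms(2) by (auto simp: openin_open)
  from homeomorphism_imp_open_map[OF homeo[OF assms(1)] this]
  show ?thesis using open_im[OF assms(1)] openin_open_trans by blast
qed

lemma open_chart_image': "c \<in> A \<Longrightarrow> open U \<Longrightarrow> U \<subseteq> dom_chart c \<Longrightarrow> open (snd c ` U)"
  using open_chart_image[of c U] by (simp add: Int_absorb2)

lemma smooth_transition:
  assumes "c \<in> A" "d \<in> A"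
  shows "smooth_on (snd c ` (dom_chart c \<inter> dom_chart d)) (snd d \<circ> inv_chart c)"
  using smooth_mfd assms unfolding smooth_manifold_def compatible_charts_def by blast

lemma smooth_transition_subset:
  assumes "c \<in> A" "d \<in> A" "U \<subseteq> dom_chart c"
  shows "smooth_on (snd d ` (U \<inter> dom_chart d)) (\<lambda>x. snd c (inv_chart d x))"
  using smooth_on_subset[OF smooth_transition[OF assms(2,1)], of "snd d ` (U \<inter> dom_chart d)"] assms(3)
  by (auto simp: o_def)

lemma smooth_fun_at_coords:
  assumes c: "c \<in> A" and U: "open U" "U \<subseteq> dom_chart c" and p: "p \<in> U"
    and g: "smooth_on (snd c ` U) g"
  shows "smooth_fun_at A p (\<lambda>q. g (snd c q))"
proof -
  have "smooth_on (snd d ` (U \<inter> dom_chart d)) (\<lambda>x. g (snd c (inv_chart d x)))" if d: "d \<in> A" for d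
  proof (rule smooth_on_compose[where T="snd c ` U" and f="\<lambda>x. snd c (inv_chart d x)", OF _ _ _ g])
    show "open (snd d ` (U \<inter> dom_chart d))" by (rule open_chart_image[OF d U(1)])
    show "smooth_on (snd d ` (U \<inter> dom_chart d)) (\<lambda>x. snd c (inv_chart d x))"
      by (rule smooth_transition_subset[OF c d U(2)])
  qed (use inv_chart[OF d] in auto)
  then show ?thesis using U p by (auto simp: smooth_fun_at_def o_def)
qed

lemma smooth_fun_at_coord: "c \<in> A \<Longrightarrow> p \<in> dom_chart c \<Longrightarrow> smooth_fun_at A p (\<lambda>q. snd c q $ i)"
  using smooth_fun_at_coords[of c "dom_chart c" p "\<lambda>x. x $ i"] open_dom
  by (simp add: smooth_on_bounded_linear bounded_linear_vec_nth)

lemma smooth_fun_at_has_derivative: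
  assumes "smooth_fun_at A p f" "c \<in> A" "p \<in> dom_chart c"
  shows "((f \<circ> inv_chart c) has_derivative frechet_derivative (f \<circ> inv_chart c) (at (snd c p))) (at (snd c p))"
proof -
  obtain U where "open U" "p \<in> U" "smooth_on (snd c ` (U \<inter> dom_chart c)) (f \<circ> inv_chart c)"
    using assms unfolding smooth_fun_at_def by blast
  then show ?thesis using assms(3) by (intro smooth_on_imp_has_derivative) auto
qed

lemma transition_has_derivative:
  assumes "c \<in> A" "d \<in> A" "p \<in> dom_chart c" "p \<in> dom_chart d"
  shows "((snd d \<circ> inv_chart c) has_derivative frechet_derivative (snd d \<circ> inv_chart c) (at (snd c p))) (at (snd c p))"
  by (rule smooth_on_imp_has_derivative[OF smooth_transition[OF assms(1,2)]]) (use assms in auto)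

lemma comps_coord_vec:
  assumes "c \<in> A" "d \<in> A" "p \<in> dom_chart c" "p \<in> dom_chart d"
  shows "comps d (coord_vec A c p w) = frechet_derivative (snd d \<circ> inv_chart c) (at (snd c p)) w"
proof -
  have "(((\<lambda>q. snd d q $ i) \<circ> inv_chart c) has_derivative
      (\<lambda>w. frechet_derivative (snd d \<circ> inv_chart c) (at (snd c p)) w $ i)) (at (snd c p))" for i
    using bounded_linear.has_derivative[OF bounded_linear_vec_nth transition_has_derivative[OF assms]]
    by (simp add: o_def)
  from frechet_derivative_at[OF this]
  have "frechet_derivative ((\<lambda>q. snd d q $ i) \<circ> inv_chart c) (at (snd c p)) w
      = frechet_derivative (snd d \<circ> inv_chart c) (at (snd c p)) w $ i" for i
    by metis
  then show ?thesis
    using smooth_fun_at_coord[OF assms(2,4)] by (simp add: comps_def coord_vec_def vec_eq_iff)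
qed

lemma comps_coord_vec_same:
  assumes "c \<in> A" "p \<in> dom_chart c"
  shows "comps c (coord_vec A c p w) = w"
proof -
  have "((\<lambda>x. x) has_derivative frechet_derivative (snd c \<circ> inv_chart c) (at (snd c p))) (at (snd c p))"
    by (rule has_derivative_transform_within_open[OF transition_has_derivative[OF assms(1,1,2,2)] open_im[OF assms(1)]])
       (use assms chart_inv in auto)
  then have "frechet_derivative (snd c \<circ> inv_chart c) (at (snd c p)) = (\<lambda>w. w)"
    using has_derivative_unique has_derivative_ident by blast
  then show ?thesis by (simp add: comps_coord_vec[OF assms(1,1,2,2)])
qed

text \<open>A tangent vector may be expanded in any chart around its base point; the components transform by
  the derivative of the transition map.\<close>

lemma coord_vec_change:
  assumes "c \<in> A" "d \<in> A" "p \<in> dom_chart c" "p \<in> dom_chart d"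
  shows "coord_vec A c p w = coord_vec A d p (comps d (coord_vec A c p w))"
proof
  fix f
  show "coord_vec A c p w f = coord_vec A d p (comps d (coord_vec A c p w)) f"
  proof (cases "smooth_fun_at A p f")
    case True
    let ?t = "snd d \<circ> inv_chart c" and ?S = "snd c ` (dom_chart d \<inter> dom_chart c)"
    have t: "?t (snd c p) = snd d p" using assms inv_chart by simp
    have "((\<lambda>x. (f \<circ> inv_chart d) (?t x)) has_derivative
        (\<lambda>w. frechet_derivative (f \<circ> inv_chart d) (at (snd d p)) (frechet_derivative ?t (at (snd c p)) w))) (at (snd c p))"
      using has_derivative_compose[OF transition_has_derivative[OF assms],
          of "f \<circ> inv_chart d" "frechet_derivative (f \<circ> inv_chart d) (at (snd d p))"]
        smooth_fun_at_has_derivative[OF True assms(2,4)]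
      unfolding t by simp
    moreover have "open ?S" using open_chart_image[OF assms(1) open_dom[OF assms(2)]] .
    moreover have "snd c p \<in> ?S" using assms by auto
    ultimately have "((f \<circ> inv_chart c) has_derivative
        (\<lambda>w. frechet_derivative (f \<circ> inv_chart d) (at (snd d p)) (frechet_derivative ?t (at (snd c p)) w))) (at (snd c p))"
      by (rule has_derivative_transform_within_open)
         (use inv_chart[OF assms(1)] inv_chart[OF assms(2)] in auto)
    then show ?thesis
      using True by (simp add: coord_vec_def[of A c] coord_vec_def[of A d] comps_coord_vec[OF assms, unfolded coord_vec_def]
          frechet_derivative_at[symmetric])
  qed (simp add: coord_vec_def)
qed

lemma coord_vec_in: "c \<in> A \<Longrightarrow> p \<in> dom_chart c \<Longrightarrow> coord_vec A c p w \<in> tangent_space A p"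
  unfolding tangent_space_def by blast

lemma tangent_eq_coord_vec:
  assumes "v \<in> tangent_space A p" "c \<in> A" "p \<in> dom_chart c"
  shows "v = coord_vec A c p (comps c v)"
proof -
  obtain d w where "d \<in> A" "p \<in> dom_chart d" "v = coord_vec A d p w"
    using assms(1) unfolding tangent_space_def by blast
  then show ?thesis using coord_vec_change[of d c p w] assms by simp
qed

lemma coord_vec_lincomb:
  assumes "c \<in> A" "p \<in> dom_chart c"
  shows "tadd (tscale a (coord_vec A c p w)) (tscale b (coord_vec A c p z)) = coord_vec A c p (a *\<^sub>R w + b *\<^sub>R z)"
proof
  fix f
  show "a * coord_vec A c p w f + b * coord_vec A c p z f = coord_vec A c p (a *\<^sub>R w + b *\<^sub>R z) f"
    using has_derivative_linear[OF smooth_fun_at_has_derivative[OF _ assms]]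
    by (simp add: coord_vec_def linear_add linear_scale)
qed

lemma coord_vec_scale:
  "c \<in> A \<Longrightarrow> p \<in> dom_chart c \<Longrightarrow> tscale a (coord_vec A c p w) = coord_vec A c p (a *\<^sub>R w)"
  using coord_vec_lincomb[of c p a w 0 0] by simp

lemma coord_vec_zero: "c \<in> A \<Longrightarrow> p \<in> dom_chart c \<Longrightarrow> coord_vec A c p 0 = (\<lambda>_. 0)"
  using coord_vec_scale[of c p 0 0] by simp

lemma comps_tadd: "comps c (tadd v w) = comps c v + comps c w"
  by (simp add: comps_def vec_eq_iff)

lemma comps_tscale: "comps c (tscale a v) = a *\<^sub>R comps c v"
  by (simp add: comps_def vec_eq_iff)

lemma smooth_field_on_cong:
  assumes "open U" "smooth_field_on A U Y" "\<And>q. q \<in> U \<Longrightarrow> Y q = Z q"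
  shows "smooth_field_on A U Z"
proof -
  have "smooth_on (snd d ` (U \<inter> dom_chart d)) (\<lambda>x. comps d (Z (inv_chart d x)))" if d: "d \<in> A" for d
    by (rule smooth_on_cong[where f="\<lambda>x. comps d (Y (inv_chart d x))"])
       (use assms(2,3) d inv_chart[OF d] open_chart_image[OF d assms(1)] in \<open>auto simp: smooth_field_on_def\<close>)
  then show ?thesis using assms(2,3) unfolding smooth_field_on_def by metis
qed

text \<open>Smoothness in one chart suffices for the smoothness of a vector field.\<close>

lemma smooth_field_on_coords:
  assumes c: "c \<in> A" and U: "open U" "U \<subseteq> dom_chart c" and h: "smooth_on (snd c ` U) \<eta>"
  shows "smooth_field_on A U (\<lambda>q. coord_vec A c q (\<eta> (snd c q)))"
  unfolding smooth_field_on_def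
proof (intro conjI ballI)
  fix q assume "q \<in> U"
  then show "coord_vec A c q (\<eta> (snd c q)) \<in> tangent_space A q" using coord_vec_in[OF c] U by auto
next
  fix d assume d: "d \<in> A"
  let ?S = "snd c ` (U \<inter> dom_chart d)" and ?T = "snd d ` (U \<inter> dom_chart d)"
  let ?f = "\<lambda>z. frechet_derivative (snd d \<circ> inv_chart c) (at z) (\<eta> z)"
  have "open (U \<inter> dom_chart d)" "U \<inter> dom_chart d \<subseteq> dom_chart c"
    using U open_dom[OF d] by auto
  then have oS: "open ?S" by (rule open_chart_image'[OF c])
  have oT: "open ?T" by (rule open_chart_image[OF d U(1)])
  have "smooth_on ?S ?f"
  proof (rule smooth_on_frechet_derivative_apply[OF oS])
    show "smooth_on ?S (snd d \<circ> inv_chart c)"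
      by (rule smooth_on_subset[OF smooth_transition[OF c d]]) (use U in auto)
    show "smooth_on ?S \<eta>" by (rule smooth_on_subset[OF h]) auto
  qed
  then have "smooth_on ?T (\<lambda>x. ?f (snd c (inv_chart d x)))"
    by (rule smooth_on_compose[OF oT _ smooth_transition_subset[OF c d U(2)], rotated])
       (use inv_chart[OF d] in auto)
  then show "smooth_on ?T (\<lambda>x. comps d (coord_vec A c (inv_chart d x) (\<eta> (snd c (inv_chart d x)))))"
    by (rule smooth_on_cong[OF oT, rotated]) (use U inv_chart[OF d] comps_coord_vec[OF c d] in auto)
qed

lemma smooth_coord_field: "c \<in> A \<Longrightarrow> smooth_field_on A (dom_chart c) (coord_field A c j)"
  using smooth_field_on_coords[of c "dom_chart c" "\<lambda>_. axis j 1"] open_dom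
  by (simp add: coord_field_def[abs_def] smooth_on_const)

lemma smooth_christoffel:
  assumes D: "linear_connection A D" and c: "c \<in> A"
  shows "smooth_on (im_chart c) (\<lambda>x. christoffel A D c (inv_chart c x) k i j)"
proof -
  have "smooth_field_on A (dom_chart c) (\<lambda>q. D q (coord_field A c i q) (coord_field A c j))"
    by (rule linear_connection_smooth[OF D open_dom[OF c] smooth_coord_field[OF c] smooth_coord_field[OF c]])
  then have "smooth_on (im_chart c) (\<lambda>x. comps c (D (inv_chart c x) (coord_field A c i (inv_chart c x)) (coord_field A c j)))"
    using c unfolding smooth_field_on_def by fastforce
  then show ?thesis unfolding christoffel_def by (intro smooth_on_nth open_im c)
qed

end

section \<open>Local solutions of linear differential equations\<close>

text \<open>Near \<open>0\<close>, the equation \<open>u' = A t u\<close> has a solution with any given value at \<open>0\<close>. It is the fixed point of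
  the integral operator of the equation, on bounded continuous functions of all times. The operator
  only uses the values on a small interval \<open>{-d..d}\<close>, and \<open>clamp\<close> retracts all times to this interval.\<close>

lemma linear_ode_local_solution:
  fixes A :: "real \<Rightarrow> 'a::euclidean_space \<Rightarrow> 'a"
  assumes a: "a > 0" and cont: "continuous_on ({-a..a} \<times> UNIV) (\<lambda>(t, v). A t v)"
    and lin: "\<And>t. linear (A t)"
  obtains d u where "0 < d" "d \<le> a" "u 0 = u0"
    "\<And>t. \<bar>t\<bar> < d \<Longrightarrow> (u has_vector_derivative A t (u t)) (at t)"
proof -
  have "compact ((\<lambda>(t, v). A t v) ` ({-a..a} \<times> cball 0 1))"
    by (intro compact_continuous_image continuous_on_subset[OF cont] compact_Times) auto
  from compact_imp_bounded[OF this] obtain L where "L > 0"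
    and L_image: "\<And>x. x \<in> (\<lambda>(t, v). A t v) ` ({-a..a} \<times> cball 0 1) \<Longrightarrow> norm x \<le> L"
    unfolding bounded_pos by blast
  then have L: "L > 0" "\<And>t v. t \<in> {-a..a} \<Longrightarrow> norm v \<le> 1 \<Longrightarrow> norm (A t v) \<le> L"
    by force+
  have bound: "norm (A t v) \<le> L * norm v" if "t \<in> {-a..a}" for t v
  proof (cases "v = 0")
    case True then show ?thesis using linear_0[OF lin] by simp
  next
    case False
    have "norm (A t ((1 / norm v) *\<^sub>R v)) \<le> L" using L(2)[OF that, of "(1 / norm v) *\<^sub>R v"] False by simp
    then show ?thesis using False by (simp add: linear_scale[OF lin] divide_simps)
  qed
  \<comment> \<open>The operator \<open>T\<close> below has the Lipschitz constant \<open>4 d L\<close>; this choice makes it at most \<open>1/2\<close>.\<close>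
  define d where "d = min a (1 / (8 * L))"
  have d: "0 < d" "d \<le> a" "8 * d * L \<le> 1" using a L(1) by (auto simp: d_def min_def field_simps)
  define clamp where "clamp t = max (- d) (min d t)" for t
  have clamp: "clamp t \<in> {-d..d}" for t using d by (auto simp: clamp_def)
  define I where "I u t = integral {-d..t} (\<lambda>s. A s (apply_bcontfun u s))" for u :: "real \<Rightarrow>\<^sub>C 'a" and t
  have cA: "continuous_on {-d..d} (\<lambda>s. A s (apply_bcontfun u s))" for u
  proof -
    have "continuous_on {-d..d} (\<lambda>s. (s, apply_bcontfun u s))"
      by (intro continuous_on_Pair continuous_on_id continuous_on_apply_bcontfun)
    moreover have "(\<lambda>s. (s, apply_bcontfun u s)) ` {-d..d} \<subseteq> {-a..a} \<times> UNIV" using d by auto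
    ultimately have "continuous_on {-d..d} (\<lambda>s. (\<lambda>(t, v). A t v) (s, apply_bcontfun u s))"
      by (rule continuous_on_compose2[OF cont])
    then show ?thesis by simp
  qed
  have intA: "(\<lambda>s. A s (apply_bcontfun u s)) integrable_on {-d..t}" if "t \<in> {-d..d}" for u t
    by (rule integrable_continuous_real[OF continuous_on_subset[OF cA]]) (use that in auto)
  have cI: "continuous_on {-d..d} (I u)" for u
    unfolding I_def[abs_def]
    by (rule indefinite_integral_continuous_1[OF integrable_continuous_real[OF cA]])
  \<comment> \<open>The integral starts at \<open>-d\<close>, hence the correction by \<open>I u 0\<close>.\<close>
  define T where "T u t = u0 + I u (clamp t) - I u 0" for u t
  have T: "T u \<in> bcontfun" for u
  proof -
    have c: "continuous_on UNIV (T u)"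
      unfolding T_def[abs_def] using clamp
      by (intro continuous_intros continuous_on_compose2[OF cI, of _ clamp])
         (auto simp: clamp_def[abs_def] intro!: continuous_intros)
    have "range (T u) \<subseteq> (\<lambda>t. u0 + I u t - I u 0) ` {-d..d}"
      using clamp by (auto simp: T_def)
    moreover have "compact ((\<lambda>t. u0 + I u t - I u 0) ` {-d..d})"
      by (intro compact_continuous_image continuous_intros cI) auto
    ultimately show ?thesis
      using c compact_imp_bounded bounded_subset by (auto simp: bcontfun_def)
  qed
  have diff: "norm (I u t - I v t) \<le> 2 * d * L * dist u v" if t: "t \<in> {-d..d}" for u v t
  proof -
    have "I u t - I v t = integral {-d..t} (\<lambda>s. A s (apply_bcontfun u s) - A s (apply_bcontfun v s))"
      unfolding I_def by (rule integral_diff[symmetric]) (use intA[OF t] in auto)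
    also have "norm \<dots> \<le> L * dist u v * (t - - d)"
    proof (rule integral_bound)
      show "continuous_on {-d..t} (\<lambda>s. A s (apply_bcontfun u s) - A s (apply_bcontfun v s))"
        using t by (intro continuous_on_diff continuous_on_subset[OF cA]) auto
      fix s assume s: "s \<in> {-d..t}"
      have "norm (A s (apply_bcontfun u s) - A s (apply_bcontfun v s))
          = norm (A s (apply_bcontfun u s - apply_bcontfun v s))"
        by (simp add: linear_diff[OF lin])
      also have "\<dots> \<le> L * norm (apply_bcontfun u s - apply_bcontfun v s)"
        using s t d by (intro bound) auto
      also have "\<dots> \<le> L * dist u v"
        using L(1) dist_bounded[of u s v] by (intro mult_left_mono) (auto simp: dist_norm)
      finally show "norm (A s (apply_bcontfun u s) - A s (apply_bcontfun v s)) \<le> L * dist u v" .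
    qed (use t in auto)
    also have "\<dots> \<le> L * dist u v * (2 * d)"
      using t L(1) by (intro mult_left_mono) auto
    finally show ?thesis by (simp add: mult_ac)
  qed
  have "\<exists>!u. Bcontfun (T u) = u"
  proof (rule banach_fix_type[of "1/2"])
    show "\<forall>u v. dist (Bcontfun (T u)) (Bcontfun (T v)) \<le> 1 / 2 * dist u v"
    proof (intro allI dist_bound)
      fix u v t
      have "norm ((I u (clamp t) - I v (clamp t)) - (I u 0 - I v 0)) \<le> 2 * d * L * dist u v + 2 * d * L * dist u v"
        using diff[OF clamp[of t], of u v] diff[of 0 u v] d norm_triangle_ineq4 order_trans add_mono
        by (smt (verit) atLeastAtMost_iff)
      also have "\<dots> = (8 * d * L) * (dist u v / 2)" by simp
      also have "\<dots> \<le> 1 * (dist u v / 2)" using d by (intro mult_right_mono) auto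
      finally show "dist (apply_bcontfun (Bcontfun (T u)) t) (apply_bcontfun (Bcontfun (T v)) t) \<le> 1 / 2 * dist u v"
        by (simp add: Bcontfun_inverse T T_def dist_norm algebra_simps)
    qed
  qed auto
  then obtain u where u: "Bcontfun (T u) = u" by blast
  have u_eq: "apply_bcontfun u t = u0 + I u (clamp t) - I u 0" for t
    using T[of u] by (subst u[symmetric]) (simp add: Bcontfun_inverse T_def)
  show ?thesis
  proof (rule that[OF d(1,2), of "apply_bcontfun u"])
    show "apply_bcontfun u 0 = u0" using d by (simp add: u_eq clamp_def)
    fix t assume t: "\<bar>t\<bar> < d"
    then have "t \<in> {-d..d}" by auto
    from integral_has_vector_derivative[OF cA this]
    have "(I u has_vector_derivative A t (apply_bcontfun u t)) (at t within {-d..d})"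
      unfolding I_def[abs_def] .
    then have "(I u has_vector_derivative A t (apply_bcontfun u t)) (at t)"
      using t by (simp add: at_within_Icc_at)
    then have "((\<lambda>t. u0 + I u t - I u 0) has_vector_derivative A t (apply_bcontfun u t)) (at t)"
      by (auto intro!: derivative_eq_intros)
    then show "(apply_bcontfun u has_vector_derivative A t (apply_bcontfun u t)) (at t)"
      by (rule has_vector_derivative_transform_within_open[where S="{-d<..<d}"])
         (use t in \<open>auto simp: u_eq clamp_def\<close>)
  qed
qed

section \<open>Parallel vector fields of a linear connection on a surface\<close>

text \<open>A surface with a linear connection \<open>D\<close>.\<close>

locale surface_connection = smooth_mfd A
  for A :: "('m::{t2_space, second_countable_topology}, 2) chart set" +
  fixes D :: "'m \<Rightarrow> 'm tvec \<Rightarrow> ('m \<Rightarrow> 'm tvec) \<Rightarrow> 'm tvec"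
  assumes connection: "linear_connection A D"
begin

text \<open>The coordinate expression of the covariant derivative, for a field with the components \<open>\<eta>\<close> in the
  chart \<open>c\<close>.\<close>

lemma covariant_derivative_coords:
  assumes c: "c \<in> A" and U: "open U" "U \<subseteq> dom_chart c" "p \<in> U"
    and h: "smooth_on (snd c ` U) \<eta>"
    and Y: "\<And>q. q \<in> U \<Longrightarrow> Y q = coord_vec A c q (\<eta> (snd c q))"
    and v: "v = coord_vec A c p w"
  shows "comps c (D p v Y) = frechet_derivative \<eta> (at (snd c p)) w
     + (\<chi> k. \<Sum>i\<in>UNIV. \<Sum>j\<in>UNIV. christoffel A D c p k i j * w $ i * \<eta> (snd c p) $ j)"
proof -
  have p: "p \<in> dom_chart c" using U by auto
  have oU: "open (snd c ` U)" by (rule open_chart_image'[OF c U(1,2)])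
  have fieldI: "smooth_field_at A p Z" if "smooth_field_on A U Z" for Z
    using that U unfolding smooth_field_at_def by blast
  define f where "f j q = \<eta> (snd c q) $ j" for j q
  define X where "X j = coord_field A c j" for j
  define Z where "Z j q = tscale (f j q) (X j q)" for j q
  have vt: "v \<in> tangent_space A p" and Xt: "X j p \<in> tangent_space A p" for j
    unfolding v X_def coord_field_def by (rule coord_vec_in[OF c p])+
  have X: "smooth_field_at A p (X j)" for j
    using smooth_coord_field[OF c] open_dom[OF c] p unfolding smooth_field_at_def X_def by blast
  have f: "smooth_fun_at A p (f j)" for j
    unfolding f_def[abs_def]
    by (rule smooth_fun_at_coords[OF c U, where g="\<lambda>x. \<eta> x $ j"]) (rule smooth_on_nth[OF oU h])
  have Z_eq: "Z j q = coord_vec A c q (\<eta> (snd c q) $ j *\<^sub>R axis j 1)" if "q \<in> U" for j q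
    unfolding Z_def X_def f_def coord_field_def by (rule coord_vec_scale[OF c]) (use U that in auto)
  have Z: "smooth_field_at A p (Z j)" for j
  proof (rule fieldI, rule smooth_field_on_cong[OF U(1)])
    show "smooth_field_on A U (\<lambda>q. coord_vec A c q (\<eta> (snd c q) $ j *\<^sub>R axis j 1))"
      by (rule smooth_field_on_coords[OF c U(1,2), where \<eta>="\<lambda>x. \<eta> x $ j *\<^sub>R axis j 1"])
         (intro smooth_on_scaleR smooth_on_nth smooth_on_const oU h)
  qed (use Z_eq in auto)
  have Y_sum: "Y q = tadd (Z 1 q) (Z 2 q)" if q: "q \<in> U" for q
  proof -
    have "q \<in> dom_chart c" using q U by auto
    from coord_vec_lincomb[OF c this, of 1 _ 1]
    have "tadd (Z 1 q) (Z 2 q) = coord_vec A c q (\<eta> (snd c q) $ 1 *\<^sub>R axis 1 1 + \<eta> (snd c q) $ 2 *\<^sub>R axis 2 1)"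
      by (simp add: Z_eq[OF q])
    also have "\<eta> (snd c q) $ 1 *\<^sub>R axis 1 1 + \<eta> (snd c q) $ 2 *\<^sub>R axis 2 1 = \<eta> (snd c q)"
      by (simp add: vec_eq_iff forall_2 axis_def)
    finally show ?thesis using Y[OF q] by simp
  qed
  have Yf: "smooth_field_at A p Y"
    by (rule fieldI, rule smooth_field_on_cong[OF U(1) smooth_field_on_coords[OF c U(1,2) h]]) (simp add: Y)
  have v_sum: "v = tadd (tscale (w $ 1) (X 1 p)) (tscale (w $ 2) (X 2 p))"
  proof -
    have "w = w $ 1 *\<^sub>R axis 1 1 + w $ 2 *\<^sub>R axis 2 1"
      by (simp add: vec_eq_iff forall_2 axis_def)
    then show ?thesis unfolding v X_def coord_field_def coord_vec_lincomb[OF c p] by simp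
  qed
  have DX: "D p v (X j) = tadd (tscale (w $ 1) (D p (X 1 p) (X j))) (tscale (w $ 2) (D p (X 2 p) (X j)))" for j
    unfolding v_sum by (rule linear_connection_lincomb[OF connection Xt Xt X])
  have DZ: "D p v (Z j) = tadd (tscale (v (f j)) (X j p)) (tscale (f j p) (D p v (X j)))" for j
    unfolding Z_def[abs_def] by (rule linear_connection_leibniz[OF connection vt f X])
  have "D p v Y = D p v (\<lambda>q. tadd (Z 1 q) (Z 2 q))"
    by (rule linear_connection_local[OF connection vt Yf U(1,3) Y_sum])
  also have "\<dots> = tadd (D p v (Z 1)) (D p v (Z 2))"
    by (rule linear_connection_add[OF connection vt Z Z])
  finally have DY: "D p v Y = tadd (D p v (Z 1)) (D p v (Z 2))" .
  have vf: "v (f j) = frechet_derivative \<eta> (at (snd c p)) w $ j" for j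
  proof -
    have "snd c p \<in> snd c ` U" using U by auto
    from bounded_linear.has_derivative[OF bounded_linear_vec_nth smooth_on_imp_has_derivative[OF h this]]
    have "((\<lambda>x. \<eta> x $ j) has_derivative (\<lambda>w. frechet_derivative \<eta> (at (snd c p)) w $ j)) (at (snd c p))" .
    then have "((f j \<circ> inv_chart c) has_derivative (\<lambda>w. frechet_derivative \<eta> (at (snd c p)) w $ j)) (at (snd c p))"
      by (rule has_derivative_transform_within_open[OF _ oU])
         (use U inv_chart[OF c] in \<open>auto simp: f_def\<close>)
    from frechet_derivative_at[OF this] show ?thesis
      using f[of j] unfolding v coord_vec_def by metis
  qed
  have cX: "comps c (X j p) = axis j 1" for j
    by (simp add: X_def coord_field_def comps_coord_vec_same[OF c p])
  show ?thesis
    unfolding DY DZ DX comps_tadd comps_tscale vf cX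
    by (simp add: vec_eq_iff forall_2 sum_2 axis_def christoffel_def X_def f_def algebra_simps)
qed

text \<open>By this formula, the derivative at \<open>t\<close> only depends on \<open>u t\<close> and the derivative \<open>u'\<close> of \<open>u\<close> at \<open>t\<close>.\<close>

lemma has_vector_derivative_frechet_apply:
  fixes \<phi> :: "real ^ 'k \<Rightarrow> 'b::real_normed_vector"
  assumes "open Z" "smooth_on Z \<phi>" "x0 + t *\<^sub>R a \<in> Z" "(u has_vector_derivative u') (at t)"
  shows "((\<lambda>s. frechet_derivative \<phi> (at (x0 + s *\<^sub>R a)) (u s)) has_vector_derivative
     (\<Sum>k\<in>UNIV. (u t $ k) *\<^sub>R frechet_derivative (\<lambda>x. frechet_derivative \<phi> (at x) (axis k 1)) (at (x0 + t *\<^sub>R a)) a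
       + (u' $ k) *\<^sub>R frechet_derivative \<phi> (at (x0 + t *\<^sub>R a)) (axis k 1))) (at t)"
proof -
  have 1: "((\<lambda>s. \<Sum>k\<in>UNIV. (u s $ k) *\<^sub>R frechet_derivative \<phi> (at (x0 + s *\<^sub>R a)) (axis k 1)) has_vector_derivative
     (\<Sum>k\<in>UNIV. (u t $ k) *\<^sub>R frechet_derivative (\<lambda>x. frechet_derivative \<phi> (at x) (axis k 1)) (at (x0 + t *\<^sub>R a)) a
       + (u' $ k) *\<^sub>R frechet_derivative \<phi> (at (x0 + t *\<^sub>R a)) (axis k 1))) (at t)"
  proof (intro has_vector_derivative_sum has_vector_derivative_scaleR)
    fix k
    show "((\<lambda>s. u s $ k) has_real_derivative u' $ k) (at t)"
      using bounded_linear.has_vector_derivative[OF bounded_linear_vec_nth assms(4)]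
      by (simp add: has_real_derivative_iff_has_vector_derivative)
    show "((\<lambda>s. frechet_derivative \<phi> (at (x0 + s *\<^sub>R a)) (axis k 1)) has_vector_derivative
       frechet_derivative (\<lambda>x. frechet_derivative \<phi> (at x) (axis k 1)) (at (x0 + t *\<^sub>R a)) a) (at t)"
      by (rule has_derivative_along_line[OF smooth_on_imp_has_derivative[OF smooth_on_frechet_derivative[OF assms(2)] assms(3)]])
  qed
  show ?thesis
  proof (rule has_vector_derivative_transform_within_open[OF 1])
    show "open ((\<lambda>s. x0 + s *\<^sub>R a) -` Z)"
      by (intro open_vimage assms(1) continuous_intros)
    show "t \<in> (\<lambda>s. x0 + s *\<^sub>R a) -` Z" using assms(3) by simp
    fix s assume "s \<in> (\<lambda>s. x0 + s *\<^sub>R a) -` Z"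
    then have "\<phi> differentiable at (x0 + s *\<^sub>R a)"
      using smooth_on_imp_differentiable[OF assms(2)] by simp
    then show "(\<Sum>k\<in>UNIV. (u s $ k) *\<^sub>R frechet_derivative \<phi> (at (x0 + s *\<^sub>R a)) (axis k 1))
        = frechet_derivative \<phi> (at (x0 + s *\<^sub>R a)) (u s)"
      by (intro linear_axis_expansion linear_frechet_derivative)
  qed
qed

text \<open>If the equation of parallel transport along a coordinate line of \<open>c\<close> holds in the chart \<open>c\<close>, then it
  holds in every chart. For a fixed time \<open>t\<close>, the solution \<open>u\<close> agrees to first order with a vector field \<open>Y\<close>
  that has affine components in \<open>c\<close>. The equation in a chart says that the covariant derivative of \<open>Y\<close>
  along the line vanishes at this point, which is a condition independent of charts.\<close>

lemma parallel_along_coordinate_line: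
  fixes u :: "real \<Rightarrow> real ^ 2"
  defines "\<gamma> c x0 i \<equiv> \<lambda>t::real. inv_chart c (x0 + t *\<^sub>R axis i 1)"
  assumes c: "c \<in> A" and J: "open J" "\<And>t. t \<in> J \<Longrightarrow> x0 + t *\<^sub>R axis i 1 \<in> im_chart c"
    and u: "\<And>t. t \<in> J \<Longrightarrow> (u has_vector_derivative
       (\<chi> k. - (\<Sum>j\<in>UNIV. christoffel A D c (\<gamma> c x0 i t) k i j * u t $ j))) (at t)"
  shows "parallel_along A D J (\<gamma> c x0 i) (\<lambda>t. coord_vec A c (\<gamma> c x0 i t) (u t))"
    and "smooth_curve A J (\<gamma> c x0 i)"
proof -
  define x where "x t = x0 + t *\<^sub>R axis i 1" for t :: real
  define g where "g = \<gamma> c x0 i"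
  have g: "g t = inv_chart c (x t)" for t by (simp add: g_def \<gamma>_def x_def)
  have gd: "g t \<in> dom_chart c" "snd c (g t) = x t" if "t \<in> J" for t
    using J(2)[OF that] inv_chart_in[OF c] chart_inv[OF c] by (simp_all add: g x_def)
  have xc: "continuous_on S x" for S unfolding x_def[abs_def] by (intro continuous_intros)
  show "smooth_curve A J (\<gamma> c x0 i)"
    unfolding g_def[symmetric] smooth_curve_def
  proof (intro conjI ballI)
    have "continuous_on (im_chart c) (inv_chart c)"
      using homeo[OF c] by (simp add: homeomorphism_def)
    then show "continuous_on J g"
      unfolding g[abs_def] by (rule continuous_on_compose2[OF _ xc]) (use J in \<open>auto simp: x_def\<close>)
    fix d assume d: "d \<in> A"
    let ?Z = "snd c ` (dom_chart c \<inter> dom_chart d)"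
    have Z: "open ?Z" using open_chart_image[OF c open_dom[OF d]] by (simp add: Int_commute)
    have eq: "{t\<in>J. g t \<in> dom_chart d} = J \<inter> x -` ?Z"
      using gd inv_chart[OF c] by (force simp: g)
    have o: "open (J \<inter> x -` ?Z)"
      by (intro open_Int J(1) open_vimage Z xc)
    have "smooth_on (J \<inter> x -` ?Z) (\<lambda>t. (snd d \<circ> inv_chart c) (x t))"
    proof (rule smooth_on_compose[OF o _ _ smooth_transition[OF c d]])
      show "smooth_on (J \<inter> x -` ?Z) x"
        unfolding x_def[abs_def]
        by (intro smooth_on_add o[unfolded x_def[abs_def]] smooth_on_const smooth_on_bounded_linear bounded_linear_scaleR_left)
    qed auto
    then show "smooth_on {t\<in>J. g t \<in> dom_chart d} (snd d \<circ> g)"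
      unfolding eq by (simp add: o_def g)
  qed
  show "parallel_along A D J (\<gamma> c x0 i) (\<lambda>t. coord_vec A c (\<gamma> c x0 i t) (u t))"
    unfolding parallel_along_def g_def[symmetric]
  proof (intro conjI ballI impI)
    fix t assume "t \<in> J"
    then show "coord_vec A c (g t) (u t) \<in> tangent_space A (g t)" by (intro coord_vec_in c gd)
  next
    fix d t assume d: "d \<in> A" and t: "t \<in> J" and gt: "g t \<in> dom_chart d"
    let ?W = "dom_chart c \<inter> dom_chart d"
    let ?Z = "snd c ` ?W"
    define \<phi> where "\<phi> = snd d \<circ> inv_chart c"
    have Z: "open ?Z" using open_chart_image[OF c open_dom[OF d]] by (simp add: Int_commute)
    have \<phi>: "smooth_on ?Z \<phi>" unfolding \<phi>_def by (rule smooth_transition[OF c d])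
    have xt: "x t \<in> ?Z" using gd[OF t] gt by (metis IntI imageI)
    have oN: "open (J \<inter> x -` ?Z)" by (intro open_Int J(1) open_vimage Z xc)
    have gN: "g s \<in> dom_chart c" "g s \<in> dom_chart d" "snd c (g s) = x s" if "s \<in> J \<inter> x -` ?Z" for s
      using that gd inv_chart[OF c] by (auto simp: g)
    define du where "du = (\<chi> k. - (\<Sum>j\<in>UNIV. christoffel A D c (g t) k i j * u t $ j))"
    have du: "(u has_vector_derivative du) (at t)" using u[OF t] by (simp add: du_def g_def)
    \<comment> \<open>The components of \<open>Y\<close> in the chart \<open>c\<close>; \<open>\<eta>'\<close> are those in the chart \<open>d\<close>.\<close>
    define \<eta> where "\<eta> z = u t + (z $ i - x t $ i) *\<^sub>R du" for z
    define Y where "Y q = coord_vec A c q (\<eta> (snd c q))" for q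
    define \<eta>' where "\<eta>' z = comps d (Y (inv_chart d z))" for z
    define a where "a = frechet_derivative \<phi> (at (x t)) (axis i 1)"
    define R where "R = (\<Sum>k\<in>UNIV. (u t $ k) *\<^sub>R frechet_derivative (\<lambda>x. frechet_derivative \<phi> (at x) (axis k 1)) (at (x t)) (axis i 1)
       + (du $ k) *\<^sub>R frechet_derivative \<phi> (at (x t)) (axis k 1))"
    have \<eta>_smooth: "smooth_on S \<eta>" if "open S" for S
      unfolding \<eta>_def[abs_def]
      by (intro smooth_on_add smooth_on_scaleR smooth_on_diff smooth_on_const smooth_on_bounded_linear
            bounded_linear_vec_nth that)
    have \<eta>x: "\<eta> (x s) = u t + (s - t) *\<^sub>R du" for s
      by (simp add: \<eta>_def x_def algebra_simps)
    have \<eta>x': "((\<lambda>s. \<eta> (x s)) has_vector_derivative du) (at t)"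
      unfolding \<eta>x by (auto intro!: derivative_eq_intros)
    \<comment> \<open>In the chart \<open>d\<close>, both fields have the derivative \<open>R\<close> at \<open>t\<close>.\<close>
    have V: "((\<lambda>s. comps d (coord_vec A c (g s) (u s))) has_vector_derivative R) (at t)"
    proof (rule has_vector_derivative_transform_within_open[OF _ oN])
      show "((\<lambda>s. frechet_derivative \<phi> (at (x s)) (u s)) has_vector_derivative R) (at t)"
        using has_vector_derivative_frechet_apply[OF Z \<phi> xt[unfolded x_def] du]
        by (simp add: R_def x_def)
    qed (use t xt gN comps_coord_vec[OF c d] in \<open>auto simp: \<phi>_def\<close>)
    have "((\<lambda>s. frechet_derivative \<phi> (at (x s)) (\<eta> (x s))) has_vector_derivative R) (at t)"
      using has_vector_derivative_frechet_apply[OF Z \<phi> xt[unfolded x_def] \<eta>x'] \<eta>x[of t]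
      by (simp add: R_def x_def)
    then have Y1: "((\<lambda>s. \<eta>' (\<phi> (x s))) has_vector_derivative R) (at t)"
      by (rule has_vector_derivative_transform_within_open[OF _ oN])
         (use t xt gN comps_coord_vec[OF c d] inv_chart[OF d] in
           \<open>auto simp: \<phi>_def \<eta>'_def Y_def g[symmetric]\<close>)
    have \<phi>x: "((\<lambda>s. \<phi> (x s)) has_vector_derivative a) (at t)"
      using has_derivative_along_line[OF smooth_on_imp_has_derivative[OF \<phi> xt[unfolded x_def]]]
      by (simp add: a_def x_def)
    have Yf: "smooth_field_on A (dom_chart c) Y"
      unfolding Y_def[abs_def] by (rule smooth_field_on_coords[OF c open_dom[OF c]])
         (use \<eta>_smooth open_im[OF c] in auto)
    have \<eta>'_smooth: "smooth_on (snd d ` ?W) \<eta>'"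
      using Yf d unfolding smooth_field_on_def \<eta>'_def[abs_def] by blast
    have \<phi>t: "\<phi> (x t) = snd d (g t)" by (simp add: \<phi>_def g)
    have gW: "g t \<in> ?W" using gd[OF t] gt by simp
    have "(\<eta>' has_derivative frechet_derivative \<eta>' (at (snd d (g t)))) (at (\<phi> (x t)))"
      unfolding \<phi>t by (rule smooth_on_imp_has_derivative[OF \<eta>'_smooth]) (use gW in auto)
    from vector_derivative_diff_chain_within[OF \<phi>x has_derivative_at_withinI[OF this]]
    have "((\<lambda>s. \<eta>' (\<phi> (x s))) has_vector_derivative frechet_derivative \<eta>' (at (snd d (g t))) a) (at t)"
      by (simp add: o_def)
    with Y1 have R: "R = frechet_derivative \<eta>' (at (snd d (g t))) a"
      by (rule vector_derivative_unique_at)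
    define v where "v = coord_vec A c (g t) (axis i 1)"
    have va: "comps d v = a"
      using comps_coord_vec[OF c d gd(1)[OF t] gt] gd(2)[OF t] by (simp add: v_def a_def \<phi>_def)
    have vt: "v \<in> tangent_space A (g t)" unfolding v_def by (rule coord_vec_in[OF c gd(1)[OF t]])
    have vd: "v = coord_vec A d (g t) a"
      using tangent_eq_coord_vec[OF vt d gt] va by simp
    have oW: "open ?W" by (intro open_Int open_dom c d)
    have 1: "comps c (D (g t) v Y) = frechet_derivative \<eta> (at (snd c (g t))) (axis i 1)
       + (\<chi> k. \<Sum>i'\<in>UNIV. \<Sum>j\<in>UNIV. christoffel A D c (g t) k i' j * axis i 1 $ i' * \<eta> (snd c (g t)) $ j)"
      by (rule covariant_derivative_coords[OF c open_dom[OF c] subset_refl gd(1)[OF t] \<eta>_smooth[OF open_im[OF c]]])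
         (simp_all add: Y_def v_def)
    have "(\<eta> has_derivative (\<lambda>w. (w $ i) *\<^sub>R du)) (at (x t))"
      unfolding \<eta>_def[abs_def]
      by (auto intro!: derivative_eq_intros bounded_linear.has_derivative[OF bounded_linear_vec_nth])
    from frechet_derivative_at[OF this] have "frechet_derivative \<eta> (at (x t)) (axis i 1) = du"
      by (metis axis_nth scaleR_one)
    then have "comps c (D (g t) v Y) = 0"
      unfolding 1 gd(2)[OF t] \<eta>x
      using exhaust_2[of i] by (auto simp: du_def vec_eq_iff sum_2 axis_def)
    moreover have "D (g t) v Y \<in> tangent_space A (g t)"
      by (rule linear_connection_tangent[OF connection vt])
         (use Yf gd(1)[OF t] open_dom[OF c] in \<open>auto simp: smooth_field_at_def\<close>)
    ultimately have "D (g t) v Y = (\<lambda>_. 0)"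
      using tangent_eq_coord_vec[OF _ c gd(1)[OF t]] coord_vec_zero[OF c gd(1)[OF t]] by metis
    then have 0: "comps d (D (g t) v Y) = 0" by (simp add: comps_def vec_eq_iff)
    have Yd: "Y q = coord_vec A d q (\<eta>' (snd d q))" if "q \<in> ?W" for q
      using tangent_eq_coord_vec[of "Y q" q d] coord_vec_in[OF c] that d inv_chart[OF d]
      by (simp add: Y_def \<eta>'_def)
    have 2: "comps d (D (g t) v Y) = frechet_derivative \<eta>' (at (snd d (g t))) a
       + (\<chi> k. \<Sum>i\<in>UNIV. \<Sum>j\<in>UNIV. christoffel A D d (g t) k i j * a $ i * \<eta>' (snd d (g t)) $ j)"
      by (rule covariant_derivative_coords[OF d oW _ gW \<eta>'_smooth Yd vd]) auto
    have "\<eta>' (snd d (g t)) = comps d (coord_vec A c (g t) (u t))"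
      using inv_chart[OF d gt] gd(2)[OF t] by (simp add: \<eta>'_def Y_def \<eta>x)
    moreover have "vector_derivative (snd d \<circ> g) (at t) = a"
      using vector_derivative_at[OF \<phi>x] by (simp add: \<phi>_def g o_def)
    ultimately have "R = (\<chi> k. - (\<Sum>i\<in>UNIV. \<Sum>j\<in>UNIV. christoffel A D d (g t) k i j *
                     vector_derivative (snd d \<circ> g) (at t) $ i * comps d (coord_vec A c (g t) (u t)) $ j))"
      using 2 unfolding 0 R by (simp add: vec_eq_iff algebra_simps eq_neg_iff_add_eq_0)
    then show "((\<lambda>s. comps d (coord_vec A c (g s) (u s))) has_vector_derivative
         (\<chi> k. - (\<Sum>i\<in>UNIV. \<Sum>j\<in>UNIV. christoffel A D d (g t) k i j *
                     vector_derivative (snd d \<circ> g) (at t) $ i * comps d (coord_vec A c (g t) (u t)) $ j))) (at t)"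
      using V by simp
  qed
qed

text \<open>Compatibility in local coordinates: the metric is constant along the horizontal lifts, with
  respect to the connection, of the coordinate vector fields.\<close>

lemma compatible_horizontal_constancy:
  assumes compat: "compatible_connection A F D" and c: "c \<in> A" and x: "x \<in> im_chart c"
    and diff: "loc A c F differentiable (at (x, y))"
  shows "pdx i (loc A c F) (x, y) = (\<Sum>k\<in>UNIV. \<Sum>j\<in>UNIV.
     christoffel A D c (inv_chart c x) k i j * y $ j * pdy k (loc A c F) (x, y))"
proof -
  obtain e where e: "e > 0" "cball x e \<subseteq> im_chart c"
    using open_im[OF c] x open_contains_cball by blast
  have line: "x + t *\<^sub>R axis i 1 \<in> im_chart c" if "\<bar>t\<bar> \<le> e" for t
    using e(2) that by (auto simp: dist_norm)
  let ?\<gamma> = "\<lambda>t. inv_chart c (x + t *\<^sub>R axis i 1)"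
  let ?B = "\<lambda>t v :: real ^ 2. \<chi> k. - (\<Sum>j\<in>UNIV. christoffel A D c (?\<gamma> t) k i j * v $ j)"
  have cont: "continuous_on ({-e..e} \<times> UNIV) (\<lambda>(t, v). ?B t v)"
  proof -
    have C: "continuous_on ({-e..e} \<times> (UNIV :: (real ^ 2) set)) (\<lambda>z. christoffel A D c (?\<gamma> (fst z)) k i j)" for k j
      by (rule continuous_on_compose2[OF smooth_on_imp_continuous_on[OF smooth_christoffel[OF connection c]]])
         (use line in \<open>auto intro!: continuous_intros\<close>)
    show ?thesis unfolding case_prod_beta by (intro continuous_intros C)
  qed
  have lin: "linear (?B t)" for t
    by (rule linearI) (simp_all add: vec_eq_iff sum_2 algebra_simps)
  obtain d u where du: "0 < d" "d \<le> e" "u 0 = y" "\<And>t. \<bar>t\<bar> < d \<Longrightarrow> (u has_vector_derivative ?B t (u t)) (at t)"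
    by (rule linear_ode_local_solution[OF e(1) cont lin, of y]) (rule that)
  define J where "J = {-d<..<d}"
  have J: "open J" "is_interval J" "0 \<in> J" using du by (auto simp: J_def is_interval_oo)
  have par: "parallel_along A D J ?\<gamma> (\<lambda>t. coord_vec A c (?\<gamma> t) (u t))" "smooth_curve A J ?\<gamma>"
    by (rule parallel_along_coordinate_line[where u=u, OF c J(1)]; use line du in \<open>auto simp: J_def\<close>)+
  have const: "loc A c F (x + t *\<^sub>R axis i 1, u t) = loc A c F (x, y)" if t: "t \<in> J" for t
  proof -
    have "parallel_transport A D J ?\<gamma> 0 t (coord_vec A c (?\<gamma> 0) (u 0)) (coord_vec A c (?\<gamma> t) (u t))"
      unfolding parallel_transport_def using par(1) by blast
    then have "F (?\<gamma> t) (coord_vec A c (?\<gamma> t) (u t)) = F (?\<gamma> 0) (coord_vec A c (?\<gamma> 0) (u 0))"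
      using compat[unfolded compatible_connection_def, rule_format, of J ?\<gamma> 0 t] J par(2) t by simp
    then show ?thesis using du(3) by (simp add: loc_def)
  qed
  let ?L = "loc A c F" and ?f' = "frechet_derivative (loc A c F) (at (x, y))"
  have f': "(?L has_derivative ?f') (at (x, y))" using diff by (simp add: frechet_derivative_works)
  have "((\<lambda>t. (x + t *\<^sub>R axis i 1, u t)) has_vector_derivative (axis i 1, ?B 0 y)) (at 0)"
    using du(1) du(4)[of 0] du(3)
    by (intro has_vector_derivative_Pair) (auto intro!: derivative_eq_intros)
  from vector_derivative_diff_chain_within[OF this, of ?L ?f'] f' du(3)
  have "((?L \<circ> (\<lambda>t. (x + t *\<^sub>R axis i 1, u t))) has_vector_derivative ?f' (axis i 1, ?B 0 y)) (at 0)"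
    by (simp add: has_derivative_at_withinI)
  moreover have "((?L \<circ> (\<lambda>t. (x + t *\<^sub>R axis i 1, u t))) has_vector_derivative 0) (at 0)"
    by (rule has_vector_derivative_transform_within_open[OF has_vector_derivative_const J(1,3)])
       (use const in auto)
  ultimately have "?f' (axis i 1, ?B 0 y) = 0" by (rule vector_derivative_unique_at)
  moreover have "?f' (axis i 1, w) = pdx i ?L (x, y) + (\<Sum>k\<in>UNIV. w $ k * pdy k ?L (x, y))" for w
  proof -
    have l: "linear ?f'" using f' by (rule has_derivative_linear)
    have "?f' (axis i 1, w) = ?f' ((axis i 1, 0) + (0, w))" by simp
    also have "\<dots> = ?f' (axis i 1, 0) + ?f' (0, w)" by (rule linear_add[OF l])
    also have "?f' (0, w) = (\<Sum>k\<in>UNIV. (w $ k) *\<^sub>R ?f' (0, axis k 1))"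
    proof (rule linear_axis_expansion[symmetric])
      show "linear (\<lambda>w. ?f' (0, w))"
        using linear_compose[of "\<lambda>w. (0, w)" ?f'] l by (simp add: o_def linear_iff)
    qed
    finally show ?thesis by (simp add: pdx_def pdy_def)
  qed
  ultimately show ?thesis by (simp add: sum_2 algebra_simps)
qed

end

section \<open>Partial derivatives on a punctured coordinate space\<close>

text \<open>The partial derivative of a function of the fibre coordinates \<open>y\<close> alone.\<close>

definition pd :: "'n \<Rightarrow> (real ^ 'n \<Rightarrow> real) \<Rightarrow> real ^ 'n::finite \<Rightarrow> real" where
  "pd i f y = frechet_derivative f (at y) (axis i 1)"

text \<open>Smoothness away from the origin, the regularity of Finslerian quantities on a tangent space.\<close>

definition smooth0 :: "(real ^ 'n::finite \<Rightarrow> real) \<Rightarrow> bool" where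
  "smooth0 f \<longleftrightarrow> smooth_on (UNIV - {0}) f"

lemma open_punctured: "open (UNIV - {0 :: 'a::real_normed_vector})"
  by (simp add: open_delete)

named_theorems smooth0_intros

lemma smooth0_const [smooth0_intros]: "smooth0 (\<lambda>y. c)"
  by (simp add: smooth0_def smooth_on_const)

lemma smooth0_coord [smooth0_intros]: "smooth0 (\<lambda>y. y $ i)"
  by (simp add: smooth0_def smooth_on_bounded_linear bounded_linear_vec_nth)

lemma smooth0_add [smooth0_intros]: "smooth0 f \<Longrightarrow> smooth0 g \<Longrightarrow> smooth0 (\<lambda>y. f y + g y)"
  by (simp add: smooth0_def smooth_on_add open_punctured)

lemma smooth0_diff [smooth0_intros]: "smooth0 f \<Longrightarrow> smooth0 g \<Longrightarrow> smooth0 (\<lambda>y. f y - g y)"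
  by (simp add: smooth0_def smooth_on_diff open_punctured)

lemma smooth0_minus [smooth0_intros]: "smooth0 f \<Longrightarrow> smooth0 (\<lambda>y. - f y)"
  by (simp add: smooth0_def smooth_on_minus open_punctured)

lemma smooth0_mult [smooth0_intros]: "smooth0 f \<Longrightarrow> smooth0 g \<Longrightarrow> smooth0 (\<lambda>y. f y * g y)"
  by (simp add: smooth0_def smooth_on_mult open_punctured)

lemma smooth0_sum [smooth0_intros]: "(\<And>i. i \<in> I \<Longrightarrow> smooth0 (f i)) \<Longrightarrow> smooth0 (\<lambda>y. \<Sum>i\<in>I. f i y)"
  by (simp add: smooth0_def smooth_on_sum open_punctured)

lemma smooth0_divide:
  "smooth0 f \<Longrightarrow> smooth0 g \<Longrightarrow> (\<And>y. y \<noteq> 0 \<Longrightarrow> g y \<noteq> 0) \<Longrightarrow> smooth0 (\<lambda>y. f y / g y)"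
  unfolding smooth0_def by (rule smooth_on_divide) (auto simp: open_punctured)

lemma smooth0_divide_const [smooth0_intros]: "smooth0 f \<Longrightarrow> smooth0 (\<lambda>y. f y / c)"
  using smooth0_mult[OF _ smooth0_const, of f "inverse c"] by (simp add: divide_inverse)

lemma smooth0_pd [smooth0_intros]: "smooth0 f \<Longrightarrow> smooth0 (pd i f)"
  unfolding smooth0_def pd_def[abs_def] by (rule smooth_on_frechet_derivative)

lemma smooth0_cong: "smooth0 f \<Longrightarrow> (\<And>y. y \<noteq> 0 \<Longrightarrow> f y = g y) \<Longrightarrow> smooth0 g"
  unfolding smooth0_def by (rule smooth_on_cong[where f=f]) (auto simp: open_punctured)

lemma smooth0_has_derivative:
  "smooth0 f \<Longrightarrow> y \<noteq> 0 \<Longrightarrow> (f has_derivative frechet_derivative f (at y)) (at y)"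
  unfolding smooth0_def by (rule smooth_on_imp_has_derivative) auto

lemma pd_eqI: "(f has_derivative f') (at y) \<Longrightarrow> pd i f y = f' (axis i 1)"
  unfolding pd_def by (simp add: frechet_derivative_at[symmetric])

lemma pd_cong:
  assumes "smooth0 f" "\<And>y. y \<noteq> 0 \<Longrightarrow> f y = g y" "y \<noteq> 0"
  shows "pd i f y = pd i g y"
proof -
  have "(g has_derivative frechet_derivative f (at y)) (at y)"
    by (rule has_derivative_transform_within_open[OF smooth0_has_derivative[OF assms(1,3)] open_punctured])
       (use assms in auto)
  from pd_eqI[OF this] show ?thesis by (simp add: pd_def)
qed

lemma pd_const: "pd i (\<lambda>y. c) y = 0"
  by (rule pd_eqI[OF has_derivative_const])

lemma pd_coord: "pd i (\<lambda>y. y $ j) y = (if i = j then 1 else 0)"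
  by (subst pd_eqI[OF bounded_linear_imp_has_derivative[OF bounded_linear_vec_nth]])
     (auto simp: axis_def)

lemma pd_add: "smooth0 f \<Longrightarrow> smooth0 g \<Longrightarrow> y \<noteq> 0 \<Longrightarrow> pd i (\<lambda>y. f y + g y) y = pd i f y + pd i g y"
  using pd_eqI[OF has_derivative_add[OF smooth0_has_derivative smooth0_has_derivative]] by (simp add: pd_def)

lemma pd_diff: "smooth0 f \<Longrightarrow> smooth0 g \<Longrightarrow> y \<noteq> 0 \<Longrightarrow> pd i (\<lambda>y. f y - g y) y = pd i f y - pd i g y"
  using pd_eqI[OF has_derivative_diff[OF smooth0_has_derivative smooth0_has_derivative]] by (simp add: pd_def)

lemma pd_minus: "smooth0 f \<Longrightarrow> y \<noteq> 0 \<Longrightarrow> pd i (\<lambda>y. - f y) y = - pd i f y"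
  using pd_eqI[OF has_derivative_minus[OF smooth0_has_derivative]] by (simp add: pd_def)

lemma pd_mult: "smooth0 f \<Longrightarrow> smooth0 g \<Longrightarrow> y \<noteq> 0 \<Longrightarrow>
    pd i (\<lambda>y. f y * g y) y = pd i f y * g y + f y * pd i g y"
  using pd_eqI[OF has_derivative_mult[OF smooth0_has_derivative smooth0_has_derivative], of f y g i]
  by (simp add: pd_def)

lemma pd_cmult: "smooth0 f \<Longrightarrow> y \<noteq> 0 \<Longrightarrow> pd i (\<lambda>y. c * f y) y = c * pd i f y"
  by (simp add: pd_mult smooth0_const pd_const)

lemma pd_divide_const: "smooth0 f \<Longrightarrow> y \<noteq> 0 \<Longrightarrow> pd i (\<lambda>y. f y / c) y = pd i f y / c"
  using pd_cmult[of f y i "inverse c"] by (simp add: divide_inverse mult.commute)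

lemma pd_sum: "(\<And>j. j \<in> I \<Longrightarrow> smooth0 (f j)) \<Longrightarrow> y \<noteq> 0 \<Longrightarrow> pd i (\<lambda>y. \<Sum>j\<in>I. f j y) y = (\<Sum>j\<in>I. pd i (f j) y)"
  using pd_eqI[OF has_derivative_sum[OF smooth0_has_derivative], of I f y i] by (simp add: pd_def)

lemma pd_divide:
  assumes "smooth0 f" "smooth0 g" "\<And>y. y \<noteq> 0 \<Longrightarrow> g y \<noteq> 0" "y \<noteq> 0"
  shows "pd i (\<lambda>y. f y / g y) y = (pd i f y * g y - f y * pd i g y) / (g y * g y)"
  using pd_eqI[OF has_derivative_divide'[OF smooth0_has_derivative[OF assms(1,4)]
      smooth0_has_derivative[OF assms(2,4)] assms(3)[OF assms(4)]]]
  by (simp add: pd_def)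

lemma pd_commute: "smooth0 f \<Longrightarrow> y \<noteq> 0 \<Longrightarrow> pd i (pd j f) y = pd j (pd i f) y"
  unfolding pd_def[abs_def] smooth0_def
  by (rule second_derivative_symmetric[OF open_punctured]) auto

subsection \<open>Positive homogeneity\<close>

text \<open>Homogeneity of degree \<open>k\<close> under multiplication by positive scalars.\<close>

definition pos_hom :: "nat \<Rightarrow> (real ^ 'n::finite \<Rightarrow> real) \<Rightarrow> bool" where
  "pos_hom k f \<longleftrightarrow> (\<forall>t>0. \<forall>y. y \<noteq> 0 \<longrightarrow> f (t *\<^sub>R y) = t ^ k * f y)"

lemma pos_homD: "pos_hom k f \<Longrightarrow> t > 0 \<Longrightarrow> y \<noteq> 0 \<Longrightarrow> f (t *\<^sub>R y) = t ^ k * f y"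
  by (simp add: pos_hom_def)

text \<open>Partial derivatives have one degree less. The factor \<open>t\<close> on the left hand side includes the case
  \<open>k = 0\<close>, in which this degree is \<open>-1\<close>.\<close>

lemma pd_scaled:
  assumes "smooth0 f" "pos_hom k f" "t > 0" "y \<noteq> 0"
  shows "t * pd i f (t *\<^sub>R y) = t ^ k * pd i f y"
proof -
  have "((\<lambda>y. t *\<^sub>R y) has_derivative (\<lambda>v. t *\<^sub>R v)) (at y)"
    by (auto intro!: derivative_eq_intros)
  moreover have ty: "t *\<^sub>R y \<noteq> 0" using assms by simp
  ultimately have "((\<lambda>y. f (t *\<^sub>R y)) has_derivative (\<lambda>v. frechet_derivative f (at (t *\<^sub>R y)) (t *\<^sub>R v))) (at y)"
    using has_derivative_compose smooth0_has_derivative[OF assms(1) ty] by blast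
  then have 1: "pd i (\<lambda>y. f (t *\<^sub>R y)) y = frechet_derivative f (at (t *\<^sub>R y)) (t *\<^sub>R axis i 1)"
    by (rule pd_eqI)
  have 2: "frechet_derivative f (at (t *\<^sub>R y)) (t *\<^sub>R axis i 1) = t * pd i f (t *\<^sub>R y)"
    using smooth0_has_derivative[OF assms(1) ty]
    by (simp add: pd_def has_derivative_linear linear_scale)
  have "pd i (\<lambda>y. f (t *\<^sub>R y)) y = pd i (\<lambda>y. t ^ k * f y) y"
    by (rule pd_cong[symmetric]) (use assms in \<open>auto intro!: smooth0_intros simp: pos_homD\<close>)
  then show ?thesis using 1 2 assms by (simp add: pd_cmult)
qed

lemma pos_hom_pd: "smooth0 f \<Longrightarrow> pos_hom (Suc k) f \<Longrightarrow> pos_hom k (pd i f)"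
  using pd_scaled[of f "Suc k"] by (auto simp: pos_hom_def)

text \<open>Euler's theorem.\<close>

lemma euler:
  assumes "smooth0 f" "pos_hom k f" "y \<noteq> 0"
  shows "(\<Sum>i\<in>UNIV. y $ i * pd i f y) = real k * f y"
proof -
  have "((\<lambda>t. f (0 + t *\<^sub>R y)) has_vector_derivative frechet_derivative f (at y) y) (at 1)"
    using has_derivative_along_line[of f _ 0 1 y] smooth0_has_derivative[OF assms(1,3)] by simp
  moreover have "((\<lambda>t. t ^ k * f y) has_vector_derivative real k * f y) (at 1)"
    unfolding has_real_derivative_iff_has_vector_derivative[symmetric]
    by (auto intro!: derivative_eq_intros)
  then have "((\<lambda>t. f (0 + t *\<^sub>R y)) has_vector_derivative real k * f y) (at 1)"
    by (rule has_vector_derivative_transform_within_open[where S="{0<..}"])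
       (use assms in \<open>auto simp: pos_homD\<close>)
  ultimately have "frechet_derivative f (at y) y = real k * f y"
    using vector_derivative_unique_at by blast
  moreover have "frechet_derivative f (at y) y = (\<Sum>i\<in>UNIV. y $ i * pd i f y)"
    using linear_axis_expansion[OF has_derivative_linear[OF smooth0_has_derivative[OF assms(1,3)]], of y]
    by (simp add: pd_def)
  ultimately show ?thesis by simp
qed

section \<open>Minkowski planes\<close>

text \<open>A two-dimensional Minkowski space, given by its energy \<open>e\<close>: half the square of a positively
  homogeneous and not necessarily symmetric norm.\<close>

locale minkowski_plane =
  fixes e :: "real ^ 2 \<Rightarrow> real"
  assumes smooth0_energy: "smooth0 e"
    and pos_hom_energy: "pos_hom 2 e"
    and posdef: "\<And>y w. y \<noteq> 0 \<Longrightarrow> w \<noteq> 0 \<Longrightarrow> w \<bullet> ((\<chi> i j. pd i (pd j e) y) *v w) > 0"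
begin

lemma posdef': "y \<noteq> 0 \<Longrightarrow> a \<noteq> 0 \<or> b \<noteq> 0 \<Longrightarrow>
    a * a * pd 1 (pd 1 e) y + 2 * (a * b * pd 1 (pd 2 e) y) + b * b * pd 2 (pd 2 e) y > 0"
proof -
  assume y: "y \<noteq> 0" and "a \<noteq> 0 \<or> b \<noteq> 0"
  then have "vector [a, b] \<noteq> (0 :: real ^ 2)" by (auto simp: vec_eq_iff forall_2)
  from posdef[OF y this] show ?thesis
    by (simp add: inner_vec_def matrix_vector_mult_def sum_2 algebra_simps pd_commute[OF smooth0_energy y, of 2 1])
qed

text \<open>The determinant of the fundamental tensor \<open>(\<partial>\<^sup>2e/\<partial>y\<^sup>i\<partial>y\<^sup>j)\<close>.\<close>

definition gdet :: "real ^ 2 \<Rightarrow> real" where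
  "gdet y = pd 1 (pd 1 e) y * pd 2 (pd 2 e) y - pd 1 (pd 2 e) y * pd 1 (pd 2 e) y"

lemma e11_pos: "y \<noteq> 0 \<Longrightarrow> pd 1 (pd 1 e) y > 0"
  using posdef'[of y 1 0] by simp

lemma gdet_pos:
  assumes "y \<noteq> 0" shows "gdet y > 0"
proof -
  let ?a = "pd 1 (pd 1 e) y" and ?b = "pd 1 (pd 2 e) y"
  have "?a * gdet y = ?b * ?b * ?a + 2 * (?b * (- ?a) * ?b) + ?a * ?a * pd 2 (pd 2 e) y"
    by (simp add: gdet_def algebra_simps)
  also have "\<dots> > 0" using posdef'[OF assms, of ?b "- ?a"] e11_pos[OF assms] by simp
  finally show ?thesis using e11_pos[OF assms] zero_less_mult_pos by blast
qed

lemma gdet_nonzero: "y \<noteq> 0 \<Longrightarrow> gdet y \<noteq> 0"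
  using gdet_pos by force

lemma smooth0_gdet [smooth0_intros]: "smooth0 gdet"
  unfolding gdet_def[abs_def] by (intro smooth0_intros smooth0_energy)

lemma pos_hom_pd_energy: "pos_hom 1 (pd i e)"
  by (rule pos_hom_pd[OF smooth0_energy]) (use pos_hom_energy in \<open>simp add: numeral_2_eq_2\<close>)

lemma pos_hom_pd_pd_energy: "pos_hom 0 (pd i (pd j e))"
  by (rule pos_hom_pd[OF smooth0_pd[OF smooth0_energy]]) (use pos_hom_pd_energy in simp)

lemma pos_hom_gdet: "pos_hom 0 gdet"
  using pos_hom_pd_pd_energy by (simp add: pos_hom_def gdet_def)

lemma euler0: "y \<noteq> 0 \<Longrightarrow> y $ 1 * pd 1 e y + y $ 2 * pd 2 e y = 2 * e y"
  using euler[OF smooth0_energy pos_hom_energy] by (simp add: sum_2)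

lemma euler1: "y \<noteq> 0 \<Longrightarrow> y $ 1 * pd 1 (pd i e) y + y $ 2 * pd 2 (pd i e) y = pd i e y"
  using euler[OF smooth0_pd[OF smooth0_energy] pos_hom_pd_energy, of y i] by (simp add: sum_2)

lemma euler2: "y \<noteq> 0 \<Longrightarrow> y $ 1 * pd 1 (pd i (pd j e)) y + y $ 2 * pd 2 (pd i (pd j e)) y = 0"
  using euler[OF smooth0_pd[OF smooth0_pd[OF smooth0_energy]] pos_hom_pd_pd_energy, of y i j]
  by (simp add: sum_2)

lemma e12_commute: "y \<noteq> 0 \<Longrightarrow> pd 2 (pd 1 e) y = pd 1 (pd 2 e) y"
  by (rule pd_commute[OF smooth0_energy])

lemma energy_pos:
  assumes "y \<noteq> 0" shows "e y > 0"
proof -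
  have "2 * e y = y $ 1 * (y $ 1 * pd 1 (pd 1 e) y + y $ 2 * pd 2 (pd 1 e) y)
      + y $ 2 * (y $ 1 * pd 1 (pd 2 e) y + y $ 2 * pd 2 (pd 2 e) y)"
    using euler0[OF assms] euler1[OF assms] by simp
  also have "\<dots> > 0"
    using posdef'[OF assms, of "y $ 1" "y $ 2"] assms e12_commute[OF assms]
    by (auto simp: vec_eq_iff forall_2 algebra_simps)
  finally show ?thesis by simp
qed

subsection \<open>Differentiation along the indicatrix\<close>

text \<open>The vector field \<open>V = (- \<partial>e/\<partial>y\<^sup>2, \<partial>e/\<partial>y\<^sup>1)\<close> is tangent to the level curves of \<open>e\<close>. On the
  curve \<open>e = 1/2\<close> it is the velocity of the parametrization \<open>c\<close> with \<open>c\<^sup>1 c'\<^sup>2 - c\<^sup>2 c'\<^sup>1 = 1\<close>,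
  for which \<open>c'' = - gdet c\<close>: the determinant is the centro-affine curvature of the indicatrix.\<close>

definition V :: "2 \<Rightarrow> real ^ 2 \<Rightarrow> real" where
  "V l y = (if l = 1 then - pd 2 e y else pd 1 e y)"

text \<open>The derivative along \<open>V\<close>.\<close>

definition drv :: "(real ^ 2 \<Rightarrow> real) \<Rightarrow> real ^ 2 \<Rightarrow> real" where
  "drv f y = V 1 y * pd 1 f y + V 2 y * pd 2 f y"

text \<open>\<open>f'\<close> is the derivative of the smooth function \<open>f\<close> along \<open>V\<close>. As a relation, in contrast to the
  function \<open>drv\<close>, it can be derived by structural rules.\<close>

definition has_drv :: "(real ^ 2 \<Rightarrow> real) \<Rightarrow> (real ^ 2 \<Rightarrow> real) \<Rightarrow> bool" where
  "has_drv f f' \<longleftrightarrow> smooth0 f \<and> (\<forall>y. y \<noteq> 0 \<longrightarrow> drv f y = f' y)"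

lemma V_simps [simp]: "V 1 y = - pd 2 e y" "V 2 y = pd 1 e y"
  by (auto simp: V_def)

lemma smooth0_V [smooth0_intros]: "smooth0 (V l)"
proof -
  have "V l = (\<lambda>y. - pd 2 e y) \<or> V l = pd 1 e" by (auto simp: V_def fun_eq_iff)
  then show ?thesis using smooth0_energy by (auto intro!: smooth0_intros)
qed

lemma smooth0_drv [smooth0_intros]: "smooth0 f \<Longrightarrow> smooth0 (drv f)"
  unfolding drv_def[abs_def] by (intro smooth0_intros)

lemma has_drv_drv: "smooth0 f \<Longrightarrow> has_drv f (drv f)"
  by (simp add: has_drv_def)

lemma has_drv_smooth0: "has_drv f f' \<Longrightarrow> smooth0 f"
  by (simp add: has_drv_def)

lemma has_drv_eq: "has_drv f f' \<Longrightarrow> y \<noteq> 0 \<Longrightarrow> drv f y = f' y"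
  by (simp add: has_drv_def)

lemma has_drv_unique: "has_drv f f' \<Longrightarrow> has_drv f f'' \<Longrightarrow> y \<noteq> 0 \<Longrightarrow> f' y = f'' y"
  by (simp add: has_drv_def)

lemma has_drv_cong: "has_drv f f' \<Longrightarrow> (\<And>y. y \<noteq> 0 \<Longrightarrow> f' y = f'' y) \<Longrightarrow> has_drv f f''"
  by (simp add: has_drv_def)

lemma has_drv_transfer:
  assumes "has_drv f f'" "\<And>y. y \<noteq> 0 \<Longrightarrow> f y = g y" shows "has_drv g f'"
  using assms pd_cong[of f g] smooth0_cong[of f g] by (auto simp: has_drv_def drv_def)

lemma has_drv_const: "has_drv (\<lambda>y. c) (\<lambda>y. 0)"
  by (simp add: has_drv_def smooth0_const drv_def pd_const)

lemma has_drv_add: "has_drv f f' \<Longrightarrow> has_drv g g' \<Longrightarrow> has_drv (\<lambda>y. f y + g y) (\<lambda>y. f' y + g' y)"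
  by (auto simp: has_drv_def drv_def pd_add algebra_simps intro!: smooth0_intros)

lemma has_drv_diff: "has_drv f f' \<Longrightarrow> has_drv g g' \<Longrightarrow> has_drv (\<lambda>y. f y - g y) (\<lambda>y. f' y - g' y)"
  by (auto simp: has_drv_def drv_def pd_diff algebra_simps intro!: smooth0_intros)

lemma has_drv_minus: "has_drv f f' \<Longrightarrow> has_drv (\<lambda>y. - f y) (\<lambda>y. - f' y)"
  using has_drv_diff[OF has_drv_const, of f f' 0] by simp

lemma has_drv_mult:
  "has_drv f f' \<Longrightarrow> has_drv g g' \<Longrightarrow> has_drv (\<lambda>y. f y * g y) (\<lambda>y. f' y * g y + f y * g' y)"
proof -
  assume a: "has_drv f f'" "has_drv g g'"
  have "drv (\<lambda>y. f y * g y) y = drv f y * g y + f y * drv g y" if "y \<noteq> 0" for y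
    using a that by (simp add: has_drv_def drv_def pd_mult algebra_simps)
  then show ?thesis using a by (auto simp: has_drv_def intro!: smooth0_intros)
qed

lemma has_drv_divide:
  assumes a: "has_drv f f'" "has_drv g g'" and g: "\<And>y. y \<noteq> 0 \<Longrightarrow> g y \<noteq> 0"
  shows "has_drv (\<lambda>y. f y / g y) (\<lambda>y. (f' y * g y - f y * g' y) / (g y * g y))"
proof -
  have "drv (\<lambda>y. f y / g y) y = (drv f y * g y - f y * drv g y) / (g y * g y)" if "y \<noteq> 0" for y
    using a that g by (simp add: has_drv_def drv_def pd_divide field_simps)
  then show ?thesis using a g by (auto simp: has_drv_def intro!: smooth0_divide)
qed

lemmas has_drv_rules = has_drv_const has_drv_add has_drv_diff has_drv_minus has_drv_mult

lemma has_drv_coord: "has_drv (\<lambda>y. y $ i) (V i)"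
  using exhaust_2[of i] by (auto simp: has_drv_def drv_def pd_coord smooth0_coord)

text \<open>The equation \<open>c'' = - gdet c\<close>, homogeneously extended from the indicatrix to the punctured plane.\<close>

lemma has_drv_V: "has_drv (V i) (\<lambda>y. - (gdet y * y $ i))"
proof -
  have 1: "has_drv (pd 1 e) (\<lambda>y. - (gdet y * y $ 2))"
  proof -
    have "drv (pd 1 e) y = - (gdet y * y $ 2)" if y: "y \<noteq> 0" for y
      by (simp add: drv_def gdet_def e12_commute[OF y] algebra_simps euler1[OF y, of 1, symmetric]
          euler1[OF y, of 2, symmetric])
    then show ?thesis by (simp add: has_drv_def smooth0_pd smooth0_energy)
  qed
  have 2: "has_drv (pd 2 e) (\<lambda>y. gdet y * y $ 1)"
  proof -
    have "drv (pd 2 e) y = gdet y * y $ 1" if y: "y \<noteq> 0" for y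
      by (simp add: drv_def gdet_def e12_commute[OF y] algebra_simps euler1[OF y, of 1, symmetric]
          euler1[OF y, of 2, symmetric])
    then show ?thesis by (simp add: has_drv_def smooth0_pd smooth0_energy)
  qed
  show ?thesis
    using exhaust_2[of i] has_drv_minus[OF 2] 1 by (auto simp: V_def[abs_def])
qed

text \<open>For \<open>f\<close> homogeneous of degree two, the third derivative in the direction \<open>V\<close> is given by a third order
  differential operator along the indicatrix. The correction terms come from \<open>V' = - gdet y\<close> and Euler's
  theorem.\<close>

lemma third_derivative_along_indicatrix:
  assumes f: "smooth0 f" "pos_hom 2 f"
    and f1: "has_drv f f1" and f2: "has_drv f1 f2" and f3: "has_drv f2 f3" and y: "y \<noteq> 0"
  shows "f3 y + 4 * gdet y * f1 y + 2 * drv gdet y * f y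
    = (\<Sum>i\<in>UNIV. \<Sum>j\<in>UNIV. \<Sum>k\<in>UNIV. V i y * V j y * V k y * pd k (pd j (pd i f)) y)"
proof -
  have E0: "y $ 1 * pd 1 f y + y $ 2 * pd 2 f y = 2 * f y" if "y \<noteq> 0" for y
    using euler[OF f that] by (simp add: sum_2)
  have E1: "y $ 1 * pd 1 (pd i f) y + y $ 2 * pd 2 (pd i f) y = pd i f y" if "y \<noteq> 0" for y i
    using euler[OF smooth0_pd[OF f(1)] pos_hom_pd[OF f(1)], of 1 y i] f(2) that
    by (simp add: sum_2 numeral_2_eq_2)
  define F where "F i = drv (pd i f)" for i
  define G where "G i j = drv (pd j (pd i f))" for i j
  have F: "has_drv (pd i f) (F i)" and G: "has_drv (pd j (pd i f)) (G i j)" for i j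
    unfolding F_def G_def by (intro has_drv_drv smooth0_intros f)+
  have K: "has_drv gdet (drv gdet)" by (intro has_drv_drv smooth0_intros)
  have 1: "has_drv (\<lambda>y. V 1 y * pd 1 f y + V 2 y * pd 2 f y) f2"
    by (rule has_drv_transfer[OF f2]) (use f1 in \<open>auto simp: has_drv_def drv_def\<close>)
  have "f2 y = V 1 y * (V 1 y * pd 1 (pd 1 f) y + V 2 y * pd 2 (pd 1 f) y)
      + V 2 y * (V 1 y * pd 1 (pd 2 f) y + V 2 y * pd 2 (pd 2 f) y) - 2 * gdet y * f y"
    if y: "y \<noteq> 0" for y
  proof -
    have "f2 y = - (gdet y * y $ 1) * pd 1 f y + V 1 y * drv (pd 1 f) y +
       (- (gdet y * y $ 2) * pd 2 f y + V 2 y * drv (pd 2 f) y)"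
      using has_drv_unique[OF 1 has_drv_add[OF has_drv_mult[OF has_drv_V has_drv_drv]
          has_drv_mult[OF has_drv_V has_drv_drv]] y] smooth0_pd[OF f(1)] by simp
    then show ?thesis using E0[OF y] by (simp add: drv_def) algebra
  qed
  then have 2: "has_drv (\<lambda>y. V 1 y * (V 1 y * pd 1 (pd 1 f) y + V 2 y * pd 2 (pd 1 f) y)
      + V 2 y * (V 1 y * pd 1 (pd 2 f) y + V 2 y * pd 2 (pd 2 f) y) - 2 * gdet y * f y) f3"
    by (intro has_drv_transfer[OF f3])
  have 3: "f3 y = - (gdet y * y $ 1) * (V 1 y * pd 1 (pd 1 f) y + V 2 y * pd 2 (pd 1 f) y)
     + V 1 y * ((- (gdet y * y $ 1) * pd 1 (pd 1 f) y + V 1 y * G 1 1 y) +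
                (- (gdet y * y $ 2) * pd 2 (pd 1 f) y + V 2 y * G 1 2 y))
     + (- (gdet y * y $ 2) * (V 1 y * pd 1 (pd 2 f) y + V 2 y * pd 2 (pd 2 f) y)
     + V 2 y * ((- (gdet y * y $ 1) * pd 1 (pd 2 f) y + V 1 y * G 2 1 y) +
                (- (gdet y * y $ 2) * pd 2 (pd 2 f) y + V 2 y * G 2 2 y)))
     - ((0 * gdet y + 2 * drv gdet y) * f y + 2 * gdet y * f1 y)"
    by (rule has_drv_unique[OF 2 _ y]) (intro has_drv_rules has_drv_V G K f1)
  have f1': "f1 y = V 1 y * pd 1 f y + V 2 y * pd 2 f y"
    using f1 y by (simp add: has_drv_def drv_def)
  have c: "pd 2 (pd 1 f) y = pd 1 (pd 2 f) y" using pd_commute f(1) y by blast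
  show ?thesis
    unfolding 3 f1' G_def sum_2 drv_def[of "pd _ (pd _ f)"] c
    by (simp add: E1[OF y, of 1, symmetric] E1[OF y, of 2, symmetric] c algebra_simps)
qed


text \<open>The zeros of \<open>\<beta> = t1 \<partial>e/\<partial>y\<^sup>1 + t2 \<partial>e/\<partial>y\<^sup>2\<close> along the indicatrix are simple: where \<open>\<beta> = 0\<close>, differentiating
  \<open>\<beta> P = 0\<close> gives \<open>\<beta>' P = 0\<close>. If \<open>P\<close> did not vanish there, then \<open>\<beta> = \<beta>' = 0\<close>, which says that \<open>(t1, t2)\<close> is both
  tangent to the indicatrix and parallel to \<open>y\<close>.\<close>

lemma cancel_linear_form:
  assumes tau: "t1 \<noteq> 0 \<or> t2 \<noteq> 0" and P: "smooth0 P"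
    and zero: "\<And>y. y \<noteq> 0 \<Longrightarrow> (t1 * pd 1 e y + t2 * pd 2 e y) * P y = 0"
    and y: "y \<noteq> 0"
  shows "P y = 0"
proof (rule ccontr)
  assume nz: "P y \<noteq> 0"
  define B where "B y = t1 * V 2 y - t2 * V 1 y" for y
  have B: "has_drv B (\<lambda>y. (0 * V 2 y + t1 * - (gdet y * y $ 2)) - (0 * V 1 y + t2 * - (gdet y * y $ 1)))"
    unfolding B_def[abs_def] by (intro has_drv_rules has_drv_V)
  have "has_drv (\<lambda>y. B y * P y) (\<lambda>y. 0)"
    by (rule has_drv_transfer[OF has_drv_const[of 0]]) (use zero in \<open>simp add: B_def\<close>)
  from has_drv_unique[OF this has_drv_mult[OF B has_drv_drv[OF P]] y]
  have "B y * drv P y + P y * (gdet y * (t2 * y $ 1 - t1 * y $ 2)) = 0"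
    by (simp add: algebra_simps)
  moreover have B0: "t1 * pd 1 e y + t2 * pd 2 e y = 0" using zero[OF y] nz by simp
  then have "B y = 0" by (simp add: B_def)
  ultimately have "t2 * y $ 1 = t1 * y $ 2" using nz gdet_nonzero[OF y] by simp
  moreover have "t1 * (2 * e y) = y $ 1 * (t1 * pd 1 e y + t2 * pd 2 e y)
        + pd 2 e y * (t1 * y $ 2 - t2 * y $ 1)"
    "t2 * (2 * e y) = y $ 2 * (t1 * pd 1 e y + t2 * pd 2 e y)
        + pd 1 e y * (t2 * y $ 1 - t1 * y $ 2)"
    unfolding euler0[OF y, symmetric] by (simp_all add: algebra_simps)
  ultimately have "t1 * (2 * e y) = 0" "t2 * (2 * e y) = 0" unfolding B0 by simp_all
  then show False using tau energy_pos[OF y] by simp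
qed

lemma pd_zero_at_max:
  assumes "smooth0 f" "y \<noteq> 0" "\<And>z. z \<noteq> 0 \<Longrightarrow> f z \<le> f y"
  shows "pd i f y = 0"
proof -
  have "frechet_derivative f (at y) = (\<lambda>v. 0)"
    by (rule differential_zero_maxmin[where S="UNIV - {0}" and f=f and x=y])
       (use assms smooth0_has_derivative open_punctured in auto)
  then show ?thesis by (simp add: pd_def)
qed

lemma homogeneous_attains_max:
  assumes "smooth0 f" "pos_hom 0 f"
  obtains y :: "real ^ 2" where "y \<noteq> 0" "\<And>z. z \<noteq> 0 \<Longrightarrow> f z \<le> f y"
proof -
  have "continuous_on (sphere 0 1) f"
    using smooth_on_imp_continuous_on[OF assms(1)[unfolded smooth0_def]]
    by (rule continuous_on_subset) auto
  then obtain y where y: "y \<in> sphere 0 1" "\<And>z. z \<in> sphere 0 1 \<Longrightarrow> f z \<le> f y"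
    using continuous_attains_sup[of "sphere (0 :: real ^ 2) 1" f] by auto
  have "f z \<le> f y" if "z \<noteq> 0" for z
  proof -
    have "f ((1 / norm z) *\<^sub>R z) = f z" using pos_homD[OF assms(2), of "1 / norm z" z] that by simp
    moreover have "(1 / norm z) *\<^sub>R z \<in> sphere 0 1" using that by simp
    ultimately show ?thesis using y(2) by metis
  qed
  moreover have "y \<noteq> 0" using y(1) by auto
  ultimately show ?thesis using that by blast
qed

text \<open>A function \<open>q\<close> on the closed indicatrix with \<open>q' = q\<^sup>2 / 2\<close> vanishes, since \<open>q' = 0\<close> at its extrema.\<close>

lemma riccati_on_indicatrix:
  assumes "smooth0 q" "pos_hom 0 q" "has_drv q (\<lambda>y. (q y)\<^sup>2 / 2)" "y \<noteq> 0"
  shows "q y = 0"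
proof -
  have z: "q y = 0" if "y \<noteq> 0" "\<And>i. pd i q y = 0" for y
    using has_drv_eq[OF assms(3) that(1)] that(2) by (simp add: drv_def)
  obtain a where a: "a \<noteq> 0" "\<And>z. z \<noteq> 0 \<Longrightarrow> q z \<le> q a"
    using homogeneous_attains_max[OF assms(1,2)] by metis
  have "pos_hom 0 (\<lambda>y. - q y)" using assms(2) by (simp add: pos_hom_def)
  then obtain b where b: "b \<noteq> 0" "\<And>z. z \<noteq> 0 \<Longrightarrow> - q z \<le> - q b"
    using homogeneous_attains_max[OF smooth0_minus[OF assms(1)]] by metis
  have "q a = 0" by (rule z[OF a(1) pd_zero_at_max[OF assms(1) a]])
  moreover have "pd i q b = 0" for i
    using pd_zero_at_max[OF smooth0_minus[OF assms(1)] b, of i] pd_minus[OF assms(1) b(1), of i] by simp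
  then have "q b = 0" by (rule z[OF b(1)])
  ultimately show ?thesis using a(2)[OF assms(4)] b(2)[OF assms(4)] by linarith
qed

lemma pos_hom_drv_gdet: "pos_hom 0 (drv gdet)"
proof -
  have "drv gdet (t *\<^sub>R y) = drv gdet y" if "t > 0" "y \<noteq> 0" for t y
  proof -
    have "pd i e (t *\<^sub>R y) = t * pd i e y" for i
      using pos_homD[OF pos_hom_pd_energy that] by simp
    then have "drv gdet (t *\<^sub>R y)
        = - pd 2 e y * (t * pd 1 gdet (t *\<^sub>R y)) + pd 1 e y * (t * pd 2 gdet (t *\<^sub>R y))"
      by (simp add: drv_def)
    also have "\<dots> = drv gdet y"
      unfolding pd_scaled[OF smooth0_gdet pos_hom_gdet that] by (simp add: drv_def)
    finally show ?thesis .
  qed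
  then show ?thesis by (simp add: pos_hom_def)
qed

text \<open>The fundamental tensor of a Minkowski plane is constant if its determinant is constant along the
  indicatrix: by Euler's theorem, the third derivatives of \<open>e\<close> are determined by a single number,
  and this number is a multiple of the derivative of the determinant.\<close>

lemma cartan_tensor_zero:
  assumes "\<And>y. y \<noteq> 0 \<Longrightarrow> drv gdet y = 0" and y: "y \<noteq> 0"
  shows "pd k gdet y = 0" "pd k (pd j (pd i e)) y = 0"
proof -
  let ?k1 = "pd 1 gdet y" and ?k2 = "pd 2 gdet y"
  have V0: "- pd 2 e y * ?k1 + pd 1 e y * ?k2 = 0" using assms(1)[OF y] by (simp add: drv_def)
  have y0: "y $ 1 * ?k1 + y $ 2 * ?k2 = 0"
    using euler[OF smooth0_gdet pos_hom_gdet y] by (simp add: sum_2)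
  have "2 * e y * ?k1 = pd 1 e y * (y $ 1 * ?k1 + y $ 2 * ?k2) - y $ 2 * (- pd 2 e y * ?k1 + pd 1 e y * ?k2)"
    "2 * e y * ?k2 = pd 2 e y * (y $ 1 * ?k1 + y $ 2 * ?k2) + y $ 1 * (- pd 2 e y * ?k1 + pd 1 e y * ?k2)"
    unfolding euler0[OF y, symmetric] by (simp_all add: algebra_simps)
  then have "2 * e y * ?k1 = 0" "2 * e y * ?k2 = 0" unfolding V0 y0 by simp_all
  then have k0: "?k1 = 0" "?k2 = 0" using energy_pos[OF y] by auto
  then show "pd k gdet y = 0" using exhaust_2[of k] by auto
  note s = smooth0_energy smooth0_pd[OF smooth0_energy]
  define C1 where "C1 = pd 1 (pd 1 (pd 1 e)) y"
  define C2 where "C2 = pd 1 (pd 1 (pd 2 e)) y"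
  define C3 where "C3 = pd 1 (pd 2 (pd 2 e)) y"
  define C4 where "C4 = pd 2 (pd 2 (pd 2 e)) y"
  have c1: "pd 2 (pd 1 (pd 1 e)) y = C2" "pd 1 (pd 2 (pd 1 e)) y = C2" "pd 2 (pd 1 (pd 2 e)) y = C3"
    "pd 2 (pd 2 (pd 1 e)) y = C3"
  proof -
    have c: "pd i (pd 2 (pd 1 e)) y = pd i (pd 1 (pd 2 e)) y" for i
      by (rule pd_cong) (use y e12_commute in \<open>auto intro!: smooth0_intros smooth0_energy\<close>)
    show "pd 1 (pd 2 (pd 1 e)) y = C2" using c by (simp add: C2_def)
    then show "pd 2 (pd 1 (pd 1 e)) y = C2" using pd_commute[OF s(2) y] by metis
    show "pd 2 (pd 1 (pd 2 e)) y = C3" using pd_commute[OF s(2) y] by (metis C3_def)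
    then show "pd 2 (pd 2 (pd 1 e)) y = C3" using c by simp
  qed
  define a where "a = pd 1 (pd 1 e) y"
  define b where "b = pd 1 (pd 2 e) y"
  define d where "d = pd 2 (pd 2 e) y"
  have pdk: "pd i gdet y = pd i (pd 1 (pd 1 e)) y * d + a * pd i (pd 2 (pd 2 e)) y
      - 2 * b * pd i (pd 1 (pd 2 e)) y" for i
    unfolding gdet_def[abs_def]
    by (simp add: pd_diff pd_mult smooth0_intros s y a_def b_def d_def)
  have K: "C1 * d + a * C3 - 2 * b * C2 = 0" "C2 * d + a * C4 - 2 * b * C3 = 0"
    using k0 pdk[of 1] pdk[of 2] c1 by (simp_all add: C1_def C2_def C3_def C4_def)
  have H: "y $ 1 * C1 + y $ 2 * C2 = 0" "y $ 1 * C2 + y $ 2 * C3 = 0" "y $ 1 * C3 + y $ 2 * C4 = 0"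
    using euler2[OF y, of 1 1] euler2[OF y, of 1 2] euler2[OF y, of 2 2] c1
    by (simp_all add: C1_def C2_def C3_def C4_def)
  have Q: "a * (y $ 1)\<^sup>2 + 2 * b * (y $ 1 * y $ 2) + d * (y $ 2)\<^sup>2 > 0"
    using posdef'[OF y, of "y $ 1" "y $ 2"] y
    by (auto simp: a_def b_def d_def vec_eq_iff forall_2 power2_eq_square algebra_simps)
  \<comment> \<open>Multiplied by \<open>q = 2 e\<close>, each third derivative is a combination of the vanishing quantities in \<open>K\<close> and \<open>H\<close>.\<close>
  define q where "q = a * (y $ 1)\<^sup>2 + 2 * b * (y $ 1 * y $ 2) + d * (y $ 2)\<^sup>2"
  have q: "q \<noteq> 0" using Q by (simp add: q_def)
  let ?H1 = "y $ 1 * C1 + y $ 2 * C2" and ?H2 = "y $ 1 * C2 + y $ 2 * C3"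
    and ?H3 = "y $ 1 * C3 + y $ 2 * C4"
  have "q * C1 = (y $ 2)\<^sup>2 * (C1 * d + a * C3 - 2 * b * C2) + a * (y $ 1 * ?H1 - y $ 2 * ?H2)
      + 2 * b * y $ 2 * ?H1"
    "q * C2 = - (y $ 1 * y $ 2) * (C1 * d + a * C3 - 2 * b * C2) + a * y $ 1 * ?H2 + d * y $ 2 * ?H1"
    "q * C3 = - (y $ 1 * y $ 2) * (C2 * d + a * C4 - 2 * b * C3) + a * y $ 1 * ?H3 + d * y $ 2 * ?H2"
    "q * C4 = (y $ 1)\<^sup>2 * (C2 * d + a * C4 - 2 * b * C3) + d * (y $ 2 * ?H3 - y $ 1 * ?H2)
      + 2 * b * y $ 1 * ?H3"
    by (simp_all add: q_def power2_eq_square algebra_simps)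
  then have "q * C1 = 0" "q * C2 = 0" "q * C3 = 0" "q * C4 = 0"
    unfolding K H by simp_all
  then have "C1 = 0" "C2 = 0" "C3 = 0" "C4 = 0" using q by auto
  then show "pd k (pd j (pd i e)) y = 0"
    using exhaust_2[of i] exhaust_2[of j] exhaust_2[of k] c1 
    by (auto simp: C1_def[symmetric] C2_def[symmetric] C3_def[symmetric] C4_def[symmetric])
qed

text \<open>The part of twice the spray of a generalized Berwald surface that is due to the torsion, on a tangent
  plane where the torsion of the compatible connection maps \<open>(\<partial>/\<partial>u\<^sup>1, \<partial>/\<partial>u\<^sup>2)\<close> to the vector \<open>(t1, t2)\<close>.\<close>

definition torsion_spray :: "real \<Rightarrow> real \<Rightarrow> 2 \<Rightarrow> real ^ 2 \<Rightarrow> real" where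
  "torsion_spray t1 t2 l y = (t1 * pd 1 e y + t2 * pd 2 e y) / gdet y * V l y"

lemma smooth0_torsion_spray [smooth0_intros]: "smooth0 (torsion_spray t1 t2 l)"
  unfolding torsion_spray_def[abs_def]
  by (intro smooth0_intros smooth0_divide smooth0_energy gdet_nonzero)

lemma pos_hom_torsion_spray: "pos_hom 2 (torsion_spray t1 t2 l)"
  using pos_homD[OF pos_hom_pd_energy] pos_homD[OF pos_hom_gdet]
  by (simp add: pos_hom_def torsion_spray_def V_def power2_eq_square algebra_simps add_divide_distrib)

text \<open>The left hand side vanishes on Landsberg surfaces. Up to a nonzero factor it is the product of
  \<open>\<beta> = t1 \<partial>e/\<partial>y\<^sup>1 + t2 \<partial>e/\<partial>y\<^sup>2\<close> and a second order differential expression in \<open>gdet\<close>.\<close>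

lemma landsberg_contraction:
  assumes y: "y \<noteq> 0"
  shows "(\<Sum>l\<in>UNIV. pd l e y * (\<Sum>i\<in>UNIV. \<Sum>j\<in>UNIV. \<Sum>k\<in>UNIV. V i y * V j y * V k y *
           pd k (pd j (pd i (torsion_spray t1 t2 l))) y))
    = - 2 * e y / (gdet y)\<^sup>2 * ((t1 * pd 1 e y + t2 * pd 2 e y) *
        (3 * (drv gdet y)\<^sup>2 - 2 * gdet y * drv (drv gdet) y))"
proof -
  define k where "k = gdet"
  define k1 where "k1 = drv gdet"
  define k2 where "k2 = drv k1"
  define b where "b y = t1 * V 2 y - t2 * V 1 y" for y
  define a where "a y = t1 * y $ 2 - t2 * y $ 1" for y :: "real ^ 2"
  \<comment> \<open>\<open>m\<close> is the coefficient of \<open>V\<close> in \<open>torsion_spray t1 t2\<close>; \<open>m1\<close>, \<open>m2\<close>, \<open>m3\<close> are its derivatives along \<open>V\<close>.\<close>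
  define m where "m y = b y / k y" for y
  have K: "has_drv k k1" "has_drv k1 k2"
    unfolding k_def k1_def k2_def by (intro has_drv_drv smooth0_intros)+
  have nz: "k y \<noteq> 0" if "y \<noteq> 0" for y using gdet_nonzero[OF that] by (simp add: k_def)
  have A: "has_drv a b"
  proof (rule has_drv_cong)
    show "has_drv a (\<lambda>y. (0 * y $ 2 + t1 * V 2 y) - (0 * y $ 1 + t2 * V 1 y))"
      unfolding a_def[abs_def] by (intro has_drv_rules has_drv_coord)
  qed (simp add: b_def)
  have B: "has_drv b (\<lambda>y. - (k y * a y))"
  proof (rule has_drv_cong)
    show "has_drv b (\<lambda>y. (0 * V 2 y + t1 * - (gdet y * y $ 2)) - (0 * V 1 y + t2 * - (gdet y * y $ 1)))"
      unfolding b_def[abs_def] by (intro has_drv_rules has_drv_V)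
  qed (simp add: k_def a_def algebra_simps)
  have W: "has_drv (V l) (\<lambda>y. - (k y * y $ l))" for l unfolding k_def by (rule has_drv_V)
  define m1 where "m1 y = (- (k y * a y) * k y - b y * k1 y) / (k y * k y)" for y
  have M1: "has_drv m m1"
    unfolding m_def[abs_def] m1_def[abs_def] by (intro has_drv_divide K B nz)
  define m2 where "m2 y = (((- ((k1 y * a y + k y * b y)) * k y + - (k y * a y) * k1 y)
      - (- (k y * a y) * k1 y + b y * k2 y)) * (k y * k y)
      - (- (k y * a y) * k y - b y * k1 y) * (k1 y * k y + k y * k1 y))
      / ((k y * k y) * (k y * k y))" for y
  have M2: "has_drv m1 m2"
    unfolding m1_def[abs_def] m2_def[abs_def]
    by (intro has_drv_divide has_drv_diff has_drv_mult has_drv_minus K A B) (simp add: nz)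
  define m3 where "m3 = drv m2"
  have M3: "has_drv m2 m3"
    unfolding m3_def
  proof (rule has_drv_drv)
    have "smooth0 k" "smooth0 k1" "smooth0 k2" "smooth0 a" "smooth0 b"
      using K A B smooth0_drv[of k1] has_drv_smooth0 by (auto simp: k2_def)
    then show "smooth0 m2" unfolding m2_def[abs_def]
      by (intro smooth0_divide smooth0_intros) (auto simp: nz)
  qed
  define f where "f l y = m y * V l y" for l y
  define f1 where "f1 l y = m1 y * V l y + m y * - (k y * y $ l)" for l y
  define f2 where "f2 l y = (m2 y * V l y + m1 y * - (k y * y $ l)) +
     (m1 y * - (k y * y $ l) + m y * - (k1 y * y $ l + k y * V l y))" for l y
  define f3 where "f3 l y = ((m3 y * V l y + m2 y * - (k y * y $ l)) +
     (m2 y * - (k y * y $ l) + m1 y * - (k1 y * y $ l + k y * V l y))) +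
     ((m2 y * - (k y * y $ l) + m1 y * - (k1 y * y $ l + k y * V l y)) +
      (m1 y * - (k1 y * y $ l + k y * V l y) +
       m y * - ((k2 y * y $ l + k1 y * V l y) + (k1 y * V l y + k y * - (k y * y $ l)))))" for l y
  have F: "has_drv (f l) (f1 l)" "has_drv (f1 l) (f2 l)" "has_drv (f2 l) (f3 l)" for l
    unfolding f_def[abs_def] f1_def[abs_def] f2_def[abs_def] f3_def[abs_def]
    by (intro has_drv_add has_drv_mult has_drv_minus K W M1 M2 M3 has_drv_coord)+
  have ff: "torsion_spray t1 t2 l = f l" for l
    by (simp add: torsion_spray_def f_def m_def b_def k_def fun_eq_iff)
  have s: "smooth0 (f l)" "pos_hom 2 (f l)" for l
    using smooth0_torsion_spray pos_hom_torsion_spray by (simp_all add: ff[symmetric])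
  have T: "(\<Sum>i\<in>UNIV. \<Sum>j\<in>UNIV. \<Sum>k\<in>UNIV. V i y * V j y * V k y * pd k (pd j (pd i (f l))) y)
     = f3 l y + 4 * k y * f1 l y + 2 * k1 y * f l y" for l
    using third_derivative_along_indicatrix[OF s F y] by (simp add: k_def k1_def)
  \<comment> \<open>In the frame \<open>(V, y)\<close>, only the component along \<open>y\<close> survives the contraction with the gradient of \<open>e\<close>.\<close>
  define X where "X = m3 y + k y * m1 y"
  define Y where "Y = 3 * m2 y * k y + 3 * m1 y * k1 y + m y * k2 y + 3 * (k y)\<^sup>2 * m y"
  have XY: "f3 l y + 4 * k y * f1 l y + 2 * k1 y * f l y = X * V l y - Y * y $ l" for l
    by (simp add: X_def Y_def f_def f1_def f2_def f3_def power2_eq_square algebra_simps)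
  have YE: "Y = b y * (3 * (k1 y)\<^sup>2 - 2 * k y * k2 y) / (k y)\<^sup>2"
  proof -
    have "m1 y = - a y - b y * k1 y / (k y)\<^sup>2"
      using nz[OF y] by (simp add: m1_def field_simps power2_eq_square)
    moreover have "m2 y = - b y + a y * k1 y / k y - b y * k2 y / (k y)\<^sup>2 + 2 * b y * (k1 y)\<^sup>2 / (k y) ^ 3"
      using nz[OF y] by (simp add: m2_def field_simps power2_eq_square power3_eq_cube)
    ultimately show ?thesis
      unfolding Y_def m_def using nz[OF y]
      by (simp only:) (simp add: field_simps power2_eq_square power3_eq_cube)
  qed
  have "pd 1 e y * (X * V 1 y - Y * y $ 1) + pd 2 e y * (X * V 2 y - Y * y $ 2)
      = - Y * (y $ 1 * pd 1 e y + y $ 2 * pd 2 e y)"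
    by (simp add: algebra_simps)
  also have "\<dots> = - 2 * e y * Y" unfolding euler0[OF y] by simp
  also have "\<dots> = - 2 * e y / (gdet y)\<^sup>2 * ((t1 * pd 1 e y + t2 * pd 2 e y) *
        (3 * (drv gdet y)\<^sup>2 - 2 * gdet y * drv (drv gdet) y))"
    by (simp add: YE k_def k1_def k2_def b_def)
  finally show ?thesis
    unfolding sum_2[of "\<lambda>l. pd l e y * _ l"] ff T XY .
qed

theorem torsion_spray_quadratic:
  assumes L: "\<And>y i j k. y \<noteq> 0 \<Longrightarrow> (\<Sum>l\<in>UNIV. pd l e y * pd k (pd j (pd i (torsion_spray t1 t2 l))) y) = 0"
    and y: "y \<noteq> 0"
  shows "pd k (pd j (pd i (torsion_spray t1 t2 l))) y = 0"
proof (cases "t1 = 0 \<and> t2 = 0")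
  case True
  then have "torsion_spray t1 t2 l = (\<lambda>y. 0)" by (simp add: torsion_spray_def fun_eq_iff)
  moreover have "pd i (\<lambda>y. 0) = (\<lambda>y. 0)" for i :: 2 by (simp add: pd_const fun_eq_iff)
  ultimately show ?thesis by simp
next
  case False
  let ?P = "\<lambda>y. 3 * (drv gdet y)\<^sup>2 - 2 * gdet y * drv (drv gdet) y"
  have P: "?P y = 0" if y: "y \<noteq> 0" for y
  proof (rule cancel_linear_form[where P="?P", OF _ _ _ y])
    show "t1 \<noteq> 0 \<or> t2 \<noteq> 0" using False by blast
    show "smooth0 ?P" unfolding power2_eq_square by (intro smooth0_intros)
    fix y :: "real ^ 2" assume y: "y \<noteq> 0"
    have "0 = (\<Sum>i\<in>UNIV. \<Sum>j\<in>UNIV. \<Sum>k\<in>UNIV. V i y * V j y * V k y *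
        (\<Sum>l\<in>UNIV. pd l e y * pd k (pd j (pd i (torsion_spray t1 t2 l))) y))"
      using L[OF y] by simp
    also have "\<dots> = - 2 * e y / (gdet y)\<^sup>2 * ((t1 * pd 1 e y + t2 * pd 2 e y) * ?P y)"
      unfolding landsberg_contraction[OF y, symmetric]
      by (simp only: sum_2) (simp add: algebra_simps)
    finally show "(t1 * pd 1 e y + t2 * pd 2 e y) * ?P y = 0"
      using energy_pos[OF y] gdet_nonzero[OF y] by simp
  qed
  define q where "q y = drv gdet y / gdet y" for y
  have sq: "smooth0 q" unfolding q_def[abs_def] by (intro smooth0_divide smooth0_intros gdet_nonzero)
  have hq: "pos_hom 0 q"
    using pos_hom_drv_gdet pos_hom_gdet by (simp add: pos_hom_def q_def)
  have dq: "has_drv q (\<lambda>y. (q y)\<^sup>2 / 2)"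
  proof (rule has_drv_cong)
    show "has_drv q (\<lambda>y. (drv (drv gdet) y * gdet y - drv gdet y * drv gdet y) / (gdet y * gdet y))"
      unfolding q_def[abs_def] by (intro has_drv_divide has_drv_drv smooth0_intros gdet_nonzero)
    fix y :: "real ^ 2" assume y: "y \<noteq> 0"
    show "(drv (drv gdet) y * gdet y - drv gdet y * drv gdet y) / (gdet y * gdet y) = (q y)\<^sup>2 / 2"
      using P[OF y] gdet_nonzero[OF y]
      by (simp add: q_def divide_simps) (simp add: power2_eq_square algebra_simps)
  qed
  have z: "drv gdet y = 0" if "y \<noteq> 0" for y
    using riccati_on_indicatrix[OF sq hq dq that] gdet_nonzero[OF that] by (simp add: q_def)
  \<comment> \<open>Now \<open>e\<close> is a quadratic form, and each component of \<open>torsion_spray\<close> is a constant times two linear forms.\<close>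
  note C = cartan_tensor_zero[OF z]
  note s = smooth0_intros smooth0_energy
  have W: "pd k (pd j (pd i (\<lambda>y. (t1 * pd 1 e y + t2 * pd 2 e y) / gdet y * pd m e y))) y = 0" for m
  proof -
    let ?b = "\<lambda>y. t1 * pd 1 e y + t2 * pd 2 e y"
    let ?b' = "\<lambda>i y. t1 * pd i (pd 1 e) y + t2 * pd i (pd 2 e) y"
    have 0: "pd i (\<lambda>y. ?b y / gdet y * pd m e y) y
       = (?b' i y * pd m e y + ?b y * pd i (pd m e) y) / gdet y" if "y \<noteq> 0" for i y
      using that gdet_nonzero[OF that]
      by (simp add: pd_mult pd_divide pd_add pd_const s smooth0_divide gdet_nonzero C field_simps)
    have 1: "pd j (pd i (\<lambda>y. ?b y / gdet y * pd m e y)) y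
       = (?b' i y * pd j (pd m e) y + ?b' j y * pd i (pd m e) y) / gdet y" if "y \<noteq> 0" for i j y
    proof -
      have "pd j (pd i (\<lambda>y. ?b y / gdet y * pd m e y)) y
        = pd j (\<lambda>y. (?b' i y * pd m e y + ?b y * pd i (pd m e) y) / gdet y) y"
        by (rule pd_cong[OF _ 0 that]) (intro s smooth0_divide gdet_nonzero)
      also have "\<dots> = (?b' i y * pd j (pd m e) y + ?b' j y * pd i (pd m e) y) / gdet y"
        using that gdet_nonzero[OF that]
        by (simp add: pd_mult pd_divide pd_add pd_const s smooth0_divide gdet_nonzero C)
      finally show ?thesis .
    qed
    have "pd k (pd j (pd i (\<lambda>y. ?b y / gdet y * pd m e y))) y
        = pd k (\<lambda>y. (?b' i y * pd j (pd m e) y + ?b' j y * pd i (pd m e) y) / gdet y) y"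
      by (rule pd_cong[OF _ 1 y]) (intro s smooth0_divide gdet_nonzero)
    then show ?thesis using y gdet_nonzero[OF y]
      by (simp add: pd_mult pd_divide pd_add pd_const s smooth0_divide gdet_nonzero C)
  qed
  show ?thesis
  proof (cases "l = 1")
    case True
    let ?f = "\<lambda>y. (t1 * pd 1 e y + t2 * pd 2 e y) / gdet y * pd 2 e y"
    have f: "smooth0 ?f" by (intro s smooth0_divide gdet_nonzero)
    have "torsion_spray t1 t2 l = (\<lambda>y. - ?f y)"
      using True by (simp add: torsion_spray_def fun_eq_iff)
    moreover have "pd k (pd j (pd i (\<lambda>y. - ?f y))) y = - pd k (pd j (pd i ?f)) y"
    proof -
      have 1: "pd i (\<lambda>y. - ?f y) y = - pd i ?f y" if "y \<noteq> 0" for y i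
        by (rule pd_minus[OF f that])
      have 2: "pd j (pd i (\<lambda>y. - ?f y)) y = - pd j (pd i ?f) y" if "y \<noteq> 0" for y
        using pd_cong[OF smooth0_pd[OF smooth0_minus[OF f]] 1 that] pd_minus[OF smooth0_pd[OF f] that]
        by simp
      show ?thesis
        using pd_cong[OF smooth0_pd[OF smooth0_pd[OF smooth0_minus[OF f]]] 2 y]
          pd_minus[OF smooth0_pd[OF smooth0_pd[OF f]] y] by simp
    qed
    ultimately show ?thesis using W by simp
  next
    case False
    then have "torsion_spray t1 t2 l = (\<lambda>y. (t1 * pd 1 e y + t2 * pd 2 e y) / gdet y * pd 1 e y)"
      by (simp add: torsion_spray_def V_def fun_eq_iff)
    then show ?thesis using W by simp
  qed
qed

end

lemma matrix_inv_inverse: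
  fixes A :: "real ^ 'n ^ 'n"
  assumes "invertible A"
  shows "A ** matrix_inv A = mat 1" "matrix_inv A ** A = mat 1"
proof -
  have "A ** matrix_inv A = mat 1 \<and> matrix_inv A ** A = mat 1"
    unfolding matrix_inv_def by (rule someI_ex) (use assms in \<open>auto simp: invertible_def\<close>)
  then show "A ** matrix_inv A = mat 1" "matrix_inv A ** A = mat 1" by auto
qed

context minkowski_plane
begin

subsection \<open>The spray and the Landsberg tensor on one tangent plane\<close>

text \<open>The inverse of the fundamental tensor.\<close>

definition ginv :: "2 \<Rightarrow> 2 \<Rightarrow> real ^ 2 \<Rightarrow> real" where
  "ginv l m y = matrix_inv (\<chi> i j. pd i (pd j e) y) $ l $ m"

lemma ginv_inverse:
  assumes "y \<noteq> 0"
  shows "(\<Sum>m\<in>UNIV. pd l (pd m e) y * ginv m s y) = (if l = s then 1 else 0)"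
    and "(\<Sum>m\<in>UNIV. ginv l m y * pd m (pd s e) y) = (if l = s then 1 else 0)"
proof -
  let ?A = "\<chi> i j. pd i (pd j e) y"
  have "det ?A = gdet y" by (simp add: det_2 gdet_def e12_commute[OF assms])
  then have inv: "invertible ?A" using gdet_nonzero[OF assms] by (simp add: invertible_det_nz)
  have "(?A ** matrix_inv ?A) $ l $ s = (mat 1 :: real^2^2) $ l $ s"
    "(matrix_inv ?A ** ?A) $ l $ s = (mat 1 :: real^2^2) $ l $ s"
    by (simp_all only: matrix_inv_inverse[OF inv])
  then show "(\<Sum>m\<in>UNIV. pd l (pd m e) y * ginv m s y) = (if l = s then 1 else 0)"
    "(\<Sum>m\<in>UNIV. ginv l m y * pd m (pd s e) y) = (if l = s then 1 else 0)"
    by (simp_all add: matrix_matrix_mult_def mat_def ginv_def)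
qed

lemma ginv_solve:
  assumes "y \<noteq> 0" "\<And>m. r m = (\<Sum>s\<in>UNIV. pd m (pd s e) y * X s)"
  shows "(\<Sum>m\<in>UNIV. ginv l m y * r m) = X l"
proof -
  have "(\<Sum>m\<in>UNIV. ginv l m y * r m) = (\<Sum>m\<in>UNIV. \<Sum>s\<in>UNIV. ginv l m y * pd m (pd s e) y * X s)"
    by (simp add: assms(2) sum_distrib_left mult.assoc)
  also have "\<dots> = (\<Sum>s\<in>UNIV. (\<Sum>m\<in>UNIV. ginv l m y * pd m (pd s e) y) * X s)"
    by (subst sum.swap) (simp add: sum_distrib_right)
  also have "\<dots> = X l" by (simp add: ginv_inverse[OF assms(1)] if_distrib[of "\<lambda>x. x * _"] cong: if_cong)
  finally show ?thesis .
qed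

lemma ginv_injective:
  assumes "y \<noteq> 0" "\<And>l. (\<Sum>m\<in>UNIV. ginv l m y * r m) = 0"
  shows "r s = 0"
proof -
  have "r s = (\<Sum>m\<in>UNIV. (\<Sum>l\<in>UNIV. pd s (pd l e) y * ginv l m y) * r m)"
    by (simp add: ginv_inverse[OF assms(1)] if_distrib[of "\<lambda>x. x * _"] cong: if_cong)
  also have "\<dots> = (\<Sum>l\<in>UNIV. pd s (pd l e) y * (\<Sum>m\<in>UNIV. ginv l m y * r m))"
    by (simp add: sum_distrib_left sum_distrib_right mult.assoc) (rule sum.swap)
  also have "\<dots> = 0" by (simp add: assms(2))
  finally show ?thesis .
qed

end

text \<open>A tangent plane, together with the Christoffel symbols \<open>\<Gamma> k i j\<close> of a connection at its base point.\<close>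

locale berwald_plane = minkowski_plane +
  fixes \<Gamma> :: "2 \<Rightarrow> 2 \<Rightarrow> 2 \<Rightarrow> real"
begin

text \<open>If the connection is compatible with the metric, then \<open>\<xi> i\<close> is the partial derivative of the energy with
  respect to the base coordinate \<open>x\<^sup>i\<close>.\<close>

definition \<xi> :: "2 \<Rightarrow> real ^ 2 \<Rightarrow> real" where
  "\<xi> i y = (\<Sum>k\<in>UNIV. \<Sum>j\<in>UNIV. \<Gamma> k i j * y $ j * pd k e y)"

text \<open>Twice the torsion part of the spray.\<close>

definition tors :: "2 \<Rightarrow> real ^ 2 \<Rightarrow> real" where
  "tors = torsion_spray (\<Gamma> 1 1 2 - \<Gamma> 1 2 1) (\<Gamma> 2 1 2 - \<Gamma> 2 2 1)"

text \<open>The spray coefficients in closed form.\<close>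

definition G :: "2 \<Rightarrow> real ^ 2 \<Rightarrow> real" where
  "G l y = (1/2) * (\<Sum>k\<in>UNIV. \<Sum>j\<in>UNIV. \<Gamma> l k j * (y $ k * y $ j)) + (1/2) * tors l y"

lemma smooth0_tors [smooth0_intros]: "smooth0 (tors l)"
  by (simp add: tors_def smooth0_torsion_spray)

lemma smooth0_G [smooth0_intros]: "smooth0 (G l)"
  unfolding G_def[abs_def] by (intro smooth0_intros)

lemma smooth0_\<xi> [smooth0_intros]: "smooth0 (\<xi> i)"
  unfolding \<xi>_def[abs_def] by (intro smooth0_intros smooth0_energy)

lemma lower_tors:
  assumes y: "y \<noteq> 0"
  shows "(\<Sum>s\<in>UNIV. pd m (pd s e) y * tors s y)
    = (\<Sum>k\<in>UNIV. \<Sum>r\<in>UNIV. (\<Gamma> r k m - \<Gamma> r m k) * y $ k * pd r e y)"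
proof -
  define b where "b = (\<Gamma> 1 1 2 - \<Gamma> 1 2 1) * pd 1 e y + (\<Gamma> 2 1 2 - \<Gamma> 2 2 1) * pd 2 e y"
  have t: "tors s y = b / gdet y * V s y" for s
    by (simp add: tors_def torsion_spray_def b_def)
  have c: "pd m (pd s e) y = pd s (pd m e) y" for s
    by (rule pd_commute[OF smooth0_energy y])
  have "(\<Sum>s\<in>UNIV. pd m (pd s e) y * tors s y) = b / gdet y * drv (pd m e) y"
    unfolding t c by (simp add: sum_2 drv_def algebra_simps)
  also have "drv (pd m e) y = (if m = 1 then - (gdet y * y $ 2) else gdet y * y $ 1)"
  proof (cases "m = 1")
    case True
    then have "pd m e = V 2" by (simp add: fun_eq_iff)
    then show ?thesis using has_drv_eq[OF has_drv_V y, of 2] True by simp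
  next
    case False
    then have "m = 2" using exhaust_2[of m] by simp
    then have "V 1 = (\<lambda>y. - pd m e y)" by (simp add: fun_eq_iff)
    then have "drv (\<lambda>y. - pd m e y) y = - (gdet y * y $ 1)"
      using has_drv_eq[OF has_drv_V y, of 1] by simp
    then show ?thesis
      using has_drv_eq[OF has_drv_minus[OF has_drv_drv[OF smooth0_pd[OF smooth0_energy]]] y, of m] False
      by simp
  qed
  also have "b / gdet y * \<dots> = (if m = 1 then - (b * y $ 2) else b * y $ 1)"
    using gdet_nonzero[OF y] by simp
  finally show ?thesis
    using exhaust_2[of m] by (auto simp: sum_2 b_def algebra_simps)
qed

lemma pd_\<xi>:
  assumes y: "y \<noteq> 0"
  shows "pd m (\<xi> k) y = (\<Sum>r\<in>UNIV. \<Gamma> r k m * pd r e y)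
      + (\<Sum>r\<in>UNIV. \<Sum>j\<in>UNIV. \<Gamma> r k j * y $ j * pd m (pd r e) y)"
proof -
  have "pd m (\<xi> k) y = (\<Sum>r\<in>UNIV. \<Sum>j\<in>UNIV. \<Gamma> r k j * (if m = j then 1 else 0) * pd r e y
      + \<Gamma> r k j * y $ j * pd m (pd r e) y)"
    unfolding \<xi>_def[abs_def] using y smooth0_energy
    by (simp add: pd_sum pd_mult pd_const pd_coord smooth0_intros)
  also have "\<dots> = (\<Sum>r\<in>UNIV. \<Gamma> r k m * pd r e y)
      + (\<Sum>r\<in>UNIV. \<Sum>j\<in>UNIV. \<Gamma> r k j * y $ j * pd m (pd r e) y)"
    by (simp add: sum.distrib if_distrib[of "\<lambda>x. _ * x"] if_distrib[of "\<lambda>x. x * _"] cong: if_cong)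
  finally show ?thesis .
qed

text \<open>The left hand side is the definition of the spray, with \<open>\<xi> k\<close> in the place of \<open>\<partial>E/\<partial>x\<^sup>k\<close>.\<close>

lemma spray_on_plane:
  assumes y: "y \<noteq> 0"
  shows "(1/2) * (\<Sum>m\<in>UNIV. ginv l m y * ((\<Sum>k\<in>UNIV. y $ k * pd m (\<xi> k) y) - \<xi> m y)) = G l y"
proof -
  define X where "X s = (\<Sum>k\<in>UNIV. \<Sum>j\<in>UNIV. \<Gamma> s k j * (y $ k * y $ j)) + tors s y" for s
  have "(\<Sum>k\<in>UNIV. y $ k * pd m (\<xi> k) y) - \<xi> m y = (\<Sum>s\<in>UNIV. pd m (pd s e) y * X s)" for m
  proof -
    have "(\<Sum>s\<in>UNIV. pd m (pd s e) y * X s) = (\<Sum>s\<in>UNIV. pd m (pd s e) y *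
        (\<Sum>k\<in>UNIV. \<Sum>j\<in>UNIV. \<Gamma> s k j * (y $ k * y $ j))) + (\<Sum>s\<in>UNIV. pd m (pd s e) y * tors s y)"
      by (simp add: X_def distrib_left sum.distrib)
    then show ?thesis
      unfolding lower_tors[OF y] pd_\<xi>[OF y] \<xi>_def by (simp add: sum_2 algebra_simps)
  qed
  from ginv_solve[OF y this] show ?thesis by (simp add: G_def X_def)
qed

lemma pd_G:
  assumes y: "y \<noteq> 0"
  shows "pd i (G l) y = (1/2) * (\<Sum>j\<in>UNIV. (\<Gamma> l i j + \<Gamma> l j i) * y $ j) + (1/2) * pd i (tors l) y"
proof -
  have "pd i (G l) y = (1/2) * (\<Sum>k\<in>UNIV. \<Sum>j\<in>UNIV. \<Gamma> l k j * ((if i = k then 1 else 0) * y $ j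
      + y $ k * (if i = j then 1 else 0))) + (1/2) * pd i (tors l) y"
    unfolding G_def[abs_def] using y
    by (simp add: pd_add pd_sum pd_mult pd_const pd_coord pd_divide_const smooth0_intros)
  then show ?thesis using exhaust_2[of i] by (auto simp: sum_2 algebra_simps)
qed

text \<open>The energy is constant along the horizontal vector fields \<open>X\<^sub>i\<^sup>h\<close> of the spray.\<close>

lemma \<xi>_eq_G:
  assumes y: "y \<noteq> 0"
  shows "\<xi> i y = (\<Sum>l\<in>UNIV. pd i (G l) y * pd l e y)"
proof -
  have orth: "(\<Sum>l\<in>UNIV. tors l y * pd l e y) = 0" for y
    by (simp add: sum_2 tors_def torsion_spray_def)
  have "0 = pd i (\<lambda>y. \<Sum>l\<in>UNIV. tors l y * pd l e y) y"
    unfolding orth by (simp add: pd_const)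
  also have "\<dots> = (\<Sum>l\<in>UNIV. pd i (tors l) y * pd l e y) + (\<Sum>l\<in>UNIV. pd i (pd l e) y * tors l y)"
    using y smooth0_energy by (simp add: pd_sum pd_mult smooth0_intros sum.distrib mult.commute)
  finally have "(\<Sum>l\<in>UNIV. pd i (tors l) y * pd l e y)
     = - (\<Sum>k\<in>UNIV. \<Sum>r\<in>UNIV. (\<Gamma> r k i - \<Gamma> r i k) * y $ k * pd r e y)"
    unfolding lower_tors[OF y] by simp
  moreover have "(\<Sum>l\<in>UNIV. pd i (G l) y * pd l e y) = (1/2) * (\<Sum>l\<in>UNIV. \<Sum>j\<in>UNIV. (\<Gamma> l i j + \<Gamma> l j i) * y $ j * pd l e y)
      + (1/2) * (\<Sum>l\<in>UNIV. pd i (tors l) y * pd l e y)"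
    unfolding pd_G[OF y] by (simp add: sum_2 algebra_simps)
  ultimately show ?thesis by (simp add: \<xi>_def sum_2 algebra_simps)
qed

text \<open>The contents of the parentheses in the definition of the Landsberg tensor, with \<open>\<xi> i\<close> in the place of
  \<open>\<partial>E/\<partial>x\<^sup>i\<close>.\<close>

definition landsberg_bracket :: "2 \<Rightarrow> 2 \<Rightarrow> 2 \<Rightarrow> real ^ 2 \<Rightarrow> real" where
  "landsberg_bracket i j m y =
     (pd j (pd m (\<xi> i)) y - (\<Sum>l\<in>UNIV. pd i (G l) y * pd l (pd j (pd m e)) y))
      - (\<Sum>k\<in>UNIV. pd j (pd i (G k)) y * pd k (pd m e) y)
      - (\<Sum>k\<in>UNIV. pd m (pd i (G k)) y * pd j (pd k e) y)"

text \<open>The second derivative of \<open>\<xi>_eq_G\<close> with respect to the fibre coordinates.\<close>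

lemma landsberg_bracket_eq:
  assumes y: "y \<noteq> 0"
  shows "landsberg_bracket i j m y = (\<Sum>l\<in>UNIV. pd l e y * pd j (pd m (pd i (G l))) y)"
proof -
  note s = smooth0_intros smooth0_energy
  have 1: "pd m (\<xi> i) y = (\<Sum>l\<in>UNIV. pd m (pd i (G l)) y * pd l e y + pd i (G l) y * pd m (pd l e) y)"
    if "y \<noteq> 0" for y
    using pd_cong[OF smooth0_\<xi> \<xi>_eq_G that] that by (simp add: pd_sum pd_mult s)
  have 2: "pd j (pd m (\<xi> i)) y = (\<Sum>l\<in>UNIV. (pd j (pd m (pd i (G l))) y * pd l e y
       + pd m (pd i (G l)) y * pd j (pd l e) y)
       + (pd j (pd i (G l)) y * pd m (pd l e) y + pd i (G l) y * pd j (pd m (pd l e)) y))"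
    using pd_cong[OF smooth0_pd[OF smooth0_\<xi>] 1 y] y by (simp add: pd_sum pd_mult pd_add s)
  have c1: "pd m (pd l e) y = pd l (pd m e) y" if "y \<noteq> 0" for l y
    by (rule pd_commute[OF smooth0_energy that])
  have c2: "pd j (pd m (pd l e)) y = pd l (pd j (pd m e)) y" for l
  proof -
    have "pd j (pd m (pd l e)) y = pd j (pd l (pd m e)) y"
      by (rule pd_cong[OF _ c1 y]) (intro s)
    then show ?thesis using pd_commute[OF smooth0_pd[OF smooth0_energy] y] by simp
  qed
  show ?thesis
    unfolding landsberg_bracket_def 2 c2 c1[OF y]
    by (simp add: sum.distrib sum_subtractf algebra_simps)
qed

lemma pd3_G:
  assumes y: "y \<noteq> 0"
  shows "pd k (pd j (pd i (G l))) y = (1/2) * pd k (pd j (pd i (tors l))) y"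
proof -
  note s = smooth0_intros
  have 1: "pd j (pd i (G l)) y = (1/2) * (\<Gamma> l i j + \<Gamma> l j i) + (1/2) * pd j (pd i (tors l)) y"
    if "y \<noteq> 0" for y
  proof -
    have "pd j (pd i (G l)) y = (1/2) * (\<Sum>k\<in>UNIV. (\<Gamma> l i k + \<Gamma> l k i) * (if j = k then 1 else 0))
        + (1/2) * pd j (pd i (tors l)) y"
      using pd_cong[OF smooth0_pd[OF smooth0_G] pd_G that] that
      by (simp add: pd_add pd_sum pd_mult pd_const pd_coord pd_divide_const s)
    then show ?thesis by (simp add: if_distrib[of "\<lambda>x. _ * x"] cong: if_cong)
  qed
  show ?thesis
    using pd_cong[OF smooth0_pd[OF smooth0_pd[OF smooth0_G]] 1 y] y
    by (simp add: pd_add pd_mult pd_const pd_divide_const s)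
qed

theorem landsberg_iff_berwald_on_plane:
  "(\<forall>y. y \<noteq> 0 \<longrightarrow> (\<forall>l i j. (1/2) * (\<Sum>m\<in>UNIV. ginv l m y * landsberg_bracket i j m y) = 0))
   \<longleftrightarrow> (\<forall>y. y \<noteq> 0 \<longrightarrow> (\<forall>l i j k. pd k (pd j (pd i (G l))) y = 0))"
proof (intro iffI allI impI)
  fix y :: "real ^ 2" and l i j
  assume "\<forall>y. y \<noteq> 0 \<longrightarrow> (\<forall>l i j k. pd k (pd j (pd i (G l))) y = 0)" and "y \<noteq> 0"
  then show "(1/2) * (\<Sum>m\<in>UNIV. ginv l m y * landsberg_bracket i j m y) = 0"
    by (simp add: landsberg_bracket_eq)
next
  fix y :: "real ^ 2" and l i j k
  assume L: "\<forall>y. y \<noteq> 0 \<longrightarrow> (\<forall>l i j. (1/2) * (\<Sum>m\<in>UNIV. ginv l m y * landsberg_bracket i j m y) = 0)"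
    and y: "y \<noteq> 0"
  have "(\<Sum>l\<in>UNIV. pd l e y * pd k (pd j (pd i (tors l))) y) = 0" if "y \<noteq> 0" for i j k y
  proof -
    have "landsberg_bracket i k j y = 0"
      by (rule ginv_injective[OF that]) (use L that in auto)
    then show ?thesis using that
      by (simp add: landsberg_bracket_eq pd3_G sum_divide_distrib[symmetric])
  qed
  then show "pd k (pd j (pd i (G l))) y = 0"
    using torsion_spray_quadratic[OF _ y] pd3_G[OF y] by (simp add: tors_def)
qed

end

section \<open>From the tangent bundle to a single tangent plane\<close>

lemma matrix_inv_2:
  fixes M :: "real ^ 2 ^ 2"
  assumes "det M \<noteq> 0"
  shows "matrix_inv M $ i $ j =
    (if i = 1 then if j = 1 then M $ 2 $ 2 / det M else - M $ 1 $ 2 / det M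
     else if j = 1 then - M $ 2 $ 1 / det M else M $ 1 $ 1 / det M)"
proof -
  let ?B = "\<chi> i j. (if i = 1 then if j = 1 then M $ 2 $ 2 / det M else - M $ 1 $ 2 / det M
     else if j = 1 then - M $ 2 $ 1 / det M else M $ 1 $ 1 / det M) :: real ^ 2 ^ 2"
  have "M ** ?B = mat 1"
    using assms
    by (simp add: vec_eq_iff forall_2 matrix_matrix_mult_def sum_2 mat_def det_2 diff_divide_distrib[symmetric]
        add_divide_distrib[symmetric] mult.commute)
  then have "matrix_inv M = matrix_inv M ** M ** ?B" by (simp add: matrix_mul_assoc[symmetric])
  also have "\<dots> = ?B" using assms by (simp add: matrix_inv_inverse invertible_det_nz)
  finally show ?thesis by simp
qed

lemma smooth_on_pdx: "smooth_on S f \<Longrightarrow> smooth_on S (pdx i f)"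
  unfolding pdx_def[abs_def] by (rule smooth_on_frechet_derivative)

lemma smooth_on_pdy: "smooth_on S f \<Longrightarrow> smooth_on S (pdy i f)"
  unfolding pdy_def[abs_def] by (rule smooth_on_frechet_derivative)

lemma pdx_pdy_commute: "open S \<Longrightarrow> smooth_on S f \<Longrightarrow> z \<in> S \<Longrightarrow> pdx i (pdy j f) z = pdy j (pdx i f) z"
  unfolding pdx_def[abs_def] pdy_def[abs_def] by (rule second_derivative_symmetric)

lemma pdy_cong:
  assumes "open S" "smooth_on S f" "\<And>z. z \<in> S \<Longrightarrow> f z = g z" "z \<in> S"
  shows "pdy i f z = pdy i g z"
  unfolding pdy_def
  using frechet_derivative_transform_within_open[OF smooth_on_imp_differentiable[OF assms(2,4)] assms(1,4)] assms(3)
  by simp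

lemma pdy_eq_pd:
  assumes "f differentiable (at (x, y))" shows "pdy i f (x, y) = pd i (\<lambda>y. f (x, y)) y"
proof -
  have "((\<lambda>y. (x, y)) has_derivative (\<lambda>w. (0, w))) (at y)"
    by (auto intro!: derivative_eq_intros)
  from has_derivative_compose[OF this] assms
  have "((\<lambda>y. f (x, y)) has_derivative (\<lambda>w. frechet_derivative f (at (x, y)) (0, w))) (at y)"
    by (simp add: frechet_derivative_works)
  from pd_eqI[OF this] show ?thesis by (simp add: pdy_def)
qed

text \<open>Functions on a part \<open>S\<close> of the tangent bundle without the zero section, in the coordinates \<open>(x, y)\<close>,
  restricted to the tangent space at \<open>x\<close>.\<close>

context
  fixes X :: "(real ^ 'n) set" and S and x
  defines "S \<equiv> X \<times> (UNIV - {0 :: real ^ 'n})"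
  assumes X: "open X" "x \<in> X"
begin

lemma open_slit_bundle: "open S"
  unfolding S_def by (intro open_Times X open_punctured)

lemma smooth0_fibre:
  assumes "smooth_on S f" shows "smooth0 (\<lambda>y. f (x, y))"
  unfolding smooth0_def
proof (rule smooth_on_compose[OF open_punctured _ _ assms])
  have "smooth_on (UNIV - {0}) (\<lambda>y :: real ^ 'n. (x, 0 :: real ^ 'n) + (0, y))"
    by (intro smooth_on_add open_punctured smooth_on_const smooth_on_bounded_linear
          bounded_linear_Pair bounded_linear_zero bounded_linear_ident)
  then show "smooth_on (UNIV - {0}) (\<lambda>y :: real ^ 'n. (x, y))" by simp
qed (use X in \<open>auto simp: S_def\<close>)

lemma pdy_fibre:
  assumes "smooth_on S f" "\<And>y. y \<noteq> 0 \<Longrightarrow> f (x, y) = g y" "y \<noteq> 0"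
  shows "pdy i f (x, y) = pd i g y"
proof -
  have "f differentiable (at (x, y))"
    by (rule smooth_on_imp_differentiable[OF assms(1)]) (use X assms(3) in \<open>auto simp: S_def\<close>)
  then show ?thesis using pdy_eq_pd pd_cong[OF smooth0_fibre[OF assms(1)] assms(2,3)] by metis
qed

end

text \<open>A surface with a Finsler metric and a compatible linear connection.\<close>

locale generalized_berwald_surface = surface_connection A D
  for A :: "('m::{t2_space, second_countable_topology}, 2) chart set" and D +
  fixes F :: "'m \<Rightarrow> 'm tvec \<Rightarrow> real"
  assumes metric: "finsler_metric A F" and compatible: "compatible_connection A F D"

text \<open>A chart \<open>c\<close> and the coordinates \<open>x\<close> of a point in it are fixed. \<open>E\<close> is the energy in the induced
  coordinates, smooth on \<open>S\<close>, and \<open>e\<close> is the energy on the tangent plane at \<open>x\<close>.\<close>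

locale generalized_berwald_surface_point = generalized_berwald_surface A D F
  for A :: "('m::{t2_space, second_countable_topology}, 2) chart set" and D F +
  fixes c :: "('m, 2) chart" and x :: "real ^ 2"
  assumes c: "c \<in> A" and x: "x \<in> im_chart c"
begin

abbreviation S :: "((real ^ 2) \<times> (real ^ 2)) set" where
  "S \<equiv> im_chart c \<times> (UNIV - {0})"

abbreviation E :: "(real ^ 2) \<times> (real ^ 2) \<Rightarrow> real" where
  "E \<equiv> loc A c (energy F)"

abbreviation e :: "real ^ 2 \<Rightarrow> real" where
  "e \<equiv> \<lambda>y. E (x, y)"

abbreviation \<Gamma> :: "2 \<Rightarrow> 2 \<Rightarrow> 2 \<Rightarrow> real" where
  "\<Gamma> \<equiv> christoffel A D c (inv_chart c x)"

lemma open_S: "open S"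
  by (rule open_slit_bundle[OF open_im[OF c] x])

lemma in_S: "y \<noteq> 0 \<Longrightarrow> (x, y) \<in> S"
  using x by simp

lemmas pdy_fib = pdy_fibre[OF open_im[OF c] x]

lemma smooth_on_loc: "smooth_on S (loc A c F)"
  using metric c unfolding finsler_metric_def by blast

lemma E_eq: "E = (\<lambda>z. (loc A c F z * loc A c F z) / 2)"
  by (auto simp: loc_def energy_def power2_eq_square fun_eq_iff)

lemma smooth_on_E: "smooth_on S E"
  unfolding E_eq by (intro smooth_on_divide smooth_on_mult open_S smooth_on_loc smooth_on_const) simp

lemma pdy_E: "y \<noteq> 0 \<Longrightarrow> pdy i E (x, y) = pd i e y"
  by (rule pdy_fib[OF smooth_on_E]) simp_all

lemma fundamental_tensor_fibre: "y \<noteq> 0 \<Longrightarrow> fundamental_tensor E i j (x, y) = pd i (pd j e) y"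
  unfolding fundamental_tensor_def by (rule pdy_fib[OF smooth_on_pdy[OF smooth_on_E] pdy_E])

lemma posdef_fundamental_matrix:
  assumes "z \<in> S" "w \<noteq> 0" shows "w \<bullet> (fundamental_matrix E z *v w) > 0"
proof -
  have "\<forall>c\<in>A. \<forall>x\<in>im_chart c. \<forall>y. y \<noteq> 0 \<longrightarrow>
        (\<forall>w. w \<noteq> 0 \<longrightarrow> w \<bullet> (fundamental_matrix (loc A c (energy F)) (x, y) *v w) > 0)"
    using metric unfolding finsler_metric_def by (elim conjE)
  from this[rule_format, OF c _ _ assms(2), of "fst z" "snd z"] show ?thesis
    using assms(1) by (simp add: mem_Times_iff)
qed

lemma minkowski_plane_fibre: "minkowski_plane e"
proof
  show "smooth0 e" by (rule smooth0_fibre[OF open_im[OF c] x smooth_on_E])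
  show "pos_hom 2 e"
  proof -
    have p: "inv_chart c x \<in> dom_chart c" by (rule inv_chart_in[OF c x])
    have "F (inv_chart c x) (coord_vec A c (inv_chart c x) (t *\<^sub>R y))
        = t * F (inv_chart c x) (coord_vec A c (inv_chart c x) y)" if "t > 0" for t y
    proof -
      have "\<forall>p. \<forall>v\<in>tangent_space A p. \<forall>t>0. F p (tscale t v) = t * F p v"
        using metric unfolding finsler_metric_def by (elim conjE)
      from this[rule_format, OF coord_vec_in[OF c p] that] show ?thesis
        by (simp add: coord_vec_scale[OF c p])
    qed
    then show ?thesis by (simp add: pos_hom_def loc_def energy_def power2_eq_square)
  qed
  fix y w :: "real ^ 2" assume y: "y \<noteq> 0" and w: "w \<noteq> 0"
  have "fundamental_matrix E (x, y) = (\<chi> i j. pd i (pd j e) y)"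
    using y by (simp add: fundamental_matrix_def fundamental_tensor_fibre)
  then show "w \<bullet> ((\<chi> i j. pd i (pd j e) y) *v w) > 0"
    using posdef_fundamental_matrix[OF in_S[OF y] w] by simp
qed

sublocale berwald_plane e \<Gamma>
  unfolding berwald_plane_def by (rule minkowski_plane_fibre)

text \<open>Compatibility of the connection, restated for the energy.\<close>

lemma pdx_E:
  assumes y: "y \<noteq> 0" shows "pdx i E (x, y) = \<xi> i y"
proof -
  let ?L = "loc A c F"
  have d: "?L differentiable (at (x, y))"
    by (rule smooth_on_imp_differentiable[OF smooth_on_loc in_S[OF y]])
  then have "(E has_derivative (\<lambda>v. ?L (x, y) * frechet_derivative ?L (at (x, y)) v)) (at (x, y))"
    unfolding E_eq frechet_derivative_works by (auto intro!: derivative_eq_intros)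
  from frechet_derivative_at[OF this]
  have E': "frechet_derivative E (at (x, y)) v = ?L (x, y) * frechet_derivative ?L (at (x, y)) v" for v
    by metis
  have "pdx i E (x, y) = ?L (x, y) * pdx i ?L (x, y)" by (simp add: pdx_def E')
  also have "\<dots> = (\<Sum>k\<in>UNIV. \<Sum>j\<in>UNIV. \<Gamma> k i j * y $ j * (?L (x, y) * pdy k ?L (x, y)))"
    unfolding compatible_horizontal_constancy[OF compatible c x d]
    by (simp add: sum_distrib_left mult_ac)
  also have "\<dots> = (\<Sum>k\<in>UNIV. \<Sum>j\<in>UNIV. \<Gamma> k i j * y $ j * pdy k E (x, y))"
    by (simp add: pdy_def E')
  finally show ?thesis by (simp add: \<xi>_def pdy_E[OF y])
qed

lemma inverse_tensor_fibre: "y \<noteq> 0 \<Longrightarrow> inverse_tensor E l m (x, y) = ginv l m y"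
  by (simp add: inverse_tensor_def ginv_def fundamental_matrix_def fundamental_tensor_fibre)

lemma smooth_on_fundamental_tensor: "smooth_on S (fundamental_tensor E i j)"
  unfolding fundamental_tensor_def by (intro smooth_on_pdy smooth_on_E)

lemma det_fundamental_matrix_nonzero:
  assumes z: "z \<in> S" shows "det (fundamental_matrix E z) \<noteq> 0"
proof
  assume 0: "det (fundamental_matrix E z) = 0"
  obtain w where w: "w \<noteq> 0" "fundamental_matrix E z *v w = 0"
    using 0 invertible_det_nz[of "fundamental_matrix E z"] invertible_left_inverse matrix_left_invertible_ker
    by metis
  then show False using posdef_fundamental_matrix[OF z w(1)] by simp
qed

lemma smooth_on_inverse_tensor: "smooth_on S (inverse_tensor E l m)"
proof -
  let ?g = "fundamental_tensor E"
  have d: "smooth_on S (\<lambda>z. det (fundamental_matrix E z))"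
    unfolding det_2 fundamental_matrix_def
    by (simp, intro smooth_on_diff smooth_on_mult open_S smooth_on_fundamental_tensor)
  show ?thesis
  proof (rule smooth_on_cong[OF open_S])
    show "smooth_on S (\<lambda>z. (if l = 1 then if m = 1 then ?g 2 2 z else - ?g 1 2 z
        else if m = 1 then - ?g 2 1 z else ?g 1 1 z) / det (fundamental_matrix E z))"
      by (rule smooth_on_divide[OF open_S _ d det_fundamental_matrix_nonzero])
         (cases "l = 1"; cases "m = 1"; simp add: smooth_on_minus[OF open_S] smooth_on_fundamental_tensor)
  next
    fix z assume z: "z \<in> S"
    show "(if l = 1 then if m = 1 then ?g 2 2 z else - ?g 1 2 z
        else if m = 1 then - ?g 2 1 z else ?g 1 1 z) / det (fundamental_matrix E z) = inverse_tensor E l m z"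
      unfolding inverse_tensor_def matrix_inv_2[OF det_fundamental_matrix_nonzero[OF z]]
      by (simp add: fundamental_matrix_def)
  qed
qed

text \<open>Smoothness in \<open>(x, y)\<close> is needed even though only \<open>y\<close>-derivatives of the spray occur: \<open>pdy\<close> is defined by the
  Frechet derivative in both variables.\<close>

lemma smooth_on_spray: "smooth_on S (spray E l)"
  unfolding spray_def[abs_def]
  by (intro smooth_on_mult smooth_on_sum smooth_on_diff smooth_on_const smooth_on_pdy smooth_on_pdx
        smooth_on_E smooth_on_inverse_tensor open_S smooth_on_bounded_linear
        bounded_linear_compose[OF bounded_linear_vec_nth bounded_linear_snd])

lemma spray_fibre:
  assumes y: "y \<noteq> 0" shows "spray E l (x, y) = G l y"
proof -
  have "pdy m (pdx k E) (x, y) = pd m (\<xi> k) y" for m k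
    by (rule pdy_fib[OF smooth_on_pdx[OF smooth_on_E] pdx_E y])
  then show ?thesis
    using spray_on_plane[OF y] by (simp add: spray_def inverse_tensor_fibre[OF y] pdx_E[OF y])
qed

lemma spray1_fibre: "y \<noteq> 0 \<Longrightarrow> spray1 E l i (x, y) = pd i (G l) y"
  unfolding spray1_def by (rule pdy_fib[OF smooth_on_spray spray_fibre])

lemma smooth_on_spray1: "smooth_on S (spray1 E l i)"
  unfolding spray1_def by (intro smooth_on_pdy smooth_on_spray)

lemma smooth_on_spray2: "smooth_on S (spray2 E l i j)"
  unfolding spray2_def by (intro smooth_on_pdy smooth_on_spray1)

lemma spray2_fibre: "y \<noteq> 0 \<Longrightarrow> spray2 E l i j (x, y) = pd j (pd i (G l)) y"
  unfolding spray2_def by (rule pdy_fib[OF smooth_on_spray1 spray1_fibre])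

lemma spray3_fibre: "y \<noteq> 0 \<Longrightarrow> spray3 E l i j k (x, y) = pd k (pd j (pd i (G l))) y"
  unfolding spray3_def by (rule pdy_fib[OF smooth_on_spray2 spray2_fibre])

lemma pdx_fundamental_tensor:
  assumes y: "y \<noteq> 0" shows "pdx i (fundamental_tensor E j m) (x, y) = pd j (pd m (\<xi> i)) y"
proof -
  note s = smooth_on_E smooth_on_pdy[OF smooth_on_E] smooth_on_pdx[OF smooth_on_E]
  have "pdx i (fundamental_tensor E j m) (x, y) = pdy j (pdx i (pdy m E)) (x, y)"
    unfolding fundamental_tensor_def by (rule pdx_pdy_commute[OF open_S s(2) in_S[OF y]])
  also have "\<dots> = pdy j (pdy m (pdx i E)) (x, y)"
    by (rule pdy_cong[OF open_S smooth_on_pdx[OF s(2)] pdx_pdy_commute[OF open_S s(1)] in_S[OF y]])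
  also have "\<dots> = pd j (pd m (\<xi> i)) y"
    by (rule pdy_fib[OF smooth_on_pdy[OF s(3)] pdy_fib[OF s(3) pdx_E] y])
  finally show ?thesis .
qed

lemma landsberg_tensor_fibre:
  assumes y: "y \<noteq> 0"
  shows "landsberg_tensor E l i j (x, y) = (1/2) * (\<Sum>m\<in>UNIV. ginv l m y * landsberg_bracket i j m y)"
proof -
  have "pdy l (fundamental_tensor E j m) (x, y) = pd l (pd j (pd m e)) y" for l m
    by (rule pdy_fib[OF smooth_on_fundamental_tensor fundamental_tensor_fibre y])
  then show ?thesis
    by (simp add: landsberg_tensor_def landsberg_bracket_def hor_def y inverse_tensor_fibre
        fundamental_tensor_fibre spray1_fibre spray2_fibre pdx_fundamental_tensor)
qed

lemma landsberg_iff_berwald_at_point: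
  "(\<forall>y. y \<noteq> 0 \<longrightarrow> (\<forall>l i j. landsberg_tensor E l i j (x, y) = 0)) \<longleftrightarrow>
   (\<forall>y. y \<noteq> 0 \<longrightarrow> (\<forall>l i j k. mixed_curvature E l i j k (x, y) = 0))"
  using landsberg_iff_berwald_on_plane
  by (simp add: landsberg_tensor_fibre mixed_curvature_def spray3_fibre)

end

theorem theorem3:
  fixes A :: "('m::{t2_space, second_countable_topology}, 2) chart set"
    and F :: "'m \<Rightarrow> 'm tvec \<Rightarrow> real"
  assumes "generalized_berwald_manifold A F"
    and "connected (UNIV :: 'm set)"
    and "\<not> riemannian A F"
  shows "landsberg_manifold A F \<longleftrightarrow> berwald_manifold A F"
proof -
  obtain D where D: "linear_connection A D" "compatible_connection A F D"
    and A: "smooth_manifold A" "finsler_metric A F"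
    using assms(1) unfolding generalized_berwald_manifold_def finsler_manifold_def
    by (elim conjE exE) (rule that)
  have surface: "generalized_berwald_surface A D F"
    by unfold_locales (use D A in auto)
  have pointwise: "(\<forall>y. y \<noteq> 0 \<longrightarrow> (\<forall>l i j. landsberg_tensor (loc A c (energy F)) l i j (x, y) = 0)) \<longleftrightarrow>
   (\<forall>y. y \<noteq> 0 \<longrightarrow> (\<forall>l i j k. mixed_curvature (loc A c (energy F)) l i j k (x, y) = 0))"
    if "c \<in> A" "x \<in> im_chart c" for c x
  proof -
    interpret generalized_berwald_surface_point A D F c x
      using surface that
      by (simp add: generalized_berwald_surface_point_def generalized_berwald_surface_point_axioms_def)
    show ?thesis by (rule landsberg_iff_berwald_at_point)
  qed
  show ?thesis
    unfolding landsberg_manifold_def berwald_manifold_def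
    by (intro conj_cong ball_cong refl pointwise)
qed

end
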